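(* For any positive integer $q$ and any odd positive integer $\ell$, there exists an integer $N_{q,\ell}$ such that for any positive integer $n\ge N_{q,\ell}$, the product $(1^{\ell}+q^{\ell})(2^{\ell}+q^{\ell})\cdots (n^{\ell}+q^{\ell})$ is not a powerful number.
   Context: A positive integer $t$ is called a powerful number if $t>1$ and $p^2\mid t$ for every prime divisor $p$ of $t$. *)

theory Defs
  imports Complex_Main "HOL-Computational_Algebra.Primes"
begin

definition powerful :: "nat \<Rightarrow> bool" where
  "powerful t \<longleftrightarrow> t > 1 \<and> (\<forall>p. prime p \<longrightarrow> p dvd t \<longrightarrow> p\<^sup>2 dvd t)"

end

(* For large n it suffices to find a prime p with (n + q)/2 < p <= n + q and gcd(p - 1, l) = 1:
   then x -> x^l permutes the residues mod p, so p divides k^l + q^l only if p divides k + q,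
   i.e. only for k = p - q, and p^2 does not divide (p - q)^l + q^l because its residue mod p^2
   is l p q^(l-1).
   Such primes come from the weight prod (1 - (n/r)) over the primes r dividing l, (n/r) being the
   Legendre symbol; it is nonnegative and vanishes if n = 1 mod some r. Expanding the product gives only
   real characters (the empty one giving zeta), whose L-functions do not vanish on Re s = 1 (the 3-4-1 inequality off the real
   axis, Monsky's Lambert series argument at s = 1). A Tauberian argument with Fejer kernels then
   puts a positive amount of weighted primes into every interval (x/2, x] with x large. *)
theory Submission
  imports Defs "HOL-Complex_Analysis.Complex_Analysis" "HOL-Number_Theory.Number_Theory"
begin


section \<open>Dirichlet series\<close>

text \<open>The target is only a positive lower bound for the weighted primes in a logarithmic
  window of fixed length; proper prime powers contribute O(x^(-1/2) (ln x)^2) to it and are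
  absorbed. Only the class 1 modulo each prime r dividing l has to be excluded, and one quadratic
  character per r achieves this. Since l is odd, so is every r, and a nontrivial Legendre symbol
  exists; for r = 2 the exclusion would be hopeless, as p - 1 is even for p > 2. The obstacle is s =
  1: there the third term of the 3-4-1 inequality meets the pole of zeta too, and 3 - 4 m + 1 >= 0
  still permits a simple zero. Monsky's argument fills this gap. Fejer kernels suit the Tauberian
  step because they are nonnegative and see only a compact piece of the line, on which continuity of
  the extended series gives all bounds. The factor 1/2 in the interval comes from the product: k + q
  stays below 2 p, so p divides k + q for only one k.\<close>

definition abs_conv_beyond_1 :: "(nat \<Rightarrow> real) \<Rightarrow> bool" where
  "abs_conv_beyond_1 a \<longleftrightarrow> (\<forall>\<sigma>>1. summable (\<lambda>n. \<bar>a n\<bar> * real n powr - \<sigma>))"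

text \<open>The term at \<open>n = 0\<close> vanishes, since \<open>0 powr z = 0\<close>.\<close>

definition dirichlet_series :: "(nat \<Rightarrow> real) \<Rightarrow> complex \<Rightarrow> complex" where
  "dirichlet_series a s = (\<Sum>n. of_real (a n) * of_nat n powr - s)"

lemma norm_nat_powr: "norm (of_nat n powr s :: complex) = real n powr Re s"
  by (cases "n = 0") (simp_all add: norm_powr_real_powr)

lemma nat_powr_mult: "of_nat (m * n) powr s = (of_nat m powr s * of_nat n powr s :: complex)"
  using powr_times_real[of "of_real (real m)" "of_real (real n)" s] by simp

lemma abs_conv_beyond_1_norm_summable:
  assumes "abs_conv_beyond_1 a" "Re s > 1"
  shows "summable (\<lambda>n. norm (of_real (a n) * of_nat n powr - s :: complex))"
  using assms by (simp add: abs_conv_beyond_1_def norm_mult norm_nat_powr)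

lemma abs_conv_beyond_1_summable:
  assumes "abs_conv_beyond_1 a" "Re s > 1"
  shows "summable (\<lambda>n. of_real (a n) * of_nat n powr - s :: complex)"
  by (rule summable_norm_cancel[OF abs_conv_beyond_1_norm_summable[OF assms]])

lemma abs_conv_beyond_1_ln:
  assumes "\<And>n. n > 0 \<Longrightarrow> \<bar>a n\<bar> \<le> C * (1 + ln (real n))"
  shows "abs_conv_beyond_1 a"
  unfolding abs_conv_beyond_1_def
proof (intro allI impI)
  fix \<sigma> :: real assume s: "\<sigma> > 1"
  \<comment> \<open>Half the room above 1: bounding the logarithm by n powr e leaves the exponent e
    - sigma = -(1 + sigma) / 2, which is still below -1.\<close>
  define e where "e = (\<sigma> - 1) / 2"
  have e: "e > 0" using s by (simp add: e_def)
  have C: "C \<ge> 0" using assms[of 1] by (auto intro: order_trans[OF abs_ge_zero])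
  have "summable (\<lambda>n. C * (1 + 1/e) * real n powr (e - \<sigma>))"
    using s by (intro summable_mult) (simp add: summable_real_powr_iff e_def field_simps)
  then show "summable (\<lambda>n. \<bar>a n\<bar> * real n powr - \<sigma>)"
  proof (rule summable_comparison_test'[where N = 1])
    fix n :: nat assume n: "1 \<le> n"
    have "ln (real n) \<le> real n powr e / e"
      using ln_powr_bound[of "real n" e] n e by simp
    moreover have "1 \<le> real n powr e" using n e by (simp add: ge_one_powr_ge_zero)
    ultimately have "1 + ln (real n) \<le> (1 + 1/e) * real n powr e" by (simp add: field_simps)
    then have "\<bar>a n\<bar> \<le> C * ((1 + 1/e) * real n powr e)"
      using assms[of n] n C by (meson mult_left_mono order_trans less_le_trans zero_less_one)
    then have "\<bar>a n\<bar> * real n powr - \<sigma> \<le> C * ((1 + 1/e) * real n powr e) * real n powr - \<sigma>"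
      by (intro mult_right_mono) auto
    also have "\<dots> = C * (1 + 1/e) * real n powr (e - \<sigma>)"
      by (simp add: powr_diff powr_minus field_simps)
    finally show "norm (\<bar>a n\<bar> * real n powr - \<sigma>) \<le> C * (1 + 1/e) * real n powr (e - \<sigma>)" by simp
  qed
qed

section \<open>Regrouping double sums by divisors\<close>

lemma dvd_div_pos: "n > 0 \<Longrightarrow> d dvd n \<Longrightarrow> n div d > 0" for n d :: nat
  by (auto elim!: dvdE intro: Nat.gr0I)

text \<open>The bijection (d, e) -> (d e, d) sorts the pairs by their product. Indices are positive
  so that each product has finitely many divisors. Both the product of Dirichlet series and the
  Lambert series are instances.\<close>

lemma infsum_divisors:
  fixes G :: "nat \<Rightarrow> nat \<Rightarrow> 'a::banach"
  assumes "(\<lambda>(d, e). G d e) summable_on ({0<..} \<times> {0<..})"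
  shows "(\<lambda>n. \<Sum>d | d dvd n. G d (n div d)) summable_on {0<..}" (is ?A)
    and "(\<Sum>\<^sub>\<infinity>d\<in>{0<..}. \<Sum>\<^sub>\<infinity>e\<in>{0<..}. G d e) = (\<Sum>\<^sub>\<infinity>n\<in>{0<..}. \<Sum>d | d dvd n. G d (n div d))" (is ?B)
proof -
  let ?D = "\<lambda>n::nat. {d. d dvd n}"
  have S: "(\<lambda>(n, d). G d (n div d)) summable_on (Sigma {0<..} ?D)"
    using assms
    by (subst summable_on_reindex_bij_witness[of _ "\<lambda>(d, e). (d * e, d)" "\<lambda>(n, d). (d, n div d)"
          "{0<..} \<times> {0<..}" "\<lambda>(d, e). G d e"]) (auto simp: dvd_div_pos intro: Nat.gr0I)
  have E: "(\<Sum>\<^sub>\<infinity>d\<in>?D n. G d (n div d)) = (\<Sum>d | d dvd n. G d (n div d))" if "n \<in> {0<..}" for n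
    using that by (intro infsum_finite) auto
  show ?A by (rule summable_on_cong[THEN iffD1, OF E summable_on_Sigma_banach[OF S]])
  have "(\<Sum>\<^sub>\<infinity>d\<in>{0<..}. \<Sum>\<^sub>\<infinity>e\<in>{0<..}. G d e) = (\<Sum>\<^sub>\<infinity>(d, e)\<in>{0<..} \<times> {0<..}. G d e)"
    using assms by (rule infsum_Sigma'_banach)
  also have "\<dots> = (\<Sum>\<^sub>\<infinity>(n, d)\<in>Sigma {0<..} ?D. G d (n div d))"
    by (rule sym, rule infsum_reindex_bij_witness[of _ "\<lambda>(d, e). (d * e, d)" "\<lambda>(n, d). (d, n div d)"])
      (auto simp: dvd_div_pos intro: Nat.gr0I)
  also have "\<dots> = (\<Sum>\<^sub>\<infinity>n\<in>{0<..}. \<Sum>\<^sub>\<infinity>d\<in>?D n. G d (n div d))"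
    using S by (rule infsum_Sigma'_banach[symmetric])
  also have "\<dots> = (\<Sum>\<^sub>\<infinity>n\<in>{0<..}. \<Sum>d | d dvd n. G d (n div d))"
    using E by (intro infsum_cong)
  finally show ?B .
qed

text \<open>Bridge between unordered sums, where regrouping takes place, and ordered series, in
  which \<open>dirichlet_series\<close> is defined.\<close>

lemma infsum_pos_nat:
  fixes f :: "nat \<Rightarrow> 'a::banach"
  assumes "f summable_on {0<..}" "f 0 = 0"
  shows "infsum f {0<..} = suminf f" "f sums infsum f {0<..}"
proof -
  have "(f has_sum infsum f {0<..}) UNIV"
    using has_sum_infsum[OF assms(1)]
    by (rule has_sum_cong_neutral[THEN iffD1, rotated -1]) (use assms(2) in auto)
  then show "f sums infsum f {0<..}" by (rule has_sum_imp_sums)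
  then show "infsum f {0<..} = suminf f" by (simp add: sums_iff)
qed

lemma dirichlet_series_mult:
  assumes a: "abs_conv_beyond_1 a" and b: "abs_conv_beyond_1 b" and s: "Re s > 1"
  shows "dirichlet_series a s * dirichlet_series b s = dirichlet_series (\<lambda>n. \<Sum>d | d dvd n. a d * b (n div d)) s"
proof -
  let ?F = "\<lambda>c n. of_real (c n) * of_nat n powr - s :: complex"
  have F: "(\<lambda>n. norm (?F c n)) summable_on {0<..}" "infsum (?F c) {0<..} = dirichlet_series c s" if "abs_conv_beyond_1 c" for c
  proof -
    have "(\<lambda>n. norm (?F c n)) summable_on UNIV"
      using abs_conv_beyond_1_norm_summable[OF that s] by (subst summable_on_UNIV_nonneg_real_iff) auto
    then show 1: "(\<lambda>n. norm (?F c n)) summable_on {0<..}" by (rule summable_on_subset_banach) auto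
    show "infsum (?F c) {0<..} = dirichlet_series c s"
      unfolding dirichlet_series_def by (rule infsum_pos_nat(1)) (use 1 abs_summable_summable in auto)
  qed
  have "(\<lambda>x. norm ((\<lambda>(d, e). ?F a d * ?F b e) x)) summable_on ({0<..} \<times> {0<..})"
    using F(1)[OF a] F(1)[OF b]
    by (intro Infinite_Sum.abs_summable_on_Sigma_iff[THEN iffD2] conjI ballI)
      (auto simp: norm_mult infsum_cmult_right' abs_mult infsum_nonneg intro!: summable_on_cmult_right summable_on_cmult_left)
  then have S: "(\<lambda>(d, e). ?F a d * ?F b e) summable_on ({0<..} \<times> {0<..})"
    by (rule abs_summable_summable)
  have G: "(\<Sum>d | d dvd n. ?F a d * ?F b (n div d)) = ?F (\<lambda>n. \<Sum>d | d dvd n. a d * b (n div d)) n" for n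
  proof (cases "n = 0")
    \<comment> \<open>Every natural number divides 0, so the divisor sum runs over an infinite set
      and is 0 by convention; the other side vanishes because 0 powr z = 0.\<close>
    case True then show ?thesis by simp
  next
    case False
    have "?F a d * ?F b (n div d) = of_real (a d * b (n div d)) * of_nat n powr - s" if "d dvd n" for d
    proof -
      have "of_nat n powr - s = (of_nat d powr - s * of_nat (n div d) powr - s :: complex)"
        using nat_powr_mult[of d "n div d" "- s"] that by simp
      then show ?thesis by simp
    qed
    then have "(\<Sum>d | d dvd n. ?F a d * ?F b (n div d)) =
        (\<Sum>d | d dvd n. of_real (a d * b (n div d)) * of_nat n powr - s)"
      by (intro sum.cong) auto
    then show ?thesis by (simp only: sum_distrib_right of_real_sum)
  qed
  have "dirichlet_series a s * dirichlet_series b s = infsum (?F a) {0<..} * infsum (?F b) {0<..}" using F(2) a b by simp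
  also have "\<dots> = (\<Sum>\<^sub>\<infinity>d\<in>{0<..}. \<Sum>\<^sub>\<infinity>e\<in>{0<..}. ?F a d * ?F b e)"
    by (subst infsum_cmult_right', subst infsum_cmult_left') (rule refl)
  also have "\<dots> = (\<Sum>\<^sub>\<infinity>n\<in>{0<..}. \<Sum>d | d dvd n. ?F a d * ?F b (n div d))"
    by (rule infsum_divisors(2)[OF S])
  also have "\<dots> = suminf (\<lambda>n. \<Sum>d | d dvd n. ?F a d * ?F b (n div d))"
    by (rule infsum_pos_nat(1)[OF infsum_divisors(1)[OF S]]) simp
  finally show ?thesis unfolding G dirichlet_series_def .
qed


section \<open>Increments of complex powers, and series that are holomorphic for positive real
  part\<close>

lemma closed_segment_nat_Suc:
  assumes "n > 0" "x \<in> closed_segment (of_nat n) (of_nat (Suc n) :: complex)"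
  obtains t where "x = of_real t" "real n \<le> t" "t \<le> real n + 1"
proof -
  from assms(2) obtain u where u: "0 \<le> u" "u \<le> 1" "x = (1 - u) *\<^sub>R of_nat n + u *\<^sub>R of_nat (Suc n)"
    by (auto simp: closed_segment_def)
  then have "x = of_real (real n + u)" by (simp add: scaleR_conv_of_real algebra_simps)
  with u show ?thesis by (intro that[of "real n + u"]) auto
qed

lemma powr_deriv_closed_segment:
  assumes "n > 0" "x \<in> closed_segment (of_nat n) (of_nat (Suc n) :: complex)"
  shows "((\<lambda>z. z powr s) has_field_derivative s * x powr (s - 1)) (at x within S)"
proof -
  obtain t where t: "x = of_real t" "real n \<le> t" by (rule closed_segment_nat_Suc[OF assms])
  then have "x \<notin> \<real>\<^sub>\<le>\<^sub>0" using assms(1) by (auto simp: complex_nonpos_Reals_iff)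
  then show ?thesis by (rule has_field_derivative_at_within[OF has_field_derivative_powr])
qed

lemma powr_norm_closed_segment:
  assumes "n > 0" "x \<in> closed_segment (of_nat n) (of_nat (Suc n) :: complex)" "Re s \<le> 0"
  shows "norm (x powr s) \<le> real n powr Re s"
proof -
  obtain t where t: "x = of_real t" "real n \<le> t" by (rule closed_segment_nat_Suc[OF assms(1,2)])
  then have "norm (x powr s) = t powr Re s" using assms(1) by (simp add: norm_powr_real_powr)
  also have "\<dots> \<le> real n powr Re s" using t assms by (intro powr_mono2') auto
  finally show ?thesis .
qed

text \<open>The derivative of z powr (-s) on the segment from n to n + 1 is smaller than the
  function by a factor of order n. This gain moves convergence from Re s > 1 to Re s > 0 after
  partial summation.\<close>

lemma powr_diff_bound:
  assumes "n > 0" "Re s > 0"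
  shows "norm (of_nat n powr - s - of_nat (Suc n) powr - s :: complex) \<le> norm s * real n powr (- Re s - 1)"
proof -
  let ?S = "closed_segment (of_nat n) (of_nat (Suc n) :: complex)"
  have "norm (of_nat (Suc n) powr - s - of_nat n powr - s :: complex) \<le>
    (norm s * real n powr (- Re s - 1)) * norm (of_nat (Suc n) - of_nat n :: complex)"
  proof (rule field_differentiable_bound[where S = ?S and f' = "\<lambda>x. - s * x powr (- s - 1)"])
    show "((\<lambda>x. x powr - s) has_field_derivative - s * z powr (- s - 1)) (at z within ?S)" if "z \<in> ?S" for z
      by (rule powr_deriv_closed_segment[OF assms(1) that])
    show "norm (- s * z powr (- s - 1)) \<le> norm s * real n powr (- Re s - 1)" if "z \<in> ?S" for z
      using powr_norm_closed_segment[OF assms(1) that, of "- s - 1"] assms by (auto simp: norm_mult intro!: mult_left_mono)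
  qed auto
  then show ?thesis by (simp add: norm_minus_commute)
qed

text \<open>Second-order Taylor remainder of z powr (1 - s) at n, taken at n + 1. It compares n powr
  (-s) with the integral of x powr (-s) over [n, n + 1]; multiplying through by s - 1 avoids the
  division at s = 1.\<close>

lemma powr_taylor_bound:
  assumes "n > 0" "Re s > 0"
  shows "norm ((s - 1) * of_nat n powr - s - of_nat n powr (1 - s) + of_nat (Suc n) powr (1 - s) :: complex)
    \<le> norm s * norm (s - 1) * real n powr (- Re s - 1)"
proof -
  let ?S = "closed_segment (of_nat n) (of_nat (Suc n) :: complex)"
  define f where "f = (\<lambda>i::nat. \<lambda>x::complex. if i = 0 then x powr (1 - s) else if i = 1 then (1 - s) * x powr - s
    else (1 - s) * (- s * x powr (- s - 1)))"
  have "norm (f 0 (of_nat (Suc n)) - (\<Sum>i\<le>1. f i (of_nat n) * (of_nat (Suc n) - of_nat n) ^ i / fact i))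
     \<le> (norm s * norm (s - 1) * real n powr (- Re s - 1)) * norm (of_nat (Suc n) - of_nat n :: complex) ^ Suc 1 / fact 1"
  proof (rule complex_Taylor[where S = ?S])
    fix i :: nat and x assume x: "x \<in> ?S" and i: "i \<le> 1"
    show "(f i has_field_derivative f (Suc i) x) (at x within ?S)"
    proof (cases "i = 0")
      case True
      then show ?thesis using powr_deriv_closed_segment[OF assms(1) x, of "1 - s" ?S] by (simp add: f_def)
    next
      case False
      then have "i = 1" using i by simp
      then show ?thesis using DERIV_cmult[OF powr_deriv_closed_segment[OF assms(1) x, of "- s" ?S], of "1 - s"] by (simp add: f_def)
    qed
  next
    fix x assume x: "x \<in> ?S"
    show "norm (f (Suc 1) x) \<le> norm s * norm (s - 1) * real n powr (- Re s - 1)"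
      using powr_norm_closed_segment[OF assms(1) x, of "- s - 1"] assms
      by (auto simp: f_def norm_mult norm_minus_commute mult_ac intro!: mult_left_mono)
  qed auto
  then show ?thesis by (simp add: f_def algebra_simps)
qed

lemma holomorphic_nat_powr [holomorphic_intros]:
  "g holomorphic_on A \<Longrightarrow> (\<lambda>s. of_nat n powr g s :: complex) holomorphic_on A"
  by (cases "n = 0") (auto intro!: holomorphic_intros)

text \<open>Locally uniform convergence by the Weierstrass test. The polynomial factor in s is large
  enough for both increment estimates above and is bounded on small balls.\<close>

lemma holomorphic_series:
  fixes f :: "nat \<Rightarrow> complex \<Rightarrow> complex"
  assumes hol: "\<And>n. f n holomorphic_on {s. Re s > 0}"
    and bound: "\<And>n s. n > 0 \<Longrightarrow> Re s > 0 \<Longrightarrow> norm (f n s) \<le> C * (norm s + 1)^2 * real n powr (- Re s - 1)"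
  obtains F where "F holomorphic_on {s. Re s > 0}" "\<And>s. Re s > 0 \<Longrightarrow> (\<lambda>n. f n s) sums F s"
proof -
  have op: "open {s. Re s > 0}" by (simp add: open_halfspace_Re_gt)
  have C: "C \<ge> 0" using order_trans[OF norm_ge_zero bound[of 1 1]] by (simp add: zero_le_mult_iff)
  have "\<exists>g g'. \<forall>x\<in>{s. Re s > 0}. (\<lambda>n. f n x) sums g x \<and> (\<lambda>n. deriv (f n) x) sums g' x \<and>
      (g has_field_derivative g' x) (at x)"
  proof (rule series_and_derivative_comparison_local[OF op])
    show "(f n has_field_derivative deriv (f n) x) (at x)" if "x \<in> {s. Re s > 0}" for n x
      using hol op that by (rule holomorphic_derivI)
    fix x assume x: "x \<in> {s. Re s > 0}"
    \<comment> \<open>On the ball of this radius Re y stays above Re x / 2, so one convergent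
      majorant serves all its points.\<close>
    let ?d = "Re x / 2" and ?h = "\<lambda>n. C * (norm x + Re x / 2 + 1)^2 * real n powr (- (Re x / 2) - 1)"
    have "norm (f n y) \<le> ?h n" if n: "n \<ge> 1" and y: "y \<in> ball x ?d \<inter> {s. Re s > 0}" for n y
    proof -
      have d: "norm (x - y) < ?d" using y by (simp add: dist_norm)
      have 1: "norm y \<le> norm x + ?d" using d norm_triangle_ineq2[of y x] by (simp add: norm_minus_commute)
      have 2: "Re y \<ge> ?d" using d abs_Re_le_cmod[of "x - y"] by simp
      have "norm (f n y) \<le> C * (norm y + 1)^2 * real n powr (- Re y - 1)" using bound[of n y] n y by simp
      also have "\<dots> \<le> C * (norm x + ?d + 1)^2 * real n powr (- ?d - 1)"
        using 1 2 n C by (intro mult_mono power_mono powr_mono) auto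
      finally show ?thesis .
    qed
    moreover have "summable ?h" using x by (intro summable_mult) (simp add: summable_real_powr_iff)
    ultimately show "\<exists>d h. 0 < d \<and> summable h \<and> (\<forall>\<^sub>F n in sequentially. \<forall>y\<in>ball x d \<inter> {s. Re s > 0}. norm (f n y) \<le> h n)"
      using x by (intro exI[of _ ?d] exI[of _ ?h]) (auto simp: eventually_sequentially intro!: exI[of _ 1])
  qed
  then obtain g g' where g: "\<And>x. Re x > 0 \<Longrightarrow> (\<lambda>n. f n x) sums g x"
    "\<And>x. Re x > 0 \<Longrightarrow> (g has_field_derivative g' x) (at x)" by auto
  have "g holomorphic_on {s. Re s > 0}"
    using op g(2) by (auto simp: holomorphic_on_open)
  with g(1) show ?thesis using that by blast
qed

lemma dirichlet_series_has_deriv: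
  assumes a: "abs_conv_beyond_1 a" and al: "abs_conv_beyond_1 (\<lambda>n. a n * ln (real n))" and s: "Re s > 1"
  shows "(dirichlet_series a has_field_derivative - dirichlet_series (\<lambda>n. a n * ln (real n)) s) (at s)"
proof -
  let ?S = "{s. Re s > 1}"
  let ?f = "\<lambda>n s. of_real (a n) * of_nat n powr - s :: complex"
  let ?f' = "\<lambda>n s. - (of_real (a n * ln (real n)) * of_nat n powr - s) :: complex"
  have op: "open ?S" by (simp add: open_halfspace_Re_gt)
  have "\<exists>g g'. \<forall>x\<in>?S. (\<lambda>n. ?f n x) sums g x \<and> (\<lambda>n. ?f' n x) sums g' x \<and> (g has_field_derivative g' x) (at x)"
  proof (rule series_and_derivative_comparison_local[OF op])
    show "(?f n has_field_derivative ?f' n x) (at x)" if "x \<in> ?S" for n x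
    proof (cases "n = 0")
      case False
      have L: "Ln (of_nat n) = complex_of_real (ln (real n))" using False Ln_of_nat by simp
      have "((\<lambda>s. of_nat n powr - s :: complex) has_field_derivative Ln (of_nat n) * of_nat n powr - x * - 1) (at x)"
        using False by (intro DERIV_chain2[OF has_field_derivative_powr_right]) (auto intro!: derivative_eq_intros)
      from DERIV_cmult[OF this, of "of_real (a n)"] L show ?thesis by (simp add: mult_ac)
    qed auto
    fix x assume x: "x \<in> ?S"
    let ?d = "(Re x - 1) / 2"
    let ?h = "\<lambda>n. \<bar>a n\<bar> * real n powr - (1 + ?d)"
    have "norm (?f n y) \<le> ?h n" if n: "n \<ge> 1" and y: "y \<in> ball x ?d \<inter> ?S" for n y
    proof -
      have d: "norm (x - y) < ?d" using y by (simp add: dist_norm)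
      have "1 + ?d \<le> Re y" using d abs_Re_le_cmod[of "x - y"] by (simp add: field_simps)
      then have "real n powr - Re y \<le> real n powr - (1 + ?d)" using n by (intro powr_mono) auto
      then show ?thesis by (auto simp: norm_mult norm_nat_powr intro!: mult_left_mono)
    qed
    moreover have "summable ?h" using a[unfolded abs_conv_beyond_1_def, rule_format, of "1 + ?d"] x by simp
    ultimately show "\<exists>d h. 0 < d \<and> summable h \<and> (\<forall>\<^sub>F n in sequentially. \<forall>y\<in>ball x d \<inter> ?S. norm (?f n y) \<le> h n)"
      using x by (intro exI[of _ ?d] exI[of _ ?h]) (auto simp: eventually_sequentially intro!: exI[of _ 1])
  qed
  then obtain g g' where g: "\<And>x. Re x > 1 \<Longrightarrow> (\<lambda>n. ?f n x) sums g x" "\<And>x. Re x > 1 \<Longrightarrow> (\<lambda>n. ?f' n x) sums g' x"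
    "\<And>x. Re x > 1 \<Longrightarrow> (g has_field_derivative g' x) (at x)" by auto
  have 1: "g x = dirichlet_series a x" if "x \<in> ?S" for x using g(1)[of x] that by (simp add: dirichlet_series_def sums_iff)
  have 2: "g' s = - dirichlet_series (\<lambda>n. a n * ln (real n)) s"
    using sums_unique[OF g(2)[OF s]] suminf_minus[OF abs_conv_beyond_1_summable[OF al s]] by (simp add: dirichlet_series_def)
  show ?thesis
    using has_field_derivative_transform_within_open[OF g(3)[OF s] op _ 1] s 2 by simp
qed

section \<open>Sign characters and their von Mangoldt series\<close>

lemma mangoldt_le_ln: "n > 0 \<Longrightarrow> mangoldt n \<le> ln (real n)"
proof -
  assume n: "n > 0"
  have "mangoldt n = (\<Sum>d\<in>{n}. mangoldt d :: real)" by simp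
  also have "\<dots> \<le> (\<Sum>d | d dvd n. mangoldt d)" using n by (intro sum_mono2) (auto simp: mangoldt_nonneg)
  finally show ?thesis using mangoldt_sum[of n, where 'a = real] n by simp
qed

text \<open>The value at 0 is left open so that the constant 1 qualifies: zeta and the L-functions
  of real characters are then treated together.\<close>

definition sign_character :: "(nat \<Rightarrow> real) \<Rightarrow> bool" where
  "sign_character \<psi> \<longleftrightarrow> \<psi> 1 = 1 \<and> (\<forall>m n. \<psi> (m * n) = \<psi> m * \<psi> n) \<and> (\<forall>n. \<psi> n \<in> {-1, 0, 1})"

lemma sign_character_abs_le: "sign_character \<psi> \<Longrightarrow> \<bar>\<psi> n\<bar> \<le> 1"
  unfolding sign_character_def by (metis abs_0 abs_1 abs_neg_one insertE le_numeral_extra(4) singletonD zero_le_one)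

lemma sign_character_abs_conv_beyond_1:
  assumes "sign_character \<psi>"
  shows "abs_conv_beyond_1 \<psi>" "abs_conv_beyond_1 (\<lambda>n. \<psi> n * ln (real n))" "abs_conv_beyond_1 (\<lambda>n. mangoldt n * \<psi> n)"
proof -
  note le = sign_character_abs_le[OF assms]
  show "abs_conv_beyond_1 \<psi>"
    by (rule abs_conv_beyond_1_ln[of _ 1]) (use le in \<open>auto intro: order_trans[of _ 1]\<close>)
  show "abs_conv_beyond_1 (\<lambda>n. \<psi> n * ln (real n))"
    by (rule abs_conv_beyond_1_ln[of _ 1]) (use le in \<open>auto simp: abs_mult intro: order_trans[OF mult_left_le_one_le]\<close>)
  show "abs_conv_beyond_1 (\<lambda>n. mangoldt n * \<psi> n)"
    by (intro abs_conv_beyond_1_ln[of _ 1]) (use le mangoldt_le_ln in \<open>auto simp: abs_mult mangoldt_nonneg intro!: order_trans[OF mult_right_le_one_le] order_trans[of "mangoldt _" "ln _" "1 + ln _"]\<close>)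
qed

text \<open>The identity -L' / L = sum of mangoldt n * psi n * n powr (-s), written as a product
  because L is not yet known to be nonzero. Complete multiplicativity pulls psi n out of the
  convolution, and the divisor sum of \<open>mangoldt\<close> is the logarithm.\<close>

lemma dirichlet_series_mangoldt:
  assumes "sign_character \<psi>" "Re s > 1"
  shows "dirichlet_series (\<lambda>n. mangoldt n * \<psi> n) s * dirichlet_series \<psi> s = dirichlet_series (\<lambda>n. \<psi> n * ln (real n)) s"
proof -
  have "(\<Sum>d | d dvd n. mangoldt d * \<psi> d * \<psi> (n div d)) = \<psi> n * ln (real n)" if "n > 0" for n
  proof -
    have "\<psi> d * \<psi> (n div d) = \<psi> n" if "d dvd n" for d
      using assms(1) that unfolding sign_character_def by (metis dvd_mult_div_cancel)
    then have "(\<Sum>d | d dvd n. mangoldt d * \<psi> d * \<psi> (n div d)) = (\<Sum>d | d dvd n. \<psi> n * mangoldt d)"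
      by (intro sum.cong) (auto simp: mult_ac)
    also have "\<dots> = \<psi> n * ln (real n)"
      using mangoldt_sum[of n, where 'a = real] that by (simp flip: sum_distrib_left)
    finally show ?thesis .
  qed
  then have "of_real (\<Sum>d | d dvd n. mangoldt d * \<psi> d * \<psi> (n div d)) * of_nat n powr - s =
      (of_real (\<psi> n * ln (real n)) * of_nat n powr - s :: complex)" for n
    by (cases "n = 0") auto
  then show ?thesis
    unfolding dirichlet_series_mult[OF sign_character_abs_conv_beyond_1(3)[OF assms(1)] sign_character_abs_conv_beyond_1(1)[OF assms(1)] assms(2)]
    unfolding dirichlet_series_def by (simp only:)
qed


section \<open>Analytic continuation to the right half-plane\<close>

text \<open>Abel summation: the bounded partial sums of psi are paired with the increments of n powr
  (-s), which are summable for Re s > 0.\<close>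

lemma dirichlet_series_continuation:
  assumes B: "\<And>N. \<bar>\<Sum>j\<le>N. \<psi> j\<bar> \<le> B" and psi0: "\<psi> 0 = (0 :: real)"
  obtains F where "F holomorphic_on {s. Re s > 0}"
    "\<And>s. Re s > 0 \<Longrightarrow> (\<lambda>n. of_real (\<psi> n) * of_nat n powr - s) sums F s"
proof -
  define S where "S = (\<lambda>N. \<Sum>j\<le>N. \<psi> j)"
  have BS: "\<bar>S N\<bar> \<le> B" for N using B by (simp add: S_def)
  have Bpos: "B \<ge> 0" using BS[of 0] by simp
  let ?f = "\<lambda>n s. of_real (S n) * (of_nat n powr - s - of_nat (Suc n) powr - s) :: complex"
  obtain F where F: "F holomorphic_on {s. Re s > 0}" "\<And>s. Re s > 0 \<Longrightarrow> (\<lambda>n. ?f n s) sums F s"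
  proof (rule holomorphic_series[of ?f B])
    show "?f n holomorphic_on {s. Re s > 0}" for n by (intro holomorphic_intros)
    show "norm (?f n s) \<le> B * (norm s + 1)\<^sup>2 * real n powr (- Re s - 1)" if "n > 0" "Re s > 0" for n s
    proof -
      have "norm (?f n s) \<le> B * (norm s * real n powr (- Re s - 1))"
        unfolding norm_mult using BS Bpos powr_diff_bound[OF that] by (intro mult_mono) auto
      also have "\<dots> \<le> B * ((norm s + 1)\<^sup>2 * real n powr (- Re s - 1))"
        using Bpos by (intro mult_left_mono mult_right_mono) (auto simp: power2_eq_square algebra_simps)
      finally show ?thesis by (simp add: mult_ac)
    qed
  qed blast
  have "(\<lambda>n. of_real (\<psi> n) * of_nat n powr - s) sums F s" if s: "Re s > 0" for s
  proof -
    have abel: "(\<Sum>n\<le>N. of_real (\<psi> n) * of_nat n powr - s) = (\<Sum>n<N. ?f n s) + of_real (S N) * of_nat N powr - s" for N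
    proof (induction N)
      case (Suc N)
      have "S (Suc N) = S N + \<psi> (Suc N)" by (simp add: S_def)
      then show ?case using Suc by (simp add: algebra_simps)
    qed simp
    have "(\<lambda>N. of_real (S N) * of_nat N powr - s :: complex) \<longlonglongrightarrow> 0"
    proof (rule Lim_null_comparison)
      show "\<forall>\<^sub>F N in sequentially. norm (of_real (S N) * of_nat N powr - s :: complex) \<le> B * real N powr - Re s"
        using BS by (intro always_eventually allI) (auto simp: norm_mult norm_nat_powr intro!: mult_right_mono)
      have "(\<lambda>N. real N powr - Re s) \<longlonglongrightarrow> 0" using s by real_asymp
      from tendsto_mult_left[OF this, of B] show "(\<lambda>N. B * real N powr - Re s) \<longlonglongrightarrow> 0" by simp
    qed
    with F(2)[OF s] have "(\<lambda>N. \<Sum>n\<le>N. of_real (\<psi> n) * of_nat n powr - s) \<longlonglongrightarrow> F s + 0"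
      unfolding abel sums_def by (intro tendsto_add)
    then show ?thesis by (simp add: sums_def_le)
  qed
  with F(1) show ?thesis by (rule that)
qed

text \<open>The differences of n powr (1 - s) telescope to 1, so the series \<open>?f\<close> sums
  to (s - 1) zeta(s) - 1. At s = 1 each of its terms vanishes, which gives the residue 1.\<close>

lemma zeta_continuation:
  obtains Z where "Z holomorphic_on {s. Re s > 0}" "Z 1 = 1"
    "\<And>s. Re s > 1 \<Longrightarrow> Z s = (s - 1) * dirichlet_series (\<lambda>n. 1) s"
proof -
  \<comment> \<open>At n = 0 the formula would yield 1, because 0 powr z = 0; this 1 reappears in
    the witness \<open>1 + F s\<close>.\<close>
  let ?f = "\<lambda>n s. if n = 0 then 0 else (s - 1) * of_nat n powr - s - of_nat n powr (1 - s) + of_nat (Suc n) powr (1 - s) :: complex"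
  obtain F where F: "F holomorphic_on {s. Re s > 0}" "\<And>s. Re s > 0 \<Longrightarrow> (\<lambda>n. ?f n s) sums F s"
  proof (rule holomorphic_series[of ?f 1])
    show "?f n holomorphic_on {s. Re s > 0}" for n by (cases "n = 0") (auto intro!: holomorphic_intros)
    show "norm (?f n s) \<le> 1 * (norm s + 1)\<^sup>2 * real n powr (- Re s - 1)" if "n > 0" "Re s > 0" for n s
    proof -
      have "norm (?f n s) \<le> norm s * norm (s - 1) * real n powr (- Re s - 1)"
        using powr_taylor_bound[OF that] that by simp
      also have "\<dots> \<le> ((norm s + 1) * (norm s + 1)) * real n powr (- Re s - 1)"
        using norm_triangle_ineq4[of s 1] by (intro mult_right_mono mult_mono) auto
      finally show ?thesis by (simp add: power2_eq_square)
    qed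
  qed blast
  show ?thesis
  proof (rule that[of "\<lambda>s. 1 + F s"])
    show "(\<lambda>s. 1 + F s) holomorphic_on {s. Re s > 0}" using F(1) by (intro holomorphic_intros)
    have "(\<lambda>n. ?f n 1) = (\<lambda>n. 0)" by (auto simp del: of_nat_Suc)
    then show "1 + F 1 = 1" using F(2)[of 1] by (simp add: sums_iff)
    fix s :: complex assume s: "Re s > 1"
    have c: "abs_conv_beyond_1 (\<lambda>n. 1)" by (rule abs_conv_beyond_1_ln[of _ 1]) simp
    have sum_f: "(\<Sum>n\<le>N. ?f n s) = (s - 1) * (\<Sum>n\<le>N. of_real 1 * of_nat n powr - s) + (of_nat (Suc N) powr (1 - s) - 1)" for N
      by (induction N) (auto simp: algebra_simps)
    have "(\<lambda>N. of_nat (Suc N) powr (1 - s) - 1 :: complex) \<longlonglongrightarrow> 0 - 1"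
    proof (intro tendsto_diff tendsto_const, rule tendsto_norm_zero_cancel)
      have "(\<lambda>N. real (Suc N) powr (1 - Re s)) \<longlonglongrightarrow> 0" using s by real_asymp
      then show "(\<lambda>N. norm (of_nat (Suc N) powr (1 - s) :: complex)) \<longlonglongrightarrow> 0"
        unfolding norm_nat_powr by simp
    qed
    moreover have "(\<lambda>n. of_real 1 * of_nat n powr - s) sums dirichlet_series (\<lambda>n. 1) s"
      unfolding dirichlet_series_def using abs_conv_beyond_1_summable[OF c s] by (rule summable_sums)
    ultimately have "(\<lambda>N. \<Sum>n\<le>N. ?f n s) \<longlonglongrightarrow> (s - 1) * dirichlet_series (\<lambda>n. 1) s + (0 - 1)"
      unfolding sum_f sums_def_le by (intro tendsto_add tendsto_mult_left)
    then have "F s = (s - 1) * dirichlet_series (\<lambda>n. 1) s + (0 - 1)"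
      using F(2)[of s] s unfolding sums_def_le by (intro LIMSEQ_unique) auto
    then show "1 + F s = (s - 1) * dirichlet_series (\<lambda>n. 1) s" by simp
  qed
qed

text \<open>Supplies a point where the continued function does not vanish, so that all its zeros
  have finite order. At 4 the terms beyond n = 1 have total norm below 1.\<close>

lemma dirichlet_series_sign_nonzero:
  assumes "sign_character \<psi>"
  shows "dirichlet_series \<psi> 4 \<noteq> 0"
proof -
  have le: "\<bar>\<psi> n\<bar> \<le> 1" for n using sign_character_abs_le[OF assms] .
  let ?t = "\<lambda>n. of_real (\<psi> n) * of_nat n powr - 4 :: complex"
  have s: "summable (\<lambda>n. norm (?t n))"
    using abs_conv_beyond_1_norm_summable[OF sign_character_abs_conv_beyond_1(1)[OF assms], of 4] by simp
  \<comment> \<open>For n at least 2, one factor n^(-2) is at most 1/4; what remains is the tail of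
    the Basel series.\<close>
  have n: "norm (?t (n + 2)) \<le> (1 / (real n + 2)\<^sup>2) / 4" for n
  proof -
    have "norm (?t (n + 2)) \<le> 1 * real (n + 2) powr - 4"
      unfolding norm_mult norm_nat_powr using le[of "n + 2"] by (intro mult_mono) auto
    also have "\<dots> = 1 / (real n + 2)\<^sup>2 * (1 / (real n + 2)\<^sup>2)"
      by (simp add: powr_minus divide_simps add_ac power2_eq_square power4_eq_xxxx)
    also have "\<dots> \<le> 1 / (real n + 2)\<^sup>2 * (1 / 2\<^sup>2)"
      by (intro mult_left_mono divide_left_mono power_mono) auto
    finally show ?thesis by simp
  qed
  have q: "(\<lambda>n. (1 / (real n + 2)\<^sup>2) / 4) sums ((pi\<^sup>2 / 6 - 1) / 4)"
  proof (rule sums_divide)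
    have "(\<lambda>n. 1 / (real (Suc n) + 1)\<^sup>2) sums (pi\<^sup>2 / 6 - 1)"
      using inverse_squares_sums by (subst sums_Suc_iff) (simp add: add_ac)
    then show "(\<lambda>n. 1 / (real n + 2)\<^sup>2) sums (pi\<^sup>2 / 6 - 1)" by (simp add: add_ac)
  qed
  have s2: "summable (\<lambda>n. norm (?t (n + 2)))" using s by (subst summable_iff_shift)
  have "norm (\<Sum>n. ?t (n + 2)) \<le> (\<Sum>n. norm (?t (n + 2)))" by (rule summable_norm[OF s2])
  also have "\<dots> \<le> (pi\<^sup>2 / 6 - 1) / 4"
    using suminf_le[OF n s2 sums_summable[OF q]] sums_unique[OF q] by simp
  also have "\<dots> < 1"
    using power_strict_mono[of pi 4 2] pi_less_4 by simp
  finally have "norm (\<Sum>n. ?t (n + 2)) < 1" .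
  moreover have "dirichlet_series \<psi> 4 = (\<Sum>n. ?t (n + 2)) + 1"
  proof -
    have "{..<2::nat} = {0, 1}" by auto
    moreover have "\<psi> (Suc 0) = 1" using assms by (simp add: sign_character_def)
    ultimately show ?thesis
      unfolding dirichlet_series_def using suminf_split_initial_segment[OF summable_norm_cancel[OF s], of 2] by simp
  qed
  moreover have "x + 1 \<noteq> 0" if "norm x < 1" for x :: complex
    using that by (auto simp: add_eq_0_iff2)
  ultimately show ?thesis by metis
qed

lemma holomorphic_isCont:
  assumes "F holomorphic_on S" "open S" "a \<in> S"
  shows "isCont F a" "isCont (deriv F) a"
  using assms holomorphic_deriv[OF assms(1,2)]
  by (meson field_differentiable_imp_continuous_at holomorphic_on_imp_differentiable_at)+

text \<open>Near a, F w = (w - a)^m * g w with g nonzero, hence F' / F = m / (w - a) + g' / g. The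
  approach is along the horizontal ray to the right of a, which is where the Dirichlet series lives.
  The point b rules out that F vanishes identically.\<close>

lemma log_deriv_order:
  assumes F: "F holomorphic_on S" and S: "open S" "connected S" and a: "a \<in> S" and b: "b \<in> S" "F b \<noteq> 0"
  obtains m :: nat where
    "((\<lambda>x::real. of_real x * (deriv F (a + of_real x) / F (a + of_real x))) \<longlongrightarrow> of_nat m) (at_right 0)"
    "\<forall>\<^sub>F x::real in at_right 0. F (a + of_real x) \<noteq> 0" "m = 0 \<longleftrightarrow> F a \<noteq> 0"
proof -
  have lim: "((\<lambda>x::real. G (a + of_real x)) \<longlongrightarrow> G a) (at_right 0)" if "isCont G a" for G :: "complex \<Rightarrow> complex"
    by (rule isCont_tendsto_compose[OF that]) (auto intro!: tendsto_eq_intros)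
  have xlim: "((\<lambda>x::real. complex_of_real x) \<longlongrightarrow> 0) (at_right 0)" by (auto intro!: tendsto_eq_intros)
  show ?thesis
  proof (cases "F a = 0")
    case False
    have c: "isCont F a" "isCont (deriv F) a"
      using holomorphic_isCont[OF F S(1) a] by auto
    have "((\<lambda>x::real. of_real x * (deriv F (a + of_real x) / F (a + of_real x))) \<longlongrightarrow> 0 * (deriv F a / F a)) (at_right 0)"
      by (intro tendsto_mult tendsto_divide xlim lim c False)
    then show ?thesis
      using tendsto_imp_eventually_ne[OF lim[OF c(1)] False] False by (intro that[of 0]) auto
  next
    case True
    have nc: "\<not> F constant_on S" using True a b unfolding constant_on_def by metis
    obtain g r n where g: "0 < n" "0 < r" "ball a r \<subseteq> S" "g holomorphic_on ball a r"
      "\<And>w. w \<in> ball a r \<Longrightarrow> F w = (w - a) ^ n * g w" "\<And>w. w \<in> ball a r \<Longrightarrow> g w \<noteq> 0"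
      using holomorphic_factor_zero_nonconstant[OF F S a True nc] by metis
    have c: "isCont g a" "isCont (deriv g) a"
      using holomorphic_isCont[OF g(4) open_ball, of a] g(2) by auto
    have ev: "\<forall>\<^sub>F x::real in at_right 0. 0 < x \<and> x < r"
      using g(2) eventually_at_right_less eventually_at_right_field by (auto simp: eventually_at_right_field)
    have "((\<lambda>x::real. of_nat n + of_real x * (deriv g (a + of_real x) / g (a + of_real x))) \<longlongrightarrow> of_nat n + 0 * (deriv g a / g a)) (at_right 0)"
      using g by (intro tendsto_add tendsto_mult tendsto_divide xlim lim c tendsto_const) auto
    moreover have "of_nat n + of_real x * (deriv g w / g w) = of_real x * (deriv F w / F w)"
      if x: "0 < x" "x < r" and w: "w = a + of_real x" for x w
    proof -
      have wb: "w \<in> ball a r" using x w by (simp add: dist_norm)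
      have "((\<lambda>w. (w - a) ^ n * g w) has_field_derivative (w - a) ^ n * deriv g w + of_nat n * (w - a) ^ (n - 1) * g w) (at w)"
        using holomorphic_derivI[OF g(4) open_ball wb] by (auto intro!: derivative_eq_intros)
      then have "(F has_field_derivative (w - a) ^ n * deriv g w + of_nat n * (w - a) ^ (n - 1) * g w) (at w)"
        by (rule has_field_derivative_transform_within_open[OF _ open_ball wb]) (simp add: g(5))
      then have dF: "deriv F w = (w - a) ^ n * deriv g w + of_nat n * (w - a) ^ (n - 1) * g w" by (rule DERIV_imp_deriv)
      obtain k where k: "n = Suc k" using g(1) gr0_implies_Suc by blast
      show ?thesis
        unfolding dF g(5)[OF wb] using w x g(6)[OF wb] by (simp add: k field_simps)
    qed
    ultimately have "((\<lambda>x::real. of_real x * (deriv F (a + of_real x) / F (a + of_real x))) \<longlongrightarrow> of_nat n) (at_right 0)"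
      using ev by (auto elim!: Lim_transform_eventually eventually_mono)
    moreover have "\<forall>\<^sub>F x::real in at_right 0. F (a + of_real x) \<noteq> 0"
      using ev
    proof eventually_elim
      case (elim x)
      then have "a + of_real x \<in> ball a r" by (simp add: dist_norm)
      then show ?case using g(5,6) elim by auto
    qed
    ultimately show ?thesis using g(1) True by (intro that[of n]) auto
  qed
qed


section \<open>Nonvanishing on the line of real part 1\<close>

text \<open>The exponent \<open>e = 1\<close> removes the pole of the zeta function at 1; otherwise \<open>e = 0\<close>.\<close>

definition dirichlet_continuation :: "(nat \<Rightarrow> real) \<Rightarrow> nat \<Rightarrow> (complex \<Rightarrow> complex) \<Rightarrow> bool" where
  "dirichlet_continuation \<psi> e F \<longleftrightarrow> sign_character \<psi> \<and> F holomorphic_on {s. Re s > 0} \<and>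
     (\<forall>s. Re s > 1 \<longrightarrow> F s = (s - 1) ^ e * dirichlet_series \<psi> s)"

abbreviation mangoldt_series :: "(nat \<Rightarrow> real) \<Rightarrow> complex \<Rightarrow> complex" where
  "mangoldt_series \<psi> \<equiv> dirichlet_series (\<lambda>n. mangoldt n * \<psi> n)"

text \<open>Logarithmic derivative of (s - 1)^e * L(s), cleared of denominators so that it holds
  before F is known to be nonzero.\<close>

lemma dirichlet_continuation_log_deriv:
  assumes "dirichlet_continuation \<psi> e F" "Re s > 1"
  shows "(s - 1) * (F s * mangoldt_series \<psi> s) = of_nat e * F s - (s - 1) * deriv F s"
proof -
  have cs: "sign_character \<psi>" and F: "\<And>s. Re s > 1 \<Longrightarrow> F s = (s - 1) ^ e * dirichlet_series \<psi> s"
    using assms(1) by (auto simp: dirichlet_continuation_def)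
  let ?d = "dirichlet_series (\<lambda>n. \<psi> n * ln (real n)) s"
  have "(dirichlet_series \<psi> has_field_derivative - ?d) (at s)"
    by (rule dirichlet_series_has_deriv[OF sign_character_abs_conv_beyond_1(1)[OF cs] sign_character_abs_conv_beyond_1(2)[OF cs] assms(2)])
  then have "((\<lambda>s. (s - 1) ^ e * dirichlet_series \<psi> s) has_field_derivative
      of_nat e * (s - 1) ^ (e - 1) * dirichlet_series \<psi> s - (s - 1) ^ e * ?d) (at s)"
    by (auto intro!: derivative_eq_intros)
  then have "(F has_field_derivative of_nat e * (s - 1) ^ (e - 1) * dirichlet_series \<psi> s - (s - 1) ^ e * ?d) (at s)"
    by (rule has_field_derivative_transform_within_open[of _ _ _ "{s. Re s > 1}"])
      (use F assms(2) in \<open>auto simp: open_halfspace_Re_gt\<close>)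
  then have dF: "deriv F s = of_nat e * (s - 1) ^ (e - 1) * dirichlet_series \<psi> s - (s - 1) ^ e * ?d" by (rule DERIV_imp_deriv)
  \<comment> \<open>For e = 0 the truncated exponent \<open>e - 1\<close> is harmless, since the
    factor \<open>of_nat e\<close> kills the term.\<close>
  have e: "of_nat e * (s - 1) * (s - 1) ^ (e - 1) = of_nat e * (s - 1) ^ e" by (cases e) auto
  have "(s - 1) * (F s * mangoldt_series \<psi> s) = (s - 1) * (s - 1) ^ e * (mangoldt_series \<psi> s * dirichlet_series \<psi> s)"
    using F[OF assms(2)] by simp
  also have "\<dots> = (s - 1) * (s - 1) ^ e * ?d" unfolding dirichlet_series_mangoldt[OF cs assms(2)] ..
  also have "\<dots> = of_nat e * F s - (s - 1) * deriv F s"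
  proof -
    have "(s - 1) * deriv F s = (of_nat e * (s - 1) * (s - 1) ^ (e - 1)) * dirichlet_series \<psi> s - (s - 1) * (s - 1) ^ e * ?d"
      unfolding dF by (simp add: right_diff_distrib mult_ac)
    then show ?thesis unfolding e F[OF assms(2)] by simp
  qed
  finally show ?thesis .
qed

text \<open>Reads off the order of the pole minus that of the zero of the Dirichlet series at a: m
  counts the zero of F, and e restores the pole at 1 that the factor (s - 1)^e removed.\<close>

lemma dirichlet_continuation_order:
  assumes F: "dirichlet_continuation \<psi> e F" and a: "Re a \<ge> 1"
  obtains m :: nat where
    "((\<lambda>x::real. of_real x * mangoldt_series \<psi> (a + of_real x)) \<longlongrightarrow> (if a = 1 then of_nat e else 0) - of_nat m) (at_right 0)"
    "m = 0 \<longleftrightarrow> F a \<noteq> 0"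
proof -
  have F4: "F 4 \<noteq> 0" using F dirichlet_series_sign_nonzero[of \<psi>] by (auto simp: dirichlet_continuation_def)
  have hol: "F holomorphic_on {s. Re s > 0}" using F by (simp add: dirichlet_continuation_def)
  obtain m where m: "((\<lambda>x::real. of_real x * (deriv F (a + of_real x) / F (a + of_real x))) \<longlongrightarrow> of_nat m) (at_right 0)"
    "\<forall>\<^sub>F x::real in at_right 0. F (a + of_real x) \<noteq> 0" "m = 0 \<longleftrightarrow> F a \<noteq> 0"
    by (rule log_deriv_order[OF hol _ _ _ _ F4, of a])
      (use a in \<open>auto simp: open_halfspace_Re_gt convex_halfspace_Re_gt convex_connected\<close>)
  have e: "((\<lambda>x::real. of_real x * of_nat e / (a + of_real x - 1)) \<longlongrightarrow> (if a = 1 then of_nat e else 0)) (at_right 0)"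
  proof (cases "a = 1")
    case True
    have "\<forall>\<^sub>F x::real in at_right 0. of_real x * of_nat e / (a + of_real x - 1) = (of_nat e :: complex)"
      using eventually_at_right_less[of "0::real"] by eventually_elim (use True in auto)
    then show ?thesis using True by (simp add: tendsto_eventually)
  next
    case False
    then have "((\<lambda>x::real. of_real x * of_nat e / (a + of_real x - 1)) \<longlongrightarrow> of_real 0 * of_nat e / (a + of_real 0 - 1)) (at_right 0)"
      by (intro tendsto_intros) auto
    then show ?thesis using False by simp
  qed
  have alg: "D = c / w - d / f" if "w \<noteq> 0" "f \<noteq> 0" "w * (f * D) = c * f - w * d" for c d f w D :: complex
    using that by (simp add: field_simps)
  have "\<forall>\<^sub>F x::real in at_right 0. of_real x * of_nat e / (a + of_real x - 1) -
      of_real x * (deriv F (a + of_real x) / F (a + of_real x)) = of_real x * mangoldt_series \<psi> (a + of_real x)"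
    using m(2) eventually_at_right_less[of "0::real"]
  proof eventually_elim
    case (elim x)
    let ?s = "a + of_real x"
    have s: "Re ?s > 1" using a elim by simp
    then have "?s - 1 \<noteq> 0" by (metis eq_iff_diff_eq_0 less_irrefl one_complex.sel(1))
    then have "mangoldt_series \<psi> ?s = of_nat e / (?s - 1) - deriv F ?s / F ?s"
      using alg[OF _ elim(1) dirichlet_continuation_log_deriv[OF F s]] by blast
    then show ?case by (simp only: right_diff_distrib times_divide_eq_right)
  qed
  with tendsto_diff[OF e m(1)] have "((\<lambda>x::real. of_real x * mangoldt_series \<psi> (a + of_real x)) \<longlongrightarrow> (if a = 1 then of_nat e else 0) - of_nat m) (at_right 0)"
    by (rule Lim_transform_eventually)
  then show ?thesis using m(3) by (rule that)
qed

text \<open>A zero of order m would make the von Mangoldt series grow like m / x on the ray to the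
  right of a, but absolute convergence at Re a keeps it bounded there.\<close>

lemma dirichlet_continuation_nonzero_Re_gt_1:
  assumes F: "dirichlet_continuation \<psi> e F" and a: "Re a > 1"
  shows "F a \<noteq> 0"
proof -
  obtain m where m: "((\<lambda>x::real. of_real x * mangoldt_series \<psi> (a + of_real x)) \<longlongrightarrow> (if a = 1 then of_nat e else 0) - of_nat m) (at_right 0)"
    "m = 0 \<longleftrightarrow> F a \<noteq> 0"
    by (rule dirichlet_continuation_order[OF F, of a]) (use a in auto)
  have cs: "sign_character \<psi>" using F by (simp add: dirichlet_continuation_def)
  let ?M = "(\<Sum>n. \<bar>mangoldt n * \<psi> n\<bar> * real n powr - Re a)"
  have sm: "summable (\<lambda>n. \<bar>mangoldt n * \<psi> n\<bar> * real n powr - Re a)"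
    using sign_character_abs_conv_beyond_1(3)[OF cs] a by (auto simp: abs_conv_beyond_1_def)
  have "norm (mangoldt_series \<psi> (a + of_real x)) \<le> ?M" if x: "x > 0" for x
  proof -
    have s: "Re (a + of_real x) > 1" using a x by simp
    note ns = abs_conv_beyond_1_norm_summable[OF sign_character_abs_conv_beyond_1(3)[OF cs] s]
    have "norm (mangoldt_series \<psi> (a + of_real x)) \<le> (\<Sum>n. norm (of_real (mangoldt n * \<psi> n) * of_nat n powr - (a + of_real x) :: complex))"
      unfolding dirichlet_series_def by (rule summable_norm[OF ns])
    also have "\<dots> \<le> ?M"
    proof (rule suminf_le[OF _ ns sm])
      fix n :: nat
      have "real n powr - (Re a + x) \<le> real n powr - Re a" using x by (cases "n = 0") (auto intro!: powr_mono)
      then show "norm (of_real (mangoldt n * \<psi> n) * of_nat n powr - (a + of_real x) :: complex) \<le> \<bar>mangoldt n * \<psi> n\<bar> * real n powr - Re a"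
        unfolding norm_mult norm_nat_powr by (intro mult_mono) (auto simp: norm_mult abs_mult mangoldt_nonneg)
    qed
    finally show ?thesis .
  qed
  then have "\<forall>\<^sub>F x in at_right 0. norm (of_real x * mangoldt_series \<psi> (a + of_real x)) \<le> x * ?M"
    using eventually_at_right_less[of "0::real"] by (auto elim!: eventually_mono simp: norm_mult)
  moreover have "((\<lambda>x. x * ?M) \<longlongrightarrow> 0) (at_right 0)" by (auto intro!: tendsto_eq_intros)
  ultimately have "((\<lambda>x::real. of_real x * mangoldt_series \<psi> (a + of_real x)) \<longlongrightarrow> 0) (at_right 0)"
    by (rule Lim_null_comparison)
  then have "(if a = 1 then of_nat e else 0) - of_nat m = (0 :: complex)"
    using m(1) by (intro tendsto_unique[OF _ m(1)]) auto
  then have "m = 0" using a by (cases "a = 1") auto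
  then show ?thesis using m(2) by simp
qed

lemma Re_ds_term:
  "Re (of_real c * of_nat n powr - (of_real x + \<i> * of_real t)) = c * real n powr - x * cos (t * ln (real n))"
proof (cases "n = 0")
  case False
  then have "of_nat n powr - (of_real x + \<i> * of_real t) = exp (of_real (- x * ln (real n)) + \<i> * of_real (- (t * ln (real n))))"
    by (simp add: powr_def Ln_of_nat algebra_simps)
  then show ?thesis using False by (simp add: Re_exp powr_def)
qed auto

text \<open>Termwise, with c the cosine at t: if psi n is 1 or -1, the bracket is 2 (1 + psi n *
  c)^2; if psi n = 0, it is 2 + 2 c^2. The constant character may therefore stand in for psi^2 in
  the outer terms.\<close>

lemma three_four_one:
  assumes cs: "sign_character \<psi>" and x: "x > 0"
  shows "3 * Re (mangoldt_series (\<lambda>n. 1) (1 + of_real x)) + 4 * Re (mangoldt_series \<psi> (1 + \<i> * of_real t + of_real x))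
    + Re (mangoldt_series (\<lambda>n. 1) (1 + \<i> * of_real (2 * t) + of_real x)) \<ge> 0"
proof -
  have c1: "sign_character (\<lambda>n. 1)" by (simp add: sign_character_def)
  have R: "(\<lambda>n. mangoldt n * \<phi> n * real n powr - (1 + x) * cos (u * ln (real n))) sums Re (mangoldt_series \<phi> (1 + \<i> * of_real u + of_real x))"
    if "sign_character \<phi>" for \<phi> u
  proof -
    have "(\<lambda>n. of_real (mangoldt n * \<phi> n) * of_nat n powr - (of_real (1 + x) + \<i> * of_real u)) sums mangoldt_series \<phi> (of_real (1 + x) + \<i> * of_real u)"
      unfolding dirichlet_series_def using x by (intro summable_sums abs_conv_beyond_1_summable sign_character_abs_conv_beyond_1 that) auto
    from sums_Re[OF this] show ?thesis unfolding Re_ds_term by (simp add: algebra_simps)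
  qed
  have "(\<lambda>n. 3 * (mangoldt n * 1 * real n powr - (1 + x) * cos (0 * ln (real n))) +
      4 * (mangoldt n * \<psi> n * real n powr - (1 + x) * cos (t * ln (real n))) +
      mangoldt n * 1 * real n powr - (1 + x) * cos (2 * t * ln (real n))) sums
    (3 * Re (mangoldt_series (\<lambda>n. 1) (1 + \<i> * of_real 0 + of_real x)) + 4 * Re (mangoldt_series \<psi> (1 + \<i> * of_real t + of_real x))
    + Re (mangoldt_series (\<lambda>n. 1) (1 + \<i> * of_real (2 * t) + of_real x)))"
    by (intro sums_add sums_mult R c1 cs)
  moreover have "0 \<le> 3 * (mangoldt n * 1 * real n powr - (1 + x) * cos (0 * ln (real n))) +
      4 * (mangoldt n * \<psi> n * real n powr - (1 + x) * cos (t * ln (real n))) +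
      mangoldt n * 1 * real n powr - (1 + x) * cos (2 * t * ln (real n))" for n
  proof -
    define c where "c = cos (t * ln (real n))"
    have c2: "cos (2 * t * ln (real n)) = 2 * c\<^sup>2 - 1" using cos_double_cos[of "t * ln (real n)"] by (simp add: c_def mult_ac)
    have "\<psi> n \<in> {-1, 0, 1}" using cs by (simp add: sign_character_def)
    then have "3 + 4 * \<psi> n * c + (2 * c\<^sup>2 - 1) = 2 * (1 + \<psi> n * c)\<^sup>2 \<or> 3 + 4 * \<psi> n * c + (2 * c\<^sup>2 - 1) = 2 + 2 * c\<^sup>2"
      by (auto simp: power2_eq_square algebra_simps)
    then have "0 \<le> 3 + 4 * \<psi> n * c + (2 * c\<^sup>2 - 1)" by auto
    then have "0 \<le> mangoldt n * real n powr - (1 + x) * (3 + 4 * \<psi> n * c + (2 * c\<^sup>2 - 1))"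
      by (intro mult_nonneg_nonneg mangoldt_nonneg) auto
    then show ?thesis unfolding c2 c_def[symmetric] by (simp add: algebra_simps)
  qed
  ultimately have "0 \<le> 3 * Re (mangoldt_series (\<lambda>n. 1) (1 + \<i> * of_real 0 + of_real x)) + 4 * Re (mangoldt_series \<psi> (1 + \<i> * of_real t + of_real x))
    + Re (mangoldt_series (\<lambda>n. 1) (1 + \<i> * of_real (2 * t) + of_real x))"
    by (rule sums_le[OF _ sums_zero, rotated])
  then show ?thesis by simp
qed

text \<open>Multiplying the 3-4-1 inequality by x and letting x tend to 0 gives 3 - 4 m - k >= 0, so
  m = 0. For t nonzero the third term sits away from the pole of zeta and contributes only
  -k.\<close>

lemma dirichlet_continuation_nonzero_off_real:
  assumes F: "dirichlet_continuation \<psi> e F" and Z: "dirichlet_continuation (\<lambda>n. 1) 1 Z" "Z 1 \<noteq> 0" and t: "t \<noteq> 0"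
  shows "F (1 + \<i> * of_real t) \<noteq> 0"
proof -
  let ?a = "1 + \<i> * of_real t" and ?b = "1 + \<i> * of_real (2 * t)"
  have ne: "?a \<noteq> 1" "?b \<noteq> 1" using t by auto
  obtain m where m: "((\<lambda>x::real. of_real x * mangoldt_series \<psi> (?a + of_real x)) \<longlongrightarrow> (if ?a = 1 then of_nat e else 0) - of_nat m) (at_right 0)"
      "m = 0 \<longleftrightarrow> F ?a \<noteq> 0"
    by (rule dirichlet_continuation_order[OF F, of ?a]) auto
  obtain k where k: "((\<lambda>x::real. of_real x * mangoldt_series (\<lambda>n. 1) (?b + of_real x)) \<longlongrightarrow> (if ?b = 1 then of_nat 1 else 0) - of_nat k) (at_right 0)"
    by (rule dirichlet_continuation_order[OF Z(1), of ?b]) auto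
  obtain j where j: "((\<lambda>x::real. of_real x * mangoldt_series (\<lambda>n. 1) (1 + of_real x)) \<longlongrightarrow> (if 1 = 1 then of_nat 1 else 0) - of_nat j) (at_right 0)"
      "j = 0 \<longleftrightarrow> Z 1 \<noteq> 0"
    by (rule dirichlet_continuation_order[OF Z(1), of 1]) auto
  have z: "((\<lambda>x::real. of_real x * mangoldt_series (\<lambda>n. 1) (1 + of_real x)) \<longlongrightarrow> 1) (at_right 0)"
    using j Z(2) by simp
  note m(1)[unfolded if_not_P[OF ne(1)]] and k[unfolded if_not_P[OF ne(2)]]
  note m = this(1) m(2) and k = this(2)
  have "((\<lambda>x. 3 * Re (of_real x * mangoldt_series (\<lambda>n. 1) (1 + of_real x)) + 4 * Re (of_real x * mangoldt_series \<psi> (?a + of_real x))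
      + Re (of_real x * mangoldt_series (\<lambda>n. 1) (?b + of_real x))) \<longlongrightarrow> 3 * Re 1 + 4 * Re (0 - of_nat m) + Re (0 - of_nat k)) (at_right 0)"
    by (intro tendsto_add tendsto_mult_left tendsto_Re z m(1) k)
  moreover have "\<forall>\<^sub>F x::real in at_right 0. 0 \<le> 3 * Re (of_real x * mangoldt_series (\<lambda>n. 1) (1 + of_real x)) + 4 * Re (of_real x * mangoldt_series \<psi> (?a + of_real x))
      + Re (of_real x * mangoldt_series (\<lambda>n. 1) (?b + of_real x))"
    using eventually_at_right_less[of "0::real"]
  proof eventually_elim
    case (elim x)
    have "0 \<le> x * (3 * Re (mangoldt_series (\<lambda>n. 1) (1 + of_real x)) + 4 * Re (mangoldt_series \<psi> (?a + of_real x)) + Re (mangoldt_series (\<lambda>n. 1) (?b + of_real x)))"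
      using three_four_one[of \<psi> x t] F elim by (intro mult_nonneg_nonneg) (auto simp: dirichlet_continuation_def)
    then show ?case by (simp add: algebra_simps)
  qed
  ultimately have "0 \<le> 3 * Re 1 + 4 * Re (0 - of_nat m) + Re (0 - of_nat k)"
    by (intro tendsto_lowerbound) auto
  then have "m = 0" by simp
  then show ?thesis using m(2) by simp
qed


section \<open>Divisor sums and Lambert series, for nonvanishing at 1\<close>

lemma sum_divisors_prime_power_mult:
  fixes \<psi> :: "nat \<Rightarrow> real"
  assumes cs: "sign_character \<psi>" and p: "prime p" and m: "\<not> p dvd m" "m > 0"
  shows "(\<Sum>d | d dvd p ^ k * m. \<psi> d) = (\<Sum>i\<le>k. \<psi> p ^ i) * (\<Sum>d | d dvd m. \<psi> d)"
proof -
  have mult: "\<psi> (a * b) = \<psi> a * \<psi> b" and one: "\<psi> 1 = 1" for a b using cs by (auto simp: sign_character_def)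
  have pow: "\<psi> (p ^ i) = \<psi> p ^ i" for i by (induction i) (use one in \<open>auto simp: mult\<close>)
  have nd: "\<not> p dvd d" if "d dvd m" for d using that m(1) dvd_trans by blast
  have inj: "inj_on (\<lambda>(i, d). p ^ i * d) ({..k} \<times> {d. d dvd m})"
  proof (rule inj_onI, clarify)
    fix i d j e assume *: "d dvd m" "e dvd m" "p ^ i * d = p ^ j * e"
    have "multiplicity p (p ^ i * d) = i" "multiplicity p (p ^ j * e) = j"
      using nd[OF *(1)] nd[OF *(2)] p by (auto intro!: multiplicity_eqI simp: mult_ac)
    with *(3) have "i = j" by simp
    with *(3) p show "i = j \<and> d = e" by auto
  qed
  have img: "(\<lambda>(i, d). p ^ i * d) ` ({..k} \<times> {d. d dvd m}) = {d. d dvd p ^ k * m}"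
  proof (intro equalityI subsetI)
    fix x assume "x \<in> {d. d dvd p ^ k * m}"
    then obtain b c where "x = b * c" "b dvd p ^ k" "c dvd m" using division_decomp by blast
    then show "x \<in> (\<lambda>(i, d). p ^ i * d) ` ({..k} \<times> {d. d dvd m})" using divides_primepow_nat[OF p] by auto
  qed (auto intro!: mult_dvd_mono le_imp_power_dvd)
  have "(\<Sum>d | d dvd p ^ k * m. \<psi> d) = (\<Sum>(i, d)\<in>{..k} \<times> {d. d dvd m}. \<psi> p ^ i * \<psi> d)"
    unfolding img[symmetric] sum.reindex[OF inj] by (intro sum.cong) (auto simp: mult pow)
  then show ?thesis by (simp add: sum_product sum.cartesian_product)
qed

text \<open>The only negative base is -1, whose partial sums alternate between 1 and 0; an even last
  exponent ends at 1. This is why squares are singled out below.\<close>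

lemma sum_powers_sign:
  assumes "(c :: real) \<in> {-1, 0, 1}"
  shows "0 \<le> (\<Sum>i\<le>k. c ^ i)" "1 \<le> (\<Sum>i\<le>2 * k. c ^ i)"
proof -
  have "(\<Sum>i\<le>k. (- 1 :: real) ^ i) = (if even k then 1 else 0)" for k by (induction k) auto
  moreover have "(\<Sum>i\<le>k. (0 :: real) ^ i) = 1" for k by (induction k) auto
  ultimately show "0 \<le> (\<Sum>i\<le>k. c ^ i)" "1 \<le> (\<Sum>i\<le>2 * k. c ^ i)" using assms by auto
qed

lemma sum_divisors_sign_nonneg:
  assumes cs: "sign_character \<psi>"
  shows "n > 0 \<Longrightarrow> 0 \<le> (\<Sum>d | d dvd n. \<psi> d)"
proof (induction n rule: less_induct)
  case (less n)
  show ?case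
  proof (cases "n = 1")
    case True
    then show ?thesis using cs by (simp add: sign_character_def)
  next
    case False
    then obtain p where p: "prime p" "p dvd n" using prime_factor_nat by blast
    obtain m where m: "n = p ^ multiplicity p n * m" "\<not> p dvd m"
      using multiplicity_decompose'[of n p] less.prems p by (metis gr_implies_not0 not_prime_unit)
    have "m > 0" using m less.prems by (auto intro: Nat.gr0I)
    moreover have "m < n"
    proof -
      have "m \<noteq> n" using m(2) p by auto
      moreover have "m dvd n" using m(1) by (metis dvd_triv_right)
      ultimately show ?thesis using less.prems by (simp add: dvd_imp_le le_neq_implies_less)
    qed
    ultimately have "0 \<le> (\<Sum>d | d dvd m. \<psi> d)" using less.IH by blast
    moreover have "\<psi> p \<in> {-1, 0, 1}" using cs by (simp add: sign_character_def)
    ultimately show ?thesis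
      by (subst m(1), subst sum_divisors_prime_power_mult[OF cs p(1) m(2) \<open>m > 0\<close>])
        (intro mult_nonneg_nonneg sum_powers_sign(1), auto)
  qed
qed

text \<open>Every prime has even exponent in a square, so each local factor is at least 1; the
  induction strips off one prime at a time.\<close>

lemma sum_divisors_sign_square:
  assumes cs: "sign_character \<psi>"
  shows "n > 0 \<Longrightarrow> 1 \<le> (\<Sum>d | d dvd n\<^sup>2. \<psi> d)"
proof (induction n rule: less_induct)
  case (less n)
  show ?case
  proof (cases "n = 1")
    case True
    then show ?thesis using cs by (simp add: sign_character_def)
  next
    case False
    then obtain p where p: "prime p" "p dvd n" using prime_factor_nat by blast
    define k where "k = multiplicity p n"
    obtain m where m: "n = p ^ k * m" "\<not> p dvd m"
      using multiplicity_decompose'[of n p] less.prems p unfolding k_def by (metis gr_implies_not0 not_prime_unit)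
    have m0: "m > 0" using m less.prems by (auto intro: Nat.gr0I)
    have "m < n"
    proof -
      have "m \<noteq> n" using m(2) p by auto
      moreover have "m dvd n" using m(1) by (metis dvd_triv_right)
      ultimately show ?thesis using less.prems by (simp add: dvd_imp_le le_neq_implies_less)
    qed
    then have 1: "1 \<le> (\<Sum>d | d dvd m\<^sup>2. \<psi> d)" using less.IH m0 by blast
    have "\<psi> p \<in> {-1, 0, 1}" using cs by (simp add: sign_character_def)
    then have 2: "1 \<le> (\<Sum>i\<le>2 * k. \<psi> p ^ i)" by (rule sum_powers_sign(2))
    have n2: "n\<^sup>2 = p ^ (2 * k) * m\<^sup>2" unfolding m(1) by (simp add: power_mult_distrib power_even_eq)
    have "\<not> p dvd m\<^sup>2" using m(2) p(1) prime_dvd_power by blast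
    then show ?thesis
      using mult_mono[OF 2 1] m0 1 2 unfolding n2 by (subst sum_divisors_prime_power_mult[OF cs p(1)]) auto
  qed
qed

text \<open>AM-GM on the pairs of exponents i and n - 1 - i. The base is written as a square so that
  the mean exponent (n - 1) / 2 becomes integral in y.\<close>

lemma geometric_sum_lower:
  fixes y :: real
  assumes "0 \<le> y"
  shows "real n * y ^ (n - 1) \<le> (\<Sum>i<n. (y\<^sup>2) ^ i)"
proof -
  let ?S = "\<Sum>i<n. (y\<^sup>2) ^ i"
  have "?S = (\<Sum>i<n. (y\<^sup>2) ^ (n - Suc i))" by (rule sum.nat_diff_reindex[symmetric])
  then have "2 * ?S = (\<Sum>i<n. (y\<^sup>2) ^ i + (y\<^sup>2) ^ (n - Suc i))" by (simp add: sum.distrib)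
  also have "\<dots> \<ge> (\<Sum>i<n. 2 * y ^ (n - 1))"
  proof (rule sum_mono)
    fix i assume "i \<in> {..<n}"
    then have "y ^ i * y ^ (n - Suc i) = y ^ (n - 1)" by (simp flip: power_add)
    moreover have "0 \<le> (y ^ i - y ^ (n - Suc i))\<^sup>2" by simp
    ultimately show "2 * y ^ (n - 1) \<le> (y\<^sup>2) ^ i + (y\<^sup>2) ^ (n - Suc i)"
      by (simp add: power2_diff power_mult[symmetric] mult.commute[of 2] mult.assoc)
  qed
  finally show ?thesis by simp
qed

text \<open>As x tends to 1, both terms blow up like 1 / (n (1 - x)). Weighted by psi and summed,
  the first gives L / (1 - x), with L the sum of psi n / n, and the second gives the Lambert series
  of psi.\<close>

definition lambert_gap :: "real \<Rightarrow> nat \<Rightarrow> real" where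
  "lambert_gap x n = 1 / (real n * (1 - x)) - x ^ n / (1 - x ^ n)"

text \<open>Factoring 1 - x out of 1 - x^n turns sign and monotonicity of the gap into inequalities
  between geometric sums.\<close>

lemma lambert_gap_eq:
  assumes x: "0 < x" "x < 1" and n: "n > 0"
  shows "(1 - x) * lambert_gap x n = 1 / real n - x ^ n / (\<Sum>i<n. x ^ i)" "(\<Sum>i<n. x ^ i) > 0"
proof -
  have g: "1 - x ^ n = (1 - x) * (\<Sum>i<n. x ^ i)" by (rule one_diff_power_eq)
  have alg: "u * (1 / (k * u) - X / (u * G)) = 1 / k - X / G" if "u \<noteq> 0" "k \<noteq> 0" "G \<noteq> 0" for u k X G :: real
    using that by (simp add: right_diff_distrib)
  show "(\<Sum>i<n. x ^ i) > 0" using x n by (intro sum_pos) auto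
  then show "(1 - x) * lambert_gap x n = 1 / real n - x ^ n / (\<Sum>i<n. x ^ i)"
    using x n alg[of "1 - x" "real n"] unfolding lambert_gap_def g by simp
qed

lemma lambert_gap_nonneg:
  assumes x: "0 < x" "x < 1" and n: "n > 0"
  shows "lambert_gap x n \<ge> 0"
proof -
  have "real n * x ^ n = (\<Sum>i<n. x ^ n)" by simp
  also have "\<dots> \<le> (\<Sum>i<n. x ^ i)" using x by (intro sum_mono power_decreasing) auto
  finally have "0 \<le> (1 - x) * lambert_gap x n"
    unfolding lambert_gap_eq[OF x n] using lambert_gap_eq(2)[OF x n] n by (simp add: field_simps)
  then show ?thesis using x by (simp add: zero_le_mult_iff)
qed

text \<open>With \<open>G n = 1 + x + \<dots> + x^(n-1)\<close>, monotonicity amounts to \<open>n (n + 1) x^n \<le> G n * G (n + 1)\<close>,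
  which is the AM-GM inequality applied to both factors.\<close>

lemma lambert_gap_decreasing:
  assumes x: "0 < x" "x < 1" and n: "n > 0"
  shows "lambert_gap x (Suc n) \<le> lambert_gap x n"
proof -
  define G where "G = (\<lambda>n. \<Sum>i<n. x ^ i)"
  define y where "y = sqrt x"
  have y: "0 < y" "y < 1" "y\<^sup>2 = x" using x by (auto simp: y_def)
  have alg: "X / P \<le> 1 / Q" if "P > 0" "Q > 0" "Q * X \<le> P" for X P Q :: real
    using that by (simp add: field_simps)
  have G: "real k * y ^ (k - 1) \<le> G k" for k
    using geometric_sum_lower[of y k] y by (simp add: G_def)
  have Gp: "G n > 0" "G (Suc n) > 0" using lambert_gap_eq(2)[OF x] n by (auto simp: G_def simp del: sum.lessThan_Suc)
  have "x ^ n = y ^ n * y ^ n" using y(3) by (simp add: power2_eq_square power_mult_distrib flip: y(3))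
  also have "\<dots> \<le> y ^ (n - 1) * y ^ n" using y by (intro mult_right_mono power_decreasing) auto
  finally have "x ^ n \<le> y ^ (n - 1) * y ^ n" .
  then have "(real n * real (Suc n)) * x ^ n \<le> (real n * real (Suc n)) * (y ^ (n - 1) * y ^ n)"
    by (rule mult_left_mono) auto
  also have "\<dots> = (real n * y ^ (n - 1)) * (real (Suc n) * y ^ (Suc n - 1))" by simp
  also have "\<dots> \<le> G n * G (Suc n)" using G[of n] G[of "Suc n"] y Gp by (intro mult_mono) auto
  finally have key: "x ^ n / (G n * G (Suc n)) \<le> 1 / (real n * real (Suc n))"
    using alg[of "G n * G (Suc n)" "real n * real (Suc n)" "x ^ n"] Gp n by simp
  \<comment> \<open>This recursion collapses the difference of the two fractions to a single
    fraction with numerator x^n.\<close>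
  have "G (Suc n) - x * G n = 1"
    using one_diff_power_eq[of x n] by (simp add: G_def algebra_simps)
  then have "x ^ n / G n - x ^ Suc n / G (Suc n) = x ^ n / (G n * G (Suc n))"
    using Gp by (simp add: field_simps)
  moreover have "1 / real n - 1 / real (Suc n) = 1 / (real n * real (Suc n))" using n by (simp add: field_simps)
  ultimately have "(1 - x) * lambert_gap x n - (1 - x) * lambert_gap x (Suc n) \<ge> 0"
    using key lambert_gap_eq(1)[OF x n] lambert_gap_eq(1)[OF x, of "Suc n"] unfolding G_def by simp
  then show ?thesis using x by (simp add: zero_le_mult_iff flip: right_diff_distrib)
qed

text \<open>Partial summation: the decrements of b are nonnegative and telescope to at most
  \<open>b 1\<close>.\<close>

lemma abel_bound:
  fixes \<psi> b :: "nat \<Rightarrow> real"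
  assumes B: "\<And>N. \<bar>\<Sum>j\<le>N. \<psi> j\<bar> \<le> B" and psi0: "\<psi> 0 = 0"
    and b: "\<And>n. n > 0 \<Longrightarrow> b n \<ge> 0" "\<And>n. n > 0 \<Longrightarrow> b (Suc n) \<le> b n"
  shows "\<bar>\<Sum>n\<le>N. \<psi> n * b n\<bar> \<le> B * b 1"
proof -
  define S where "S = (\<lambda>N. \<Sum>j\<le>N. \<psi> j)"
  have BS: "\<bar>S N\<bar> \<le> B" for N using B by (simp add: S_def)
  have B0: "B \<ge> 0" using BS[of 0] by simp
  \<comment> \<open>The induction starts at index 1, since \<open>b 0\<close> is unconstrained:
    \<open>lambert_gap x 0\<close> is 0 through division by zero, while
    \<open>lambert_gap x 1\<close> is 1.\<close>
  have "\<bar>(\<Sum>n\<le>Suc N. \<psi> n * b n) - S (Suc N) * b (Suc N)\<bar> \<le> B * (b 1 - b (Suc N))" for N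
  proof (induction N)
    case 0
    then show ?case by (simp add: S_def psi0)
  next
    case (Suc N)
    have "(\<Sum>n\<le>Suc (Suc N). \<psi> n * b n) - S (Suc (Suc N)) * b (Suc (Suc N)) =
      ((\<Sum>n\<le>Suc N. \<psi> n * b n) - S (Suc N) * b (Suc N)) + S (Suc N) * (b (Suc N) - b (Suc (Suc N)))"
      by (simp add: S_def algebra_simps)
    also have "\<bar>\<dots>\<bar> \<le> B * (b 1 - b (Suc N)) + B * (b (Suc N) - b (Suc (Suc N)))"
    proof (rule order_trans[OF abs_triangle_ineq add_mono[OF Suc.IH]])
      show "\<bar>S (Suc N) * (b (Suc N) - b (Suc (Suc N)))\<bar> \<le> B * (b (Suc N) - b (Suc (Suc N)))"
        unfolding abs_mult using BS[of "Suc N"] b(2)[of "Suc N"] B0 by (intro mult_mono) auto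
    qed
    finally show ?case by (simp add: algebra_simps)
  qed
  note * = this
  show ?thesis
  proof (cases N)
    case 0
    then show ?thesis using psi0 B0 b(1)[of 1] by simp
  next
    case (Suc M)
    have "\<bar>S N * b N\<bar> \<le> B * b N" unfolding abs_mult using BS[of N] b(1)[of N] B0 Suc by (intro mult_mono) auto
    moreover have "\<bar>(\<Sum>n\<le>N. \<psi> n * b n) - S N * b N\<bar> \<le> B * b 1 - B * b N"
      using *[of M] unfolding Suc[symmetric] by (simp add: right_diff_distrib)
    ultimately show ?thesis by linarith
  qed
qed


text \<open>Each x^d / (1 - x^d) is the geometric series of x^(d e) over e > 0; grouping by n = d e
  collects the divisor sums.\<close>

lemma lambert_series:
  fixes \<psi> :: "nat \<Rightarrow> real"
  assumes le: "\<And>n. \<bar>\<psi> n\<bar> \<le> 1" and psi0: "\<psi> 0 = 0" and x: "0 < x" "x < 1"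
  obtains f where "(\<lambda>n. \<psi> n * (x ^ n / (1 - x ^ n))) sums f"
    "(\<lambda>n. if n = 0 then 0 else (\<Sum>d | d dvd n. \<psi> d) * x ^ n) sums f"
proof -
  let ?G = "\<lambda>d e. \<psi> d * x ^ (d * e)"
  have gs: "(\<lambda>n. x ^ n) summable_on {0<..}"
    using x summable_on_UNIV_nonneg_real_iff[of "\<lambda>n. x ^ n"] by (auto intro: summable_on_subset_banach)
  \<comment> \<open>A product majorant: d e >= d + e - 1 for positive d and e, hence x^(d e) <= x^(d
    + e - 1).\<close>
  have gp: "(\<lambda>(d, e). x ^ d * x ^ e / x) summable_on ({0<..} \<times> {0<..})"
  proof (rule abs_summable_summable, rule Infinite_Sum.abs_summable_on_Sigma_iff[THEN iffD2], intro conjI ballI)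
    show "(\<lambda>e. norm (case (d, e) of (d, e) \<Rightarrow> x ^ d * x ^ e / x)) summable_on {0<..}" for d
      using x summable_on_cmult_right[OF gs, of "x ^ d / x"] by (simp add: abs_mult)
    have "(\<Sum>\<^sub>\<infinity>e\<in>{0<..}. norm (case (d, e) of (d, e) \<Rightarrow> x ^ d * x ^ e / x)) = x ^ d * ((\<Sum>\<^sub>\<infinity>e\<in>{0<..}. x ^ e) / x)" for d
    proof -
      have "(\<Sum>\<^sub>\<infinity>e\<in>{0<..}. norm (case (d, e) of (d, e) \<Rightarrow> x ^ d * x ^ e / x)) = (\<Sum>\<^sub>\<infinity>e\<in>{0<..}. (x ^ d / x) * x ^ e)"
        using x by (simp add: abs_mult)
      also have "\<dots> = (x ^ d / x) * (\<Sum>\<^sub>\<infinity>e\<in>{0<..}. x ^ e)" by (rule infsum_cmult_right')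
      finally show ?thesis by simp
    qed
    moreover have "(\<Sum>\<^sub>\<infinity>e\<in>{0<..}. x ^ e) \<ge> 0" using x by (intro infsum_nonneg) auto
    ultimately show "(\<lambda>d. norm (\<Sum>\<^sub>\<infinity>e\<in>{0<..}. norm (case (d, e) of (d, e) \<Rightarrow> x ^ d * x ^ e / x))) summable_on {0<..}"
      using x summable_on_cmult_left[OF gs, of "(\<Sum>\<^sub>\<infinity>e\<in>{0<..}. x ^ e) / x"] by (simp add: abs_mult)
  qed
  have S: "(\<lambda>(d, e). ?G d e) summable_on ({0<..} \<times> {0<..})"
  proof (rule abs_summable_summable, rule Infinite_Sum.abs_summable_on_comparison_test'[OF gp], clarify)
    fix d e :: nat assume "d > 0" "e > 0"
    then obtain d' e' where de: "d = Suc d'" "e = Suc e'" by (meson gr0_implies_Suc)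
    have "norm (?G d e) \<le> 1 * x ^ (d * e)"
      using le[of d] x by (auto simp: abs_mult intro!: mult_right_mono)
    also have "\<dots> \<le> x ^ (d' + e)" using x by (simp only: mult_1) (intro power_decreasing, auto simp: de)
    also have "\<dots> = x ^ d * x ^ e / x" using x by (simp add: de power_add)
    finally show "norm (?G d e) \<le> x ^ d * x ^ e / x" .
  qed
  have inner: "(\<Sum>\<^sub>\<infinity>e\<in>{0<..}. ?G d e) = \<psi> d * (x ^ d / (1 - x ^ d))" if "d \<in> {0<..}" for d
  proof -
    have d: "d > 0" using that by simp
    have xd: "0 < x ^ d" "x ^ d < 1" using x d by (auto simp: power_less_one_iff)
    have "(\<lambda>n. (x ^ d) ^ n) sums (1 / (1 - x ^ d))" using xd by (intro geometric_sums) auto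
    then have "(\<lambda>n. if n = 0 then 0 else (x ^ d) ^ n) sums (1 / (1 - x ^ d) - 1)"
      using sums_If_finite_set'[of "\<lambda>n. (x ^ d) ^ n" _ "{0}" "1 / (1 - x ^ d) - 1" "\<lambda>_. 0"] by simp
    moreover have "1 / (1 - x ^ d) - 1 = x ^ d / (1 - x ^ d)" using xd by (simp add: field_simps)
    ultimately have "((\<lambda>n. if n = 0 then 0 else (x ^ d) ^ n) has_sum (x ^ d / (1 - x ^ d))) UNIV"
      using xd by (intro sums_nonneg_imp_has_sum) auto
    then have "((\<lambda>n. (x ^ d) ^ n) has_sum (x ^ d / (1 - x ^ d))) {0<..}"
      by (rule has_sum_cong_neutral[THEN iffD1, rotated -1]) auto
    then show ?thesis by (simp add: power_mult infsum_cmult_right' infsumI)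
  qed
  have o: "(\<lambda>d. \<psi> d * (x ^ d / (1 - x ^ d))) summable_on {0<..}"
    by (rule summable_on_cong[THEN iffD1, OF inner summable_on_Sigma_banach[OF S]])
  have r: "(\<Sum>d | d dvd n. ?G d (n div d)) = (if n = 0 then 0 else (\<Sum>d | d dvd n. \<psi> d) * x ^ n)" for n
    by (cases "n = 0") (auto simp: sum_distrib_right intro!: sum.cong)
  have eq: "infsum (\<lambda>d. \<psi> d * (x ^ d / (1 - x ^ d))) {0<..} = infsum (\<lambda>n. if n = 0 then 0 else (\<Sum>d | d dvd n. \<psi> d) * x ^ n) {0<..}"
    by (rule trans[OF sym[OF infsum_cong[OF inner]] infsum_divisors(2)[OF S, unfolded r]])
  show ?thesis
    by (rule that[OF infsum_pos_nat(2)[OF o]], simp add: psi0, unfold eq, rule infsum_pos_nat(2))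
      (use infsum_divisors(1)[OF S] r in auto)
qed

text \<open>Monsky's argument: if the series vanished, the Lambert series of \<open>\<psi>\<close> would stay bounded as
  \<open>x\<close> tends to 1 from below, although its power series coefficients are at least 1 at the squares.\<close>

lemma sign_series_at_1_nonzero:
  assumes cs: "sign_character \<psi>" and psi0: "\<psi> 0 = 0" and B: "\<And>N. \<bar>\<Sum>j\<le>N. \<psi> j\<bar> \<le> B"
    and L: "(\<lambda>n. \<psi> n / real n) sums L"
  shows "L \<noteq> 0"
proof
  assume L0: "L = 0"
  have le: "\<bar>\<psi> n\<bar> \<le> 1" for n using sign_character_abs_le[OF cs] .
  \<comment> \<open>Large enough that M squares of weight at least 1/2 exceed the bound B.\<close>
  obtain M :: nat where "max (2 * B + 2) 1 < real M" using reals_Archimedean2 by blast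
  then have M: "M > 0" "real M > 2 * B + 2" by auto
  \<comment> \<open>Chosen so that x^(M^2) = 1/2; then x^(m^2) >= 1/2 for all m up to M.\<close>
  define x where "x = (1 / 2 :: real) powr (1 / real M ^ 2)"
  have x: "0 < x" "x < 1" using M(1) powr_less_mono2[of "1 / real M ^ 2" "1 / 2" 1] by (auto simp: x_def)
  have "x ^ (M\<^sup>2) = x powr (real M ^ 2)" using x by (simp flip: powr_realpow)
  also have "\<dots> = 1 / 2" using M(1) by (simp add: x_def powr_powr)
  finally have xM: "x ^ (M\<^sup>2) = 1 / 2" .
  obtain f where f: "(\<lambda>n. \<psi> n * (x ^ n / (1 - x ^ n))) sums f"
    "(\<lambda>n. if n = 0 then 0 else (\<Sum>d | d dvd n. \<psi> d) * x ^ n) sums f"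
    by (rule lambert_series[of \<psi> x, OF le psi0 x])
  \<comment> \<open>With L = 0 this sum is -f, so a bound for it bounds the Lambert series
    itself.\<close>
  have "(\<lambda>n. \<psi> n * lambert_gap x n) sums (L / (1 - x) - f)"
  proof -
    have "(\<lambda>n. \<psi> n / real n / (1 - x) - \<psi> n * (x ^ n / (1 - x ^ n))) sums (L / (1 - x) - f)"
      by (intro sums_diff sums_divide L f)
    then show ?thesis by (simp add: lambert_gap_def right_diff_distrib)
  qed
  then have "(\<lambda>N. \<bar>\<Sum>n\<le>N. \<psi> n * lambert_gap x n\<bar>) \<longlonglongrightarrow> \<bar>L / (1 - x) - f\<bar>" unfolding sums_def_le by (rule tendsto_rabs)
  moreover have "\<bar>\<Sum>n\<le>N. \<psi> n * lambert_gap x n\<bar> \<le> B * lambert_gap x 1" for N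
    by (rule abel_bound[of \<psi> B "lambert_gap x", OF B psi0 lambert_gap_nonneg[OF x] lambert_gap_decreasing[OF x]])
  ultimately have "\<bar>L / (1 - x) - f\<bar> \<le> B * lambert_gap x 1" by (intro LIMSEQ_le_const2) auto
  \<comment> \<open>This value does not depend on x, which makes the bound B uniform as x approaches
    1.\<close>
  moreover have "lambert_gap x 1 = 1" using x by (simp add: lambert_gap_def flip: diff_divide_distrib)
  ultimately have fB: "\<bar>f\<bar> \<le> B" using L0 by simp
  let ?r = "\<lambda>n. if n = 0 then 0 else (\<Sum>d | d dvd n. \<psi> d) * x ^ n"
  have nonneg: "0 \<le> ?r n" for n using sum_divisors_sign_nonneg[OF cs, of n] x by auto
  have "real M / 2 = (\<Sum>m\<in>{1..M}. 1 / 2)" by simp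
  also have "\<dots> \<le> (\<Sum>m\<in>{1..M}. ?r (m\<^sup>2))"
  proof (rule sum_mono)
    fix m assume m: "m \<in> {1..M}"
    have "1 / 2 \<le> x ^ (m\<^sup>2)" using m x unfolding xM[symmetric] by (intro power_decreasing power_mono) auto
    then have "1 * (1 / 2) \<le> (\<Sum>d | d dvd m\<^sup>2. \<psi> d) * x ^ (m\<^sup>2)"
      using sum_divisors_sign_square[OF cs, of m] m by (intro mult_mono) auto
    then show "1 / 2 \<le> ?r (m\<^sup>2)" using m by simp
  qed
  also have "\<dots> = (\<Sum>n\<in>(\<lambda>m. m\<^sup>2) ` {1..M}. ?r n)"
    by (subst sum.reindex) (auto simp: inj_on_def)
  also have "\<dots> \<le> f"
    using sum_le_suminf[OF sums_summable[OF f(2)], of "(\<lambda>m. m\<^sup>2) ` {1..M}"] nonneg sums_unique[OF f(2)] by auto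
  finally show False using fB M(2) by linarith
qed


section \<open>Holomorphic extension across the line of real part 1\<close>

definition continues_past_1 :: "(complex \<Rightarrow> complex) \<Rightarrow> bool" where
  "continues_past_1 D \<longleftrightarrow> (\<exists>U H. open U \<and> {s. Re s \<ge> 1} \<subseteq> U \<and> H holomorphic_on U \<and> (\<forall>s. Re s > 1 \<longrightarrow> H s = D s))"

lemma continues_past_1I:
  "open U \<Longrightarrow> {s. Re s \<ge> 1} \<subseteq> U \<Longrightarrow> H holomorphic_on U \<Longrightarrow> (\<And>s. Re s > 1 \<Longrightarrow> H s = D s) \<Longrightarrow> continues_past_1 D"
  unfolding continues_past_1_def by blast

lemma continues_past_1_add:
  assumes "continues_past_1 D" "continues_past_1 E"
  shows "continues_past_1 (\<lambda>s. D s + E s)"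
proof -
  obtain U H where U: "open U" "{s. Re s \<ge> 1} \<subseteq> U" "H holomorphic_on U" "\<And>s. Re s > 1 \<Longrightarrow> H s = D s"
    using assms(1) unfolding continues_past_1_def by blast
  obtain V K where V: "open V" "{s. Re s \<ge> 1} \<subseteq> V" "K holomorphic_on V" "\<And>s. Re s > 1 \<Longrightarrow> K s = E s"
    using assms(2) unfolding continues_past_1_def by blast
  show ?thesis
    by (rule continues_past_1I[of "U \<inter> V" "\<lambda>s. H s + K s"])
      (use U V in \<open>auto intro!: holomorphic_intros elim: holomorphic_on_subset\<close>)
qed

lemma continues_past_1_cmult:
  assumes "continues_past_1 D"
  shows "continues_past_1 (\<lambda>s. c * D s)"
proof -
  obtain U H where U: "open U" "{s. Re s \<ge> 1} \<subseteq> U" "H holomorphic_on U" "\<And>s. Re s > 1 \<Longrightarrow> H s = D s"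
    using assms(1) unfolding continues_past_1_def by blast
  show ?thesis
    by (rule continues_past_1I[of U "\<lambda>s. c * H s"]) (use U in \<open>auto intro!: holomorphic_intros\<close>)
qed

lemma continues_past_1_sum:
  assumes "finite A" "\<And>i. i \<in> A \<Longrightarrow> continues_past_1 (D i)"
  shows "continues_past_1 (\<lambda>s. \<Sum>i\<in>A. D i s)"
  using assms
proof (induction A rule: finite_induct)
  case empty
  show ?case by (rule continues_past_1I[of UNIV "\<lambda>_. 0"]) auto
next
  case (insert i A)
  then show ?case by (simp add: continues_past_1_add)
qed

lemma continues_past_1_cong: "continues_past_1 D \<Longrightarrow> (\<And>s. Re s > 1 \<Longrightarrow> D s = E s) \<Longrightarrow> continues_past_1 E"
  unfolding continues_past_1_def by metis

text \<open>The extension is -F' / F on the open set where F is nonzero. This set may narrow as the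
  imaginary part grows, which is why \<open>continues_past_1\<close> asks for no uniform
  strip.\<close>

lemma dirichlet_continuation_continues_past_1:
  assumes F: "dirichlet_continuation \<psi> e F" and nz: "\<And>s. Re s \<ge> 1 \<Longrightarrow> F s \<noteq> 0"
  shows "continues_past_1 (\<lambda>s. mangoldt_series \<psi> s - of_nat e / (s - 1))"
proof -
  let ?P = "{s. Re s > 0}"
  let ?U = "{s \<in> ?P. F s \<noteq> 0}"
  have P: "open ?P" by (simp add: open_halfspace_Re_gt)
  have hol: "F holomorphic_on ?P" using F by (simp add: dirichlet_continuation_def)
  have U: "open ?U"
    using continuous_open_preimage[OF holomorphic_on_imp_continuous_on[OF hol] P, of "- {0}"]
    by (simp add: vimage_def Int_def open_Compl)
  show ?thesis
  proof (rule continues_past_1I[OF U, of "\<lambda>s. - (deriv F s / F s)"])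
    show "{s. 1 \<le> Re s} \<subseteq> ?U" using nz by auto
    show "(\<lambda>s. - (deriv F s / F s)) holomorphic_on ?U"
      using U holomorphic_on_subset[OF hol, of ?U] holomorphic_on_subset[OF holomorphic_deriv[OF hol P], of ?U]
      by (auto intro!: holomorphic_intros)
    fix s :: complex assume s: "Re s > 1"
    have alg: "- (d / f) = D - c / w" if "w \<noteq> 0" "f \<noteq> 0" "w * (f * D) = c * f - w * d" for c d f w D :: complex
      using that by (simp add: field_simps)
    have "s - 1 \<noteq> 0" using s by (metis eq_iff_diff_eq_0 less_irrefl one_complex.sel(1))
    then show "- (deriv F s / F s) = mangoldt_series \<psi> s - of_nat e / (s - 1)"
      using nz[of s] s by (intro alg dirichlet_continuation_log_deriv[OF F s]) auto
  qed
qed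

text \<open>On the line away from 1, zeta plays both roles in the 3-4-1 argument; at 1 the residue
  settles the matter.\<close>

lemma zeta_continuation_nonzero:
  obtains Z where "dirichlet_continuation (\<lambda>n. 1) 1 Z" "Z 1 = 1" "\<And>s. Re s \<ge> 1 \<Longrightarrow> Z s \<noteq> 0"
proof -
  obtain Z where Z: "Z holomorphic_on {s. Re s > 0}" "Z 1 = 1" "\<And>s. Re s > 1 \<Longrightarrow> Z s = (s - 1) * dirichlet_series (\<lambda>n. 1) s"
    by (rule zeta_continuation) blast
  have l: "dirichlet_continuation (\<lambda>n. 1) 1 Z" using Z by (simp add: dirichlet_continuation_def sign_character_def)
  have "Z s \<noteq> 0" if s: "Re s \<ge> 1" for s
  proof (cases "Re s > 1")
    case True
    then show ?thesis by (rule dirichlet_continuation_nonzero_Re_gt_1[OF l])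
  next
    case False
    then have eq: "s = 1 + \<i> * of_real (Im s)" using s by (simp add: complex_eq_iff)
    show ?thesis
    proof (cases "Im s = 0")
      case True
      then show ?thesis using eq Z(2) by simp
    next
      case False
      show ?thesis by (subst eq, rule dirichlet_continuation_nonzero_off_real[OF l l]) (use Z(2) False in auto)
    qed
  qed
  with l Z(2) show ?thesis by (rule that)
qed

text \<open>Since Z 1 = 1, the difference is the quotient (Z s - Z 1) / (s - 1), whose singularity
  at 1 is removable.\<close>

lemma zeta_continues_past_1: "continues_past_1 (\<lambda>s. dirichlet_series (\<lambda>n. 1) s - 1 / (s - 1))"
proof -
  obtain Z where Z: "dirichlet_continuation (\<lambda>n. 1) 1 Z" "Z 1 = 1" by (rule zeta_continuation_nonzero)
  let ?P = "{s. Re s > 0}"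
  have P: "open ?P" by (simp add: open_halfspace_Re_gt)
  show ?thesis
  proof (rule continues_past_1I[OF P])
    show "(\<lambda>z. if z = 1 then deriv Z 1 else (Z z - Z 1) / (z - 1)) holomorphic_on ?P"
      using Z(1) P by (intro pole_lemma_open) (auto simp: dirichlet_continuation_def)
    fix s :: complex assume s: "Re s > 1"
    then have "s \<noteq> 1" by auto
    moreover have "Z s = (s - 1) * dirichlet_series (\<lambda>n. 1) s" using Z(1) s by (simp add: dirichlet_continuation_def)
    ultimately show "(if s = 1 then deriv Z 1 else (Z s - Z 1) / (s - 1)) = dirichlet_series (\<lambda>n. 1) s - 1 / (s - 1)"
      using Z(2) by (simp add: diff_divide_distrib)
  qed auto
qed

text \<open>Bounded partial sums are used twice: they continue the L-function without a pole
  (exponent 0), and they drive Monsky's argument at the point 1.\<close>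

lemma sign_character_continues_past_1:
  assumes cs: "sign_character \<psi>" and psi0: "\<psi> 0 = 0" and B: "\<And>N. \<bar>\<Sum>j\<le>N. \<psi> j\<bar> \<le> B"
  shows "continues_past_1 (mangoldt_series \<psi>)"
proof -
  obtain F where F: "F holomorphic_on {s. Re s > 0}"
    "\<And>s. Re s > 0 \<Longrightarrow> (\<lambda>n. of_real (\<psi> n) * of_nat n powr - s) sums F s"
    by (rule dirichlet_series_continuation[OF B psi0]) blast
  obtain Z where Z: "dirichlet_continuation (\<lambda>n. 1) 1 Z" "Z 1 = 1" by (rule zeta_continuation_nonzero)
  have l: "dirichlet_continuation \<psi> 0 F" using F cs by (auto simp: dirichlet_continuation_def dirichlet_series_def sums_iff)
  have "of_real (\<psi> n) * of_nat n powr - 1 = complex_of_real (\<psi> n / real n)" for n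
    by (cases "n = 0") (auto simp: powr_minus divide_simps)
  then have "(\<lambda>n. complex_of_real (\<psi> n / real n)) sums F 1" using F(2)[of 1] by simp
  from sums_Re[OF this] have "(\<lambda>n. \<psi> n / real n) sums Re (F 1)" by simp
  then have "Re (F 1) \<noteq> 0" by (rule sign_series_at_1_nonzero[OF cs psi0 B])
  then have F1: "F 1 \<noteq> 0" by auto
  have "F s \<noteq> 0" if s: "Re s \<ge> 1" for s
  proof (cases "Re s > 1")
    case True
    then show ?thesis by (rule dirichlet_continuation_nonzero_Re_gt_1[OF l])
  next
    case False
    then have eq: "s = 1 + \<i> * of_real (Im s)" using s by (simp add: complex_eq_iff)
    show ?thesis
    proof (cases "Im s = 0")
      case True
      then show ?thesis using eq F1 by simp
    next
      case False
      show ?thesis by (subst eq, rule dirichlet_continuation_nonzero_off_real[OF l Z(1)]) (use Z(2) False in auto)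
    qed
  qed
  from dirichlet_continuation_continues_past_1[OF l this] show ?thesis by simp
qed


section \<open>Fejer kernels and the Tauberian theorem\<close>

text \<open>Fourier transform of the triangle of height 1 on [-T, T], folded by evenness; for
  nonzero u it equals T (sin (T u / 2) / (T u / 2))^2. The integral form covers u = 0 as
  well.\<close>

definition fejer :: "real \<Rightarrow> real \<Rightarrow> real" where
  "fejer T u = 2 * integral {0..T} (\<lambda>t. (1 - t / T) * cos (t * u))"

lemma fejer_eq:
  assumes T: "T > 0" and u: "u \<noteq> 0"
  shows "fejer T u = 2 * (1 - cos (T * u)) / (T * u\<^sup>2)"
proof -
  let ?F = "\<lambda>t. (1 - t / T) * sin (t * u) / u - cos (t * u) / (T * u\<^sup>2)"
  have "((\<lambda>t. (1 - t / T) * cos (t * u)) has_integral ?F T - ?F 0) {0..T}"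
  proof (rule fundamental_theorem_of_calculus)
    fix t
    have "(?F has_real_derivative (1 - t / T) * cos (t * u)) (at t)"
      using T u by (auto intro!: derivative_eq_intros simp: field_simps power2_eq_square)
    then show "(?F has_vector_derivative (1 - t / T) * cos (t * u)) (at t within {0..T})"
      by (simp add: has_real_derivative_iff_has_vector_derivative has_vector_derivative_at_within)
  qed (use T in auto)
  then show ?thesis using T u unfolding fejer_def by (simp add: integral_unique diff_divide_distrib)
qed

lemma fejer_le:
  assumes T: "T > 0"
  shows "fejer T u \<le> 2 * T"
proof -
  have "integral {0..T} (\<lambda>t. (1 - t / T) * cos (t * u)) \<le> integral {0..T} (\<lambda>t. 1)"
  proof (rule integral_le)
    show "(\<lambda>t. (1 - t / T) * cos (t * u)) integrable_on {0..T}"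
      using T by (intro integrable_continuous_real continuous_intros) auto
    fix t assume t: "t \<in> {0..T}"
    have "(1 - t / T) * cos (t * u) \<le> (1 - t / T) * 1" using t T by (intro mult_left_mono) auto
    also have "\<dots> \<le> 1" using t T by simp
    finally show "(1 - t / T) * cos (t * u) \<le> 1" .
  qed auto
  then show ?thesis using T by (simp add: fejer_def)
qed

lemma cos_ge_quadratic: "1 - x\<^sup>2 / 2 \<le> cos (x :: real)"
proof -
  have "(sin (x / 2))\<^sup>2 \<le> (x / 2)\<^sup>2" using abs_sin_x_le_abs_x[of "x / 2"] by (metis abs_le_square_iff)
  moreover have "cos x = 1 - 2 * (sin (x / 2))\<^sup>2" using cos_double_sin[of "x / 2"] by simp
  ultimately show ?thesis by (simp add: power_divide)
qed

text \<open>For such u all phases t u have absolute value at most 1, where the cosine is at least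
  1/2; the triangle has area T / 2 on [0, T].\<close>

lemma fejer_ge:
  assumes T: "T > 0" and u: "\<bar>u\<bar> \<le> 1 / T"
  shows "T / 2 \<le> fejer T u"
proof -
  have "((\<lambda>t. (1 - t / T) * (1 / 2)) has_integral (T - T\<^sup>2 / (2 * T)) * (1 / 2) - (0 - 0\<^sup>2 / (2 * T)) * (1 / 2)) {0..T}"
  proof (rule fundamental_theorem_of_calculus)
    fix t
    have "((\<lambda>t. (t - t\<^sup>2 / (2 * T)) * (1 / 2)) has_real_derivative (1 - t / T) * (1 / 2)) (at t)"
      using T by (auto intro!: derivative_eq_intros simp: field_simps)
    then show "((\<lambda>t. (t - t\<^sup>2 / (2 * T)) * (1 / 2)) has_vector_derivative (1 - t / T) * (1 / 2)) (at t within {0..T})"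
      by (simp add: has_real_derivative_iff_has_vector_derivative has_vector_derivative_at_within)
  qed (use T in auto)
  moreover have "(T - T\<^sup>2 / (2 * T)) * (1 / 2) - (0 - 0\<^sup>2 / (2 * T)) * (1 / 2) = T / 4"
    using T by (simp add: field_simps power2_eq_square)
  ultimately have i: "((\<lambda>t. (1 - t / T) * (1 / 2)) has_integral T / 4) {0..T}" by (simp only:)
  have "T / 4 \<le> integral {0..T} (\<lambda>t. (1 - t / T) * cos (t * u))"
  proof (rule has_integral_le[OF i integrable_integral])
    show "(\<lambda>t. (1 - t / T) * cos (t * u)) integrable_on {0..T}"
      using T by (intro integrable_continuous_real continuous_intros) auto
    fix t assume t: "t \<in> {0..T}"
    have "\<bar>t * u\<bar> \<le> T * (1 / T)" unfolding abs_mult using t T u by (intro mult_mono) auto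
    then have "(t * u)\<^sup>2 \<le> 1" using T by (simp add: abs_square_le_1)
    then have "1 / 2 \<le> cos (t * u)" using cos_ge_quadratic[of "t * u"] by simp
    then show "(1 - t / T) * (1 / 2) \<le> (1 - t / T) * cos (t * u)" using t T by (intro mult_left_mono) auto
  qed
  then show ?thesis by (simp add: fejer_def)
qed

lemma fejer_nonneg:
  assumes T: "T > 0"
  shows "0 \<le> fejer T u"
proof (cases "u = 0")
  case True
  then show ?thesis using fejer_ge[OF T, of u] T by simp
next
  case False
  then show ?thesis using T by (simp add: fejer_eq)
qed

lemma fejer_decay:
  assumes T: "T > 0" and u: "u \<noteq> 0"
  shows "fejer T u \<le> 4 / (T * u\<^sup>2)"
proof -
  have "2 * (1 - cos (T * u)) \<le> 4" using mult_left_mono[OF cos_ge_minus_one[of "T * u"], of 2] unfolding right_diff_distrib by linarith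
  then show ?thesis using assms unfolding fejer_eq[OF assms] by (intro divide_right_mono) auto
qed

text \<open>The two shifted kernels have no common zero, because \<open>cos (u - pi) = - cos u\<close>.\<close>

lemma fejer_tail:
  assumes T: "T > 0" and \<eta>: "\<eta> > 0" and u: "\<bar>u\<bar> \<ge> \<eta>"
  shows "fejer T u \<le> (2 + 2 * pi\<^sup>2 / \<eta>\<^sup>2) / T * (fejer 1 u + fejer 1 (u - pi))"
proof -
  \<comment> \<open>For |u| >= eta, C u^2 dominates both u^2 and (u - pi)^2. With this common
    denominator the cosines cancel and the numerators add up to 4.\<close>
  define C where "C = 2 + 2 * pi\<^sup>2 / \<eta>\<^sup>2"
  have u0: "u \<noteq> 0" using u \<eta> by auto
  have C: "C \<ge> 2" by (simp add: C_def)
  have "\<eta>\<^sup>2 \<le> u\<^sup>2" using u \<eta> by (metis abs_le_square_iff abs_of_pos)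
  then have "1 \<le> u\<^sup>2 / \<eta>\<^sup>2" using \<eta> by simp
  then have "2 * pi\<^sup>2 * 1 \<le> 2 * pi\<^sup>2 * (u\<^sup>2 / \<eta>\<^sup>2)" by (intro mult_left_mono) auto
  then have Cu: "2 * u\<^sup>2 + 2 * pi\<^sup>2 \<le> C * u\<^sup>2" by (simp add: C_def algebra_simps)
  have "4 / (C * u\<^sup>2) \<le> fejer 1 u + fejer 1 (u - pi)"
  \<comment> \<open>At u = pi the closed form of the shifted kernel would divide by zero, so its
    value at 0 is bounded below directly.\<close>
  proof (cases "u = pi")
    case True
    have "3 * 3 \<le> u * u" unfolding True using pi_gt3 by (intro mult_mono) auto
    then have "8 \<le> u\<^sup>2" by (simp add: power2_eq_square)
    then have "2 * 8 \<le> C * u\<^sup>2" using C by (intro mult_mono) auto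
    then have "4 / (C * u\<^sup>2) \<le> 1 / 2" by (simp add: divide_le_eq)
    also have "\<dots> \<le> fejer 1 (u - pi)" using fejer_ge[of 1 0] True by simp
    also have "\<dots> \<le> fejer 1 u + fejer 1 (u - pi)" using fejer_nonneg[of 1 u] by simp
    finally show ?thesis .
  next
    case False
    have P: "C * u\<^sup>2 > 0" using C u0 by simp
    have 1: "u\<^sup>2 \<le> C * u\<^sup>2" using C by (simp add: mult_le_cancel_right1)
    have "(u - pi)\<^sup>2 + (u + pi)\<^sup>2 = 2 * u\<^sup>2 + 2 * pi\<^sup>2" by (simp add: power2_eq_square algebra_simps)
    then have 2: "(u - pi)\<^sup>2 \<le> C * u\<^sup>2" using Cu zero_le_power2[of "u + pi"] by linarith
    have c: "0 \<le> 2 * (1 - cos u)" "0 \<le> 2 * (1 + cos u)" using cos_ge_minus_one[of u] cos_le_one[of u] by (auto simp: zero_le_mult_iff simp del: cos_ge_minus_one)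
    have "4 / (C * u\<^sup>2) = 2 * (1 - cos u) / (C * u\<^sup>2) + 2 * (1 + cos u) / (C * u\<^sup>2)"
      by (simp add: add_divide_distrib[symmetric])
    also have "\<dots> \<le> 2 * (1 - cos u) / u\<^sup>2 + 2 * (1 + cos u) / (u - pi)\<^sup>2"
      using 1 2 P u0 False by (intro add_mono divide_left_mono c) auto
    also have "\<dots> = fejer 1 u + fejer 1 (u - pi)"
      using u0 False by (simp add: fejer_eq cos_diff)
    finally show ?thesis .
  qed
  then have "C / T * (4 / (C * u\<^sup>2)) \<le> C / T * (fejer 1 u + fejer 1 (u - pi))"
    using C T by (intro mult_left_mono) auto
  moreover have "C / T * (4 / (C * u\<^sup>2)) = 4 / (T * u\<^sup>2)" using C T by (simp add: field_simps)
  ultimately show ?thesis using fejer_decay[OF T u0] by (simp add: C_def)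
qed

lemma fejer_1_le: "fejer 1 u \<le> 8 / (1 + u\<^sup>2)"
proof (cases "\<bar>u\<bar> \<le> 1")
  case True
  then have "u\<^sup>2 \<le> 1" by (simp add: abs_square_le_1)
  then have "2 * (1 + u\<^sup>2) \<le> 8" by simp
  then have "2 \<le> 8 / (1 + u\<^sup>2)" by (simp add: pos_le_divide_eq add_pos_nonneg)
  then show ?thesis using fejer_le[of 1 u] by simp
next
  case False
  then have u: "u\<^sup>2 \<ge> 1" "u \<noteq> 0" by (auto simp: abs_square_le_1[symmetric] not_le)
  have "fejer 1 u \<le> 4 / u\<^sup>2" using fejer_decay[of 1 u] u by simp
  also have "\<dots> = 8 / (2 * u\<^sup>2)" by simp
  also have "\<dots> \<le> 8 / (1 + u\<^sup>2)" using u by (intro divide_left_mono mult_pos_pos) (auto simp: add_pos_nonneg)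
  finally show ?thesis .
qed

text \<open>The function arctan (ln z - y) is an antiderivative of 1 / (z (1 + (ln z - y)^2)) and
  has total variation at most pi, which bounds the sum over n uniformly in y. The factor 3 pays for
  replacing the intermediate point z by n.\<close>

lemma arctan_ln_step:
  assumes n: "n \<ge> 2"
  shows "1 / (real n * (1 + (y - ln (real n))\<^sup>2)) \<le> 3 * (arctan (ln (real n) - y) - arctan (ln (real (n - 1)) - y))"
proof -
  have "\<exists>z. real (n - 1) < z \<and> z < real n \<and>
      arctan (ln (real n) - y) - arctan (ln (real (n - 1)) - y) = (real n - real (n - 1)) * (1 / z * inverse (1 + (ln z - y)\<^sup>2))"
    using n by (intro MVT2) (auto intro!: derivative_eq_intros)
  then obtain z where z: "real (n - 1) < z" "z < real n"
    "arctan (ln (real n) - y) - arctan (ln (real (n - 1)) - y) = (real n - real (n - 1)) * (1 / z * inverse (1 + (ln z - y)\<^sup>2))" by blast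
  have zp: "z > 0" using z(1) n by linarith
  have "ln (real n) - ln z = ln (real n / z)" using zp n by (simp add: ln_div)
  also have "\<dots> \<le> real n / z - 1" using zp n by (intro ln_le_minus_one) auto
  also have "\<dots> \<le> 1" using z(1) zp n by (simp add: field_simps)
  finally have d: "ln (real n) - ln z \<le> 1" "0 \<le> ln (real n) - ln z" using z(2) zp by auto
  \<comment> \<open>Here v + w = ln z - ln n has absolute value at most 1, so v^2 <= 2 (v + w)^2 + 2
    w^2 gives 1 + v^2 <= 3 (1 + w^2).\<close>
  define v w where "v = ln z - y" and "w = y - ln (real n)"
  have "(v + w)\<^sup>2 \<le> 1" using d by (simp add: v_def w_def abs_square_le_1)
  moreover have "v\<^sup>2 \<le> 2 * (v + w)\<^sup>2 + 2 * w\<^sup>2"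
    using zero_le_power2[of "v + 2 * w"] by (simp add: power2_eq_square algebra_simps)
  ultimately have "1 + v\<^sup>2 \<le> 3 * (1 + w\<^sup>2)" using zero_le_power2[of w] unfolding distrib_left by linarith
  then have "z * (1 + v\<^sup>2) \<le> real n * (3 * (1 + w\<^sup>2))" using z(2) zp by (intro mult_mono) (auto simp: add_nonneg_nonneg)
  then have *: "1 / (real n * (3 * (1 + w\<^sup>2))) \<le> 1 / (z * (1 + v\<^sup>2))"
    using zp n by (intro divide_left_mono mult_pos_pos) (auto simp: add_pos_nonneg)
  have alg: "1 / (a * b) = 3 * (1 / (a * (3 * b)))" for a b :: real by simp
  have "1 / (real n * (1 + w\<^sup>2)) = 3 * (1 / (real n * (3 * (1 + w\<^sup>2))))" by (rule alg)
  also have "\<dots> \<le> 3 * (1 / (z * (1 + v\<^sup>2)))" using * by (rule mult_left_mono) simp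
  also have "1 / (z * (1 + v\<^sup>2)) = arctan (ln (real n) - y) - arctan (ln (real (n - 1)) - y)"
    using z(3) n by (simp add: v_def of_nat_diff divide_inverse)
  finally show ?thesis unfolding w_def .
qed

text \<open>The bound is uniform in delta and y. The 8 covers n = 1, where no earlier logarithm is
  available to telescope; 24 = 8 * 3 multiplies the variation of the arctangent.\<close>

lemma fejer_harmonic_bound:
  "(\<Sum>n<N. real n powr - (1 + \<delta>) * fejer 1 (y - ln (real n))) \<le> 8 + 24 * pi" if "\<delta> > 0"
proof -
  let ?f = "\<lambda>n. real n powr - (1 + \<delta>) * fejer 1 (y - ln (real n))"
  have f: "?f n \<le> 8 * (1 / (real n * (1 + (y - ln (real n))\<^sup>2)))" if n: "n \<ge> 1" for n
  proof -
    have "real n powr - (1 + \<delta>) \<le> real n powr - 1" using n \<open>\<delta> > 0\<close> by (intro powr_mono) auto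
    then have "?f n \<le> real n powr - 1 * (8 / (1 + (y - ln (real n))\<^sup>2))"
      using fejer_1_le fejer_nonneg by (intro mult_mono) auto
    then show ?thesis using n by (simp add: powr_minus divide_simps)
  qed
  have *: "(\<Sum>n<N + 2. ?f n) \<le> 8 + 24 * (arctan (ln (real (N + 1)) - y) - arctan (- y))" for N
  proof (induction N)
    case 0
    have "8 * (1 / (real 1 * (1 + (y - ln (real 1))\<^sup>2))) \<le> 8" by (simp add: divide_le_eq add_pos_nonneg)
    with f[of 1] show ?case by (simp add: numeral_2_eq_2)
  next
    case (Suc N)
    have "?f (N + 2) \<le> 8 * (3 * (arctan (ln (real (N + 2)) - y) - arctan (ln (real (N + 2 - 1)) - y)))"
      using f[of "N + 2"] arctan_ln_step[of "N + 2" y] by simp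
    with Suc show ?case by (simp add: add_ac)
  qed
  have "(\<Sum>n<N. ?f n) \<le> (\<Sum>n<N + 2. ?f n)" using fejer_nonneg by (intro sum_mono2) auto
  also have "\<dots> \<le> 8 + 24 * pi"
    using *[of N] arctan_ubound[of "ln (real (N + 1)) - y"] arctan_lbound[of "- y"] by simp
  finally show ?thesis .
qed

text \<open>The real part of exp (i t y) * n powr (-i t) is cos (t (y - ln n)). Since delta > 0, the
  series converges uniformly in t, and sum and integral may be exchanged.\<close>

lemma fejer_dirichlet_series:
  assumes c: "abs_conv_beyond_1 c" and d: "\<delta> > 0" and T: "T > 0"
  shows "(\<lambda>n. c n * real n powr - (1 + \<delta>) * fejer T (y - ln (real n))) sums
    (2 * integral {0..T} (\<lambda>t. (1 - t / T) * Re (exp (\<i> * of_real (t * y)) * dirichlet_series c (of_real (1 + \<delta>) + \<i> * of_real t))))"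
proof -
  let ?f = "\<lambda>n t. c n * real n powr - (1 + \<delta>) * ((1 - t / T) * cos (t * (y - ln (real n))))"
  let ?h = "\<lambda>t. (1 - t / T) * Re (exp (\<i> * of_real (t * y)) * dirichlet_series c (of_real (1 + \<delta>) + \<i> * of_real t))"
  have fsums: "(\<lambda>n. ?f n t) sums ?h t" for t
  proof -
    let ?s = "of_real (1 + \<delta>) + \<i> * of_real t"
    have "(\<lambda>n. of_real (c n) * of_nat n powr - ?s) sums dirichlet_series c ?s"
      unfolding dirichlet_series_def by (intro summable_sums abs_conv_beyond_1_summable c) (use d in auto)
    then have "(\<lambda>n. (1 - t / T) * Re (exp (\<i> * of_real (t * y)) * (of_real (c n) * of_nat n powr - ?s))) sums ?h t"
      by (intro sums_mult sums_Re)
    moreover have "Re (exp (\<i> * of_real (t * y)) * (of_real (c n) * of_nat n powr - ?s)) =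
        c n * real n powr - (1 + \<delta>) * cos (t * (y - ln (real n)))" for n
    proof (cases "n = 0")
      case False
      have "exp (\<i> * of_real (t * y)) * of_nat n powr - ?s =
          exp (of_real (- (1 + \<delta>) * ln (real n)) + \<i> * of_real (t * (y - ln (real n))))"
        using False by (simp add: powr_def Ln_of_nat algebra_simps flip: exp_add)
      then have "Re (exp (\<i> * of_real (t * y)) * of_nat n powr - ?s) = real n powr - (1 + \<delta>) * cos (t * (y - ln (real n)))"
        using False by (simp add: Re_exp powr_def)
      moreover have "Re (of_real x * z) = x * Re z" for x z by simp
      note Re_of_real_mult = this
      have "exp (\<i> * of_real (t * y)) * (of_real (c n) * of_nat n powr - ?s) =
          of_real (c n) * (exp (\<i> * of_real (t * y)) * of_nat n powr - ?s)" by simp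
      then have "Re (exp (\<i> * of_real (t * y)) * (of_real (c n) * of_nat n powr - ?s)) =
          c n * Re (exp (\<i> * of_real (t * y)) * of_nat n powr - ?s)" by (simp only: Re_of_real_mult)
      ultimately show ?thesis by (simp only: mult.assoc)
    qed simp
    ultimately show ?thesis by (simp only: mult_ac)
  qed
  have "uniform_limit {0..T} (\<lambda>N t. \<Sum>n<N. ?f n t) (\<lambda>t. \<Sum>n. ?f n t) sequentially"
  proof (rule Weierstrass_m_test)
    show "summable (\<lambda>n. \<bar>c n\<bar> * real n powr - (1 + \<delta>))"
      using c[unfolded abs_conv_beyond_1_def, rule_format, of "1 + \<delta>"] d by simp
    fix n t assume t: "t \<in> {0..T}"
    have "\<bar>(1 - t / T) * cos (t * (y - ln (real n)))\<bar> \<le> 1 * 1"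
      unfolding abs_mult using t T by (intro mult_mono) auto
    then have "\<bar>c n\<bar> * real n powr - (1 + \<delta>) * \<bar>(1 - t / T) * cos (t * (y - ln (real n)))\<bar> \<le> \<bar>c n\<bar> * real n powr - (1 + \<delta>) * 1"
      by (intro mult_left_mono) auto
    then show "norm (?f n t) \<le> \<bar>c n\<bar> * real n powr - (1 + \<delta>)" by (simp add: abs_mult)
  qed
  then have u: "uniform_limit {0..T} (\<lambda>N t. \<Sum>n<N. ?f n t) ?h sequentially"
    using sums_unique[OF fsums] by simp
  obtain I J where IJ: "\<And>N. ((\<lambda>t. \<Sum>n<N. ?f n t) has_integral I N) {0..T}" "(?h has_integral J) {0..T}" "I \<longlonglongrightarrow> J"
    by (rule uniform_limit_integral[OF u]) (use T in \<open>auto intro!: continuous_intros\<close>)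
  have "I N = (\<Sum>n<N. c n * real n powr - (1 + \<delta>) * fejer T (y - ln (real n)) / 2)" for N
  proof -
    have "((\<lambda>t. \<Sum>n<N. ?f n t) has_integral (\<Sum>n<N. c n * real n powr - (1 + \<delta>) * fejer T (y - ln (real n)) / 2)) {0..T}"
    proof (intro has_integral_sum ballI)
      fix n
      have "((\<lambda>t. (1 - t / T) * cos (t * (y - ln (real n)))) has_integral fejer T (y - ln (real n)) / 2) {0..T}"
        unfolding fejer_def using T by (auto intro!: integrable_integral integrable_continuous_real continuous_intros)
      from has_integral_mult_right[OF this, of "c n * real n powr - (1 + \<delta>)"]
      show "(?f n has_integral c n * real n powr - (1 + \<delta>) * fejer T (y - ln (real n)) / 2) {0..T}" by simp
    qed auto
    then show ?thesis using IJ(1) has_integral_unique by blast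
  qed
  then have "I = (\<lambda>N. \<Sum>n<N. c n * real n powr - (1 + \<delta>) * fejer T (y - ln (real n)) / 2)" by (rule ext)
  with IJ(3) have "(\<lambda>n. c n * real n powr - (1 + \<delta>) * fejer T (y - ln (real n)) / 2) sums J"
    unfolding sums_def by (simp only:)
  from sums_mult[OF this, of 2] show ?thesis using integral_unique[OF IJ(2)] by simp
qed


section \<open>Decay and continuity of the Fejer transform\<close>

lemma riemann_lebesgue_C1:
  fixes f :: "real \<Rightarrow> complex"
  assumes T: "T \<ge> 0" and f: "\<And>t. t \<in> {0..T} \<Longrightarrow> (f has_vector_derivative f' t) (at t within {0..T})"
    and cf': "continuous_on {0..T} f'"
  shows "((\<lambda>y. integral {0..T} (\<lambda>t. exp (\<i> * of_real (t * y)) * f t)) \<longlongrightarrow> 0) at_top"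
proof -
  obtain M where M: "\<And>t. t \<in> {0..T} \<Longrightarrow> norm (f' t) \<le> M"
    using compact_imp_bounded[OF compact_continuous_image[OF cf' compact_Icc]]
    unfolding bounded_iff by blast
  let ?e = "\<lambda>y t. exp (\<i> * of_real (t * y))"
  have cf: "continuous_on {0..T} f" using f by (meson continuous_on_eq_continuous_within has_vector_derivative_continuous)
  have bound: "norm (integral {0..T} (\<lambda>t. ?e y t * f t)) \<le> (norm (f T) + norm (f 0) + M * T) / y" if y: "y > 0" for y
  proof -
    \<comment> \<open>Integration by parts: the derivative of exp (i t y) / (i y) * f t is
      integrated, and each boundary or remainder term carries a factor 1 / y.\<close>
    have ne: "\<i> * of_real y \<noteq> 0" using y by simp
    have "((\<lambda>t. ?e y t * f t + ?e y t / (\<i> * of_real y) * f' t) has_integral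
        (?e y T / (\<i> * of_real y) * f T - ?e y 0 / (\<i> * of_real y) * f 0)) {0..T}"
    proof (rule fundamental_theorem_of_calculus[OF T])
      fix t assume t: "t \<in> {0..T}"
      have "((\<lambda>z. exp (\<i> * (z * of_real y)) / (\<i> * of_real y)) has_field_derivative ?e y t) (at (of_real t))"
        using ne by (auto intro!: derivative_eq_intros simp: mult_ac)
      from has_vector_derivative_real_field[OF this]
      have "((\<lambda>t. ?e y t / (\<i> * of_real y)) has_vector_derivative ?e y t) (at t within {0..T})"
        by simp
      from has_vector_derivative_mult[OF this f[OF t]]
      show "((\<lambda>t. ?e y t / (\<i> * of_real y) * f t) has_vector_derivative ?e y t * f t + ?e y t / (\<i> * of_real y) * f' t) (at t within {0..T})"
        by (simp add: add.commute)
    qed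
    moreover have i: "(\<lambda>t. ?e y t / (\<i> * of_real y) * f' t) integrable_on {0..T}"
      using ne by (intro integrable_continuous_real continuous_intros cf') auto
    ultimately have "((\<lambda>t. (?e y t * f t + ?e y t / (\<i> * of_real y) * f' t) - ?e y t / (\<i> * of_real y) * f' t) has_integral
        (?e y T / (\<i> * of_real y) * f T - ?e y 0 / (\<i> * of_real y) * f 0) - integral {0..T} (\<lambda>t. ?e y t / (\<i> * of_real y) * f' t)) {0..T}"
      by (intro has_integral_diff integrable_integral)
    then have "integral {0..T} (\<lambda>t. ?e y t * f t) =
        (?e y T / (\<i> * of_real y) * f T - ?e y 0 / (\<i> * of_real y) * f 0) - integral {0..T} (\<lambda>t. ?e y t / (\<i> * of_real y) * f' t)"
      by (simp only: add_diff_cancel_right') (rule integral_unique)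
    also have "norm \<dots> \<le> (norm (f T) / y + norm (f 0) / y) + M / y * T"
    proof (rule order_trans[OF norm_triangle_ineq4 add_mono[OF order_trans[OF norm_triangle_ineq4 add_mono]]])
      have "norm (integral {0..T} (\<lambda>t. ?e y t / (\<i> * of_real y) * f' t)) \<le> M / y * (T - 0)"
        using y M ne by (intro integral_bound T) (auto simp: norm_mult norm_divide intro!: divide_right_mono continuous_intros cf')
      then show "norm (integral {0..T} (\<lambda>t. ?e y t / (\<i> * of_real y) * f' t)) \<le> M / y * T" by simp
    qed (use y in \<open>auto simp: norm_mult norm_divide\<close>)
    finally show ?thesis using y by (simp add: add_divide_distrib)
  qed
  have "((\<lambda>y. (norm (f T) + norm (f 0) + M * T) / y) \<longlongrightarrow> 0) at_top"
    by (rule tendsto_divide_0[OF tendsto_const]) (rule filterlim_at_top_imp_at_infinity[OF filterlim_ident])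
  moreover have "\<forall>\<^sub>F y in at_top. norm (integral {0..T} (\<lambda>t. ?e y t * f t)) \<le> (norm (f T) + norm (f 0) + M * T) / y"
    using eventually_gt_at_top[of 0] by eventually_elim (rule bound)
  ultimately show ?thesis by (rule Lim_null_comparison[rotated])
qed

text \<open>The right-hand side of the kernel identity with the Dirichlet series replaced by an
  extension H, so that delta = 0 makes sense.\<close>

definition fejer_transform :: "(complex \<Rightarrow> complex) \<Rightarrow> real \<Rightarrow> real \<Rightarrow> real \<Rightarrow> real" where
  "fejer_transform H T \<delta> y = 2 * integral {0..T} (\<lambda>t. (1 - t / T) * Re (exp (\<i> * of_real (t * y)) * H (of_real (1 + \<delta>) + \<i> * of_real t)))"

lemma fejer_transform_tendsto_0:
  assumes U: "open U" "{s. Re s \<ge> 1} \<subseteq> U" "H holomorphic_on U" and T: "T > 0"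
  shows "((\<lambda>y. fejer_transform H T 0 y) \<longlongrightarrow> 0) at_top"
proof -
  let ?f = "\<lambda>t. of_real (1 - t / T) * H (1 + \<i> * of_real t)"
  let ?f' = "\<lambda>t. of_real (1 - t / T) * (\<i> * deriv H (1 + \<i> * of_real t)) + of_real (- 1 / T) * H (1 + \<i> * of_real t)"
  have in_U: "1 + \<i> * of_real t \<in> U" for t using U(2) by auto
  have c: "continuous_on A (\<lambda>t. G (1 + \<i> * of_real t))" if "G holomorphic_on U" for G and A :: "real set"
    by (rule continuous_on_compose2[OF holomorphic_on_imp_continuous_on[OF that]]) (use in_U in \<open>auto intro!: continuous_intros\<close>)
  have "((\<lambda>y. integral {0..T} (\<lambda>t. exp (\<i> * of_real (t * y)) * ?f t)) \<longlongrightarrow> 0) at_top"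
  proof (rule riemann_lebesgue_C1)
    show "continuous_on {0..T} ?f'"
      using T by (intro continuous_intros c U(3) holomorphic_deriv U(1)) auto
    fix t assume "t \<in> {0..T}"
    have "(H has_field_derivative deriv H (1 + \<i> * of_real t)) (at (1 + \<i> * of_real t))"
      by (rule holomorphic_derivI[OF U(3,1) in_U])
    moreover have "((\<lambda>z. 1 + \<i> * z) has_field_derivative \<i>) (at (of_real t))"
      by (auto intro!: derivative_eq_intros)
    ultimately have "((\<lambda>z. H (1 + \<i> * z)) has_field_derivative deriv H (1 + \<i> * of_real t) * \<i>) (at (of_real t))"
      by (rule DERIV_chain2)
    from has_vector_derivative_real_field[OF this]
    have 1: "((\<lambda>t. H (1 + \<i> * of_real t)) has_vector_derivative \<i> * deriv H (1 + \<i> * of_real t)) (at t within {0..T})"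
      by (simp add: mult.commute)
    have "((\<lambda>z. 1 - z / of_real T) has_field_derivative of_real (- 1 / T)) (at (of_real t :: complex))"
      using T by (auto intro!: derivative_eq_intros)
    from has_vector_derivative_real_field[OF this]
    have 2: "((\<lambda>t. of_real (1 - t / T) :: complex) has_vector_derivative of_real (- 1 / T)) (at t within {0..T})" by simp
    show "(?f has_vector_derivative ?f' t) (at t within {0..T})"
      by (rule has_vector_derivative_mult[OF 2 1])
  qed (use T in auto)
  from tendsto_mult_left[OF tendsto_Re[OF this], of 2]
  have "((\<lambda>y. 2 * Re (integral {0..T} (\<lambda>t. exp (\<i> * of_real (t * y)) * ?f t))) \<longlongrightarrow> 0) at_top" by simp
  moreover have "2 * Re (integral {0..T} (\<lambda>t. exp (\<i> * of_real (t * y)) * ?f t)) = fejer_transform H T 0 y" for y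
  proof -
    have "(\<lambda>t. exp (\<i> * of_real (t * y)) * ?f t) integrable_on {0..T}"
      using T by (intro integrable_continuous_real continuous_intros c U(3)) auto
    then have "Re (integral {0..T} (\<lambda>t. exp (\<i> * of_real (t * y)) * ?f t)) = integral {0..T} (\<lambda>t. Re (exp (\<i> * of_real (t * y)) * ?f t))"
      by (rule integral_linear[OF _ bounded_linear_Re, symmetric, unfolded o_def])
    moreover have "Re (exp (\<i> * of_real (t * y)) * ?f t) = (1 - t / T) * Re (exp (\<i> * of_real (t * y)) * H (of_real (1 + 0) + \<i> * of_real t))" for t
    proof -
      have "exp (\<i> * of_real (t * y)) * ?f t = of_real (1 - t / T) * (exp (\<i> * of_real (t * y)) * H (of_real (1 + 0) + \<i> * of_real t))"
        by simp
      moreover have "Re (of_real x * z) = x * Re z" for x z by simp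
      ultimately show ?thesis by (simp only:)
    qed
    ultimately show ?thesis unfolding fejer_transform_def by (simp only:)
  qed
  ultimately show ?thesis by simp
qed

text \<open>Compactness of [0, 1] x [0, T]. The limit carries the decay at delta = 0 back to small
  delta > 0; the bound, uniform in delta and y, is applied at height T = 1.\<close>

lemma fejer_transform_continuous:
  assumes U: "{s. Re s \<ge> 1} \<subseteq> U" "continuous_on U H" and T: "T > 0"
  shows "((\<lambda>\<delta>. fejer_transform H T \<delta> y) \<longlongrightarrow> fejer_transform H T 0 y) (at_right 0)"
    and "\<exists>M. \<forall>\<delta>\<in>{0..1}. \<forall>y. \<bar>fejer_transform H T \<delta> y\<bar> \<le> M"
proof -
  have c: "continuous_on ({0..1} \<times> {0..T}) (\<lambda>x. H (of_real (1 + fst x) + \<i> * of_real (snd x)))"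
    by (rule continuous_on_compose2[OF U(2)]) (use U(1) in \<open>auto intro!: continuous_intros\<close>)
  have "continuous_on {0..1} (\<lambda>\<delta>. integral (cbox 0 T) (\<lambda>t. (1 - t / T) * Re (exp (\<i> * of_real (t * y)) * H (of_real (1 + \<delta>) + \<i> * of_real t))))"
  proof (rule integral_continuous_on_param)
    show "continuous_on ({0..1} \<times> cbox 0 T) (\<lambda>(\<delta>, t). (1 - t / T) * Re (exp (\<i> * of_real (t * y)) * H (of_real (1 + \<delta>) + \<i> * of_real t)))"
      using T c unfolding case_prod_unfold cbox_interval by (intro continuous_intros) auto
  qed
  then have "continuous_on {0..1} (\<lambda>\<delta>. fejer_transform H T \<delta> y)" unfolding fejer_transform_def cbox_interval by (intro continuous_intros)
  then have "((\<lambda>\<delta>. fejer_transform H T \<delta> y) \<longlongrightarrow> fejer_transform H T 0 y) (at 0 within {0..1})" by (auto simp: continuous_on)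
  then show "((\<lambda>\<delta>. fejer_transform H T \<delta> y) \<longlongrightarrow> fejer_transform H T 0 y) (at_right 0)"
    by (simp add: at_within_Icc_at_right)
  obtain M where M: "\<And>x. x \<in> {0..1} \<times> {0..T} \<Longrightarrow> norm (H (of_real (1 + fst x) + \<i> * of_real (snd x))) \<le> M"
    using compact_imp_bounded[OF compact_continuous_image[OF c compact_Times[OF compact_Icc compact_Icc]]]
    unfolding bounded_iff by blast
  have "\<bar>fejer_transform H T \<delta> y\<bar> \<le> 2 * (M * (T - 0))" if d: "\<delta> \<in> {0..1}" for \<delta> y
  proof -
    have ct: "continuous_on {0..T} (\<lambda>t. H (of_real (1 + \<delta>) + \<i> * of_real t))"
      by (rule continuous_on_compose2[OF U(2)]) (use U(1) d in \<open>auto intro!: continuous_intros\<close>)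
    have "norm (integral {0..T} (\<lambda>t. (1 - t / T) * Re (exp (\<i> * of_real (t * y)) * H (of_real (1 + \<delta>) + \<i> * of_real t)))) \<le> M * (T - 0)"
    proof (rule integral_bound)
      show "continuous_on {0..T} (\<lambda>t. (1 - t / T) * Re (exp (\<i> * of_real (t * y)) * H (of_real (1 + \<delta>) + \<i> * of_real t)))"
        using T by (intro continuous_intros ct) auto
      fix t assume t: "t \<in> {0..T}"
      have "norm (H (of_real (1 + \<delta>) + \<i> * of_real t)) \<le> M" using M[of "(\<delta>, t)"] d t by simp
      moreover have "\<bar>Re (exp (\<i> * of_real (t * y)) * H (of_real (1 + \<delta>) + \<i> * of_real t))\<bar> \<le> norm (H (of_real (1 + \<delta>) + \<i> * of_real t))"
        by (rule order_trans[OF abs_Re_le_cmod]) (simp add: norm_mult)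
      ultimately have "\<bar>1 - t / T\<bar> * \<bar>Re (exp (\<i> * of_real (t * y)) * H (of_real (1 + \<delta>) + \<i> * of_real t))\<bar> \<le> 1 * M"
        using t T by (intro mult_mono) auto
      then show "norm ((1 - t / T) * Re (exp (\<i> * of_real (t * y)) * H (of_real (1 + \<delta>) + \<i> * of_real t))) \<le> M"
        unfolding real_norm_def abs_mult by (simp only: mult_1)
    qed (use T in auto)
    then show ?thesis unfolding fejer_transform_def by (simp only: real_norm_def abs_mult abs_numeral) 
  qed
  then show "\<exists>M. \<forall>\<delta>\<in>{0..1}. \<forall>y. \<bar>fejer_transform H T \<delta> y\<bar> \<le> M" by blast
qed


text \<open>The interval from exp (y - v) to exp y holds at least exp y - exp (y - v) - 1 integers,
  each of weight at least exp (-y); the rounding loss becomes exp (-y). For v <= 1, 1 - exp (-v) >=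
  v / 2.\<close>

lemma harmonic_short_interval:
  assumes v: "0 < v" "v \<le> 1"
  shows "v / 2 - exp (- y) \<le> (\<Sum>n | 0 < n \<and> y - v \<le> ln (real n) \<and> ln (real n) \<le> y. 1 / real n)"
proof -
  let ?S = "{n::nat. 0 < n \<and> y - v \<le> ln (real n) \<and> ln (real n) \<le> y}"
  have iff: "n \<in> ?S \<longleftrightarrow> exp (y - v) \<le> real n \<and> real n \<le> exp y" for n
  proof -
    have "n > 0" if "exp (y - v) \<le> real n" using that exp_gt_zero[of "y - v"] by (cases n) auto
    then show ?thesis by (auto simp: ln_ge_iff ln_le_cancel_iff) (metis exp_le_cancel_iff exp_ln of_nat_0_less_iff, metis ln_exp ln_le_cancel_iff exp_gt_zero of_nat_0_less_iff)
  qed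
  define a b where "a = nat \<lceil>exp (y - v)\<rceil>" and "b = nat \<lfloor>exp y\<rfloor>"
  have S: "?S = {a..b}"
    unfolding set_eq_iff iff by (auto simp: a_def b_def nat_le_iff le_nat_iff ceiling_le_iff le_floor_iff)
  have "real b \<ge> exp y - 1" unfolding b_def using exp_gt_zero[of y] by linarith
  moreover have "real a \<le> exp (y - v) + 1" unfolding a_def using exp_gt_zero[of "y - v"] by linarith
  ultimately have card: "exp y - exp (y - v) - 1 \<le> real (card ?S)" unfolding S by simp
  have "exp (- v) \<le> 1 - v / 2"
  proof -
    have "1 \<le> (1 + v) * (1 - v / 2)" using v by (simp add: algebra_simps power2_eq_square mult_left_le)
    also have "\<dots> \<le> exp v * (1 - v / 2)" using exp_ge_add_one_self[of v] v by (intro mult_right_mono) auto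
    finally show ?thesis by (simp add: exp_minus divide_simps mult.commute)
  qed
  then have "exp y * exp (- v) \<le> exp y * (1 - v / 2)" by (rule mult_left_mono) simp
  moreover have "exp y * exp (- v) = exp (y - v)" by (simp flip: exp_add)
  moreover have "exp y * (1 - v / 2) = exp y - exp y * (v / 2)" by (simp add: right_diff_distrib)
  ultimately have "exp y * (v / 2) - 1 \<le> exp y - exp (y - v) - 1" by linarith
  moreover have "exp (- y) * (exp y * (v / 2) - 1) = v / 2 - exp (- y)"
  proof -
    have "exp (- y) * exp y = 1" by (simp flip: exp_add)
    then show ?thesis by (simp only: right_diff_distrib mult.assoc[symmetric] mult_1 mult_1_right)
  qed
  ultimately have "v / 2 - exp (- y) \<le> exp (- y) * (exp y - exp (y - v) - 1)"
    by (metis exp_ge_zero mult_left_mono)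
  also have "\<dots> \<le> exp (- y) * real (card ?S)" using card by (intro mult_left_mono) auto
  also have "\<dots> = (\<Sum>n\<in>?S. exp (- y))" by simp
  also have "\<dots> \<le> (\<Sum>n\<in>?S. 1 / real n)"
  proof (rule sum_mono)
    fix n assume "n \<in> ?S"
    then have "real n \<le> exp y" "0 < n" using iff by auto
    then show "exp (- y) \<le> 1 / real n" by (simp add: exp_minus divide_simps)
  qed
  finally show ?thesis .
qed

lemma finite_log_window: "finite {n::nat. 0 < n \<and> \<bar>y - ln (real n)\<bar> \<le> \<eta>}"
proof (rule finite_subset[of _ "{..nat \<lceil>exp (y + \<eta>)\<rceil>}"])
  show "{n::nat. 0 < n \<and> \<bar>y - ln (real n)\<bar> \<le> \<eta>} \<subseteq> {..nat \<lceil>exp (y + \<eta>)\<rceil>}"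
  proof
    fix n assume n: "n \<in> {n::nat. 0 < n \<and> \<bar>y - ln (real n)\<bar> \<le> \<eta>}"
    then have "ln (real n) \<le> y + \<eta>" by auto
    moreover have "real n = exp (ln (real n))" using n by simp
    ultimately have "real n \<le> exp (y + \<eta>)" by (metis exp_le_cancel_iff)
    then show "n \<in> {..nat \<lceil>exp (y + \<eta>)\<rceil>}" by simp linarith
  qed
qed simp

text \<open>A form of the Wiener--Ikehara theorem. Against the kernel at height \<open>T\<close>, the tails of the sum over
  \<open>n\<close> are \<open>O(1/T)\<close> by comparison with the kernel at height 1, whose total mass is bounded; the part
  close to \<open>y\<close> therefore keeps a positive mass once \<open>T\<close> is large and \<open>y\<close> is large in terms of \<open>T\<close>.\<close>

theorem short_interval_mass:
  fixes a :: "nat \<Rightarrow> real"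
  assumes a: "\<And>n. a n \<ge> 0" "abs_conv_beyond_1 a" and ext: "continues_past_1 (\<lambda>s. dirichlet_series a s - dirichlet_series (\<lambda>n. 1) s)" and \<eta>: "\<eta> > 0"
  shows "\<exists>c>0. \<forall>\<^sub>F y in at_top. c \<le> (\<Sum>n | 0 < n \<and> \<bar>y - ln (real n)\<bar> \<le> \<eta>. a n / real n)"
proof -
  obtain U H where U: "open U" "{s. Re s \<ge> 1} \<subseteq> U" "H holomorphic_on U"
    and H: "\<And>s. Re s > 1 \<Longrightarrow> H s = dirichlet_series a s - dirichlet_series (\<lambda>n. 1) s" using ext unfolding continues_past_1_def by blast
  have one: "abs_conv_beyond_1 (\<lambda>n. 1)" by (rule abs_conv_beyond_1_ln[of _ 1]) simp
  have cH: "continuous_on U H" using U(3) by (rule holomorphic_on_imp_continuous_on)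
  let ?k = "\<lambda>T \<delta> y n. real n powr - (1 + \<delta>) * fejer T (y - ln (real n))"
  have knn: "?k T \<delta> y n \<ge> 0" if "T > 0" for T \<delta> y n using fejer_nonneg[OF that] by auto
  \<comment> \<open>Only the difference from the constant coefficients extends past the line, so the
    kernel identity is applied to \<open>a n - 1\<close> and compared with the harmonic sum.\<close>
  have diff: "(\<lambda>n. (a n - 1) * real n powr - (1 + \<delta>) * fejer T (y - ln (real n))) sums fejer_transform H T \<delta> y"
    if d: "\<delta> > 0" and T: "T > 0" for \<delta> T y
  proof -
    have c: "abs_conv_beyond_1 (\<lambda>n. a n - 1)" unfolding abs_conv_beyond_1_def
    proof (intro allI impI)
      fix \<sigma> :: real assume s: "1 < \<sigma>"
      have "summable (\<lambda>n. \<bar>a n\<bar> * real n powr - \<sigma> + \<bar>1\<bar> * real n powr - \<sigma>)"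
        using a(2) one s unfolding abs_conv_beyond_1_def by (intro summable_add) blast+
      then show "summable (\<lambda>n. \<bar>a n - 1\<bar> * real n powr - \<sigma>)"
      proof (rule summable_comparison_test'[where N = 0])
        fix n
        have "\<bar>a n - 1\<bar> * real n powr - \<sigma> \<le> (\<bar>a n\<bar> + \<bar>1\<bar>) * real n powr - \<sigma>" by (intro mult_right_mono) auto
        then show "norm (\<bar>a n - 1\<bar> * real n powr - \<sigma>) \<le> \<bar>a n\<bar> * real n powr - \<sigma> + \<bar>1\<bar> * real n powr - \<sigma>"
          by (simp add: distrib_right)
      qed
    qed
    have "dirichlet_series (\<lambda>n. a n - 1) (of_real (1 + \<delta>) + \<i> * of_real t) = H (of_real (1 + \<delta>) + \<i> * of_real t)" for t
    proof -
      let ?s = "of_real (1 + \<delta>) + \<i> * of_real t"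
      have s: "Re ?s > 1" using d by simp
      have "dirichlet_series a ?s - dirichlet_series (\<lambda>n. 1) ?s = dirichlet_series (\<lambda>n. a n - 1) ?s"
        unfolding dirichlet_series_def suminf_diff[OF abs_conv_beyond_1_summable[OF a(2) s] abs_conv_beyond_1_summable[OF one s]]
        by (simp add: left_diff_distrib)
      then show ?thesis using H[OF s] by simp
    qed
    with fejer_dirichlet_series[OF c d T, of y] show ?thesis unfolding fejer_transform_def by (simp only:)
  qed
  have A: "summable (\<lambda>n. a n * ?k T \<delta> y n)" if "\<delta> > 0" "T > 0" for T \<delta> y
    using sums_summable[OF fejer_dirichlet_series[OF a(2) that, of y]] by (simp only: mult.assoc)
  have O: "summable (\<lambda>n. ?k T \<delta> y n)" if "\<delta> > 0" "T > 0" for T \<delta> y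
    using sums_summable[OF fejer_dirichlet_series[OF one that, of y]] by simp
  have AO: "(\<Sum>n. a n * ?k T \<delta> y n) = fejer_transform H T \<delta> y + (\<Sum>n. ?k T \<delta> y n)" if "\<delta> > 0" "T > 0" for T \<delta> y
  proof -
    have "(\<Sum>n. a n * ?k T \<delta> y n) - (\<Sum>n. ?k T \<delta> y n) = (\<Sum>n. a n * ?k T \<delta> y n - ?k T \<delta> y n)"
      by (rule suminf_diff[OF A O]) (use that in auto)
    also have "\<dots> = fejer_transform H T \<delta> y"
      using sums_unique[OF diff[OF that, of y]] by (simp add: algebra_simps)
    finally show ?thesis by simp
  qed
  have "\<exists>M. \<forall>\<delta>\<in>{0..1}. \<forall>y. \<bar>fejer_transform H 1 \<delta> y\<bar> \<le> M" by (rule fejer_transform_continuous(2)[OF U(2) cH]) simp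
  then obtain M where "\<forall>\<delta>\<in>{0..1}. \<forall>y. \<bar>fejer_transform H 1 \<delta> y\<bar> \<le> M" ..
  then have M: "\<bar>fejer_transform H 1 \<delta> y\<bar> \<le> M" if "\<delta> \<in> {0..1}" for \<delta> y using that by simp
  \<comment> \<open>Bounds the kernel sum of a at height 1 for all y and all delta up to 1: the
    transform of H plus the harmonic mass. The maximum with 1 keeps it positive.\<close>
  define M1 where "M1 = max 1 (M + (8 + 24 * pi))"
  have M1: "(\<Sum>n. a n * ?k 1 \<delta> y n) \<le> M1" if d: "0 < \<delta>" "\<delta> \<le> 1" for \<delta> y
  proof -
    have "(\<Sum>n. ?k 1 \<delta> y n) \<le> 8 + 24 * pi"
      using O[of \<delta> 1] fejer_harmonic_bound[OF d(1), of y] d by (intro suminf_le_const) auto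
    then show ?thesis using AO[of \<delta> 1 y] M[of \<delta> y] d unfolding M1_def by auto
  qed
  define C where "C = 2 + 2 * pi\<^sup>2 / \<eta>\<^sup>2"
  have C: "C \<ge> 2" by (simp add: C_def)
  \<comment> \<open>Makes the tail C / T * 2 M1, with one M1 for each of the two shifted kernels,
    equal to 1/64; the main term will be at least 1/16.\<close>
  define T where "T = 128 * C * M1"
  have M1p: "M1 \<ge> 1" by (simp add: M1_def)
  have "1 * 1 \<le> C * M1" using C M1p by (intro mult_mono) auto
  then have T: "T > 1" by (simp add: T_def)
  have tail: "C / T * (2 * M1) = 1 / 64" using C M1p by (simp add: T_def)
  \<comment> \<open>On the window of length 1 / T below y the kernel is at least T / 2, the harmonic
    mass is at least 1 / (4 T), and n powr (-delta) is at least 1/2; the product is 1/16.\<close>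
  have low: "1 / 16 \<le> (\<Sum>n. ?k T \<delta> y n)"
    if d: "0 < \<delta>" and y: "exp (- y) \<le> 1 / (4 * T)" and dy: "exp (- y * \<delta>) \<ge> 1 / 2" for \<delta> y
  proof -
    let ?S = "{n::nat. 0 < n \<and> y - 1 / T \<le> ln (real n) \<and> ln (real n) \<le> y}"
    have "finite ?S" by (rule finite_subset[OF _ finite_log_window[of y "1 / T"]]) auto
    have "1 / (2 * T) - 1 / (4 * T) \<le> (\<Sum>n\<in>?S. 1 / real n)"
      using harmonic_short_interval[of "1 / T" y] y T by simp
    then have "1 / (4 * T) \<le> (\<Sum>n\<in>?S. 1 / real n)" by (simp add: field_simps)
    then have "T / 4 * (1 / (4 * T)) \<le> T / 4 * (\<Sum>n\<in>?S. 1 / real n)" using T by (intro mult_left_mono) auto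
    moreover have "T / 4 * (1 / (4 * T)) = 1 / 16" using T by simp
    ultimately have "1 / 16 \<le> T / 4 * (\<Sum>n\<in>?S. 1 / real n)" by simp
    also have "\<dots> = (\<Sum>n\<in>?S. 1 / real n * (1 / 2) * (T / 2))" by (simp add: sum_distrib_left mult_ac)
    also have "\<dots> \<le> (\<Sum>n\<in>?S. ?k T \<delta> y n)"
    proof (rule sum_mono)
      fix n assume n: "n \<in> ?S"
      have "1 / 2 \<le> exp (- y * \<delta>)" by (rule dy)
      also have "\<dots> \<le> exp (- ln (real n) * \<delta>)" using n d by simp
      also have "\<dots> = real n powr - \<delta>" using n by (simp add: powr_def mult.commute)
      finally have "1 / real n * (1 / 2) \<le> 1 / real n * real n powr - \<delta>" by (intro mult_left_mono) auto
      also have "\<dots> = real n powr - (1 + \<delta>)" using n by (simp add: powr_diff powr_minus field_simps powr_add)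
      finally have 1: "1 / real n * (1 / 2) \<le> real n powr - (1 + \<delta>)" .
      have "T / 2 \<le> fejer T (y - ln (real n))" using n T by (intro fejer_ge) auto
      with 1 show "1 / real n * (1 / 2) * (T / 2) \<le> ?k T \<delta> y n" using T by (intro mult_mono) auto
    qed
    also have "\<dots> \<le> (\<Sum>n. ?k T \<delta> y n)"
      using O[of \<delta> T] knn[of T] d T \<open>finite ?S\<close> by (intro sum_le_suminf) auto
    finally show ?thesis .
  qed
  let ?W = "\<lambda>y. {n::nat. 0 < n \<and> \<bar>y - ln (real n)\<bar> \<le> \<eta>}"
  \<comment> \<open>Inside the window the kernel is at most 2 T; outside, \<open>fejer_tail\<close>
    replaces it by kernels of height 1 centred at y and y - pi, whose sums are at most M1.\<close>
  have up: "(\<Sum>n. a n * ?k T \<delta> y n) \<le> 2 * T * (\<Sum>n\<in>?W y. a n / real n) + 1 / 64" if d: "0 < \<delta>" "\<delta> \<le> 1" for \<delta> y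
  proof -
    let ?g = "\<lambda>n. if n \<in> ?W y then 2 * T * (a n / real n) else 0"
    let ?h = "\<lambda>n. C / T * (a n * ?k 1 \<delta> y n + a n * ?k 1 \<delta> (y - pi) n)"
    have sh: "?h sums (C / T * ((\<Sum>n. a n * ?k 1 \<delta> y n) + (\<Sum>n. a n * ?k 1 \<delta> (y - pi) n)))"
      using d by (intro sums_mult sums_add summable_sums A) auto
    have sg: "?g sums (\<Sum>n\<in>?W y. 2 * T * (a n / real n))"
      by (rule sums_If_finite_set[OF finite_log_window])
    have le: "a n * ?k T \<delta> y n \<le> ?g n + ?h n" for n
    proof -
      have h0: "?h n \<ge> 0" using C T a(1)[of n] by (intro mult_nonneg_nonneg add_nonneg_nonneg fejer_nonneg) auto
      consider "n = 0" | "n \<in> ?W y" | "n > 0" "\<bar>y - ln (real n)\<bar> > \<eta>" by fastforce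
      then show ?thesis
      proof cases
        case 1
        then show ?thesis by simp
      next
        case 2
        then have "real n powr - (1 + \<delta>) \<le> real n powr - 1" using d by (intro powr_mono) auto
        then have "?k T \<delta> y n \<le> real n powr - 1 * (2 * T)"
          using fejer_le[of T] fejer_nonneg[of T] T by (intro mult_mono) auto
        then have "a n * ?k T \<delta> y n \<le> a n * (real n powr - 1 * (2 * T))" using a(1) by (rule mult_left_mono)
        also have "\<dots> = ?g n" using 2 by (simp add: powr_minus field_simps)
        finally show ?thesis using h0 by simp
      next
        case 3
        have "fejer T (y - ln (real n)) \<le> C / T * (fejer 1 (y - ln (real n)) + fejer 1 (y - ln (real n) - pi))"
          unfolding C_def using T \<eta> 3 by (intro fejer_tail) auto
        then have "a n * real n powr - (1 + \<delta>) * fejer T (y - ln (real n)) \<le>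
            a n * real n powr - (1 + \<delta>) * (C / T * (fejer 1 (y - ln (real n)) + fejer 1 (y - ln (real n) - pi)))"
          using a(1) by (intro mult_left_mono) auto
        also have "\<dots> = ?h n" by (simp add: algebra_simps)
        finally show ?thesis using 3 by (simp add: mult.assoc)
      qed
    qed
    have "(\<Sum>n. a n * ?k T \<delta> y n) \<le> (\<Sum>n\<in>?W y. 2 * T * (a n / real n)) +
        C / T * ((\<Sum>n. a n * ?k 1 \<delta> y n) + (\<Sum>n. a n * ?k 1 \<delta> (y - pi) n))"
      by (rule sums_le[OF le summable_sums[OF A] sums_add[OF sg sh]]) (use d T in auto)
    also have "\<dots> \<le> (\<Sum>n\<in>?W y. 2 * T * (a n / real n)) + C / T * (M1 + M1)"
      using M1[OF d] C T by (intro add_left_mono mult_left_mono add_mono) auto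
    also have "\<dots> = 2 * T * (\<Sum>n\<in>?W y. a n / real n) + 1 / 64"
      using tail by (simp only: sum_distrib_left mult_2)
    finally show ?thesis .
  qed
  \<comment> \<open>Order of choices: T is fixed, then y is taken large enough for decay at delta =
    0, and finally delta is taken small in terms of y.\<close>
  have T0: "T > 0" using T by simp
  have "\<forall>\<^sub>F y in at_top. \<bar>fejer_transform H T 0 y\<bar> < 1 / 128"
    using tendstoD[OF fejer_transform_tendsto_0[OF U T0], of "1 / 128"] by simp
  moreover have "\<forall>\<^sub>F y in at_top. exp (- y) \<le> 1 / (4 * T)"
  proof -
    have "((\<lambda>y::real. exp (- y)) \<longlongrightarrow> 0) at_top" by real_asymp
    from order_tendstoD(2)[OF this, of "1 / (4 * T)"] show ?thesis
      using T by (auto elim: eventually_mono)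
  qed
  ultimately have "\<forall>\<^sub>F y in at_top. 1 / (64 * T) \<le> (\<Sum>n\<in>?W y. a n / real n)"
  proof eventually_elim
    case (elim y)
    have "\<forall>\<^sub>F \<delta> in at_right 0. \<bar>fejer_transform H T \<delta> y - fejer_transform H T 0 y\<bar> < 1 / 128"
      using tendstoD[OF fejer_transform_continuous(1)[OF U(2) cH T0, of y], of "1 / 128"] by (simp add: dist_real_def)
    moreover have "\<forall>\<^sub>F \<delta> in at_right 0. 1 / 2 < exp (- y * \<delta>)"
    proof -
      have "((\<lambda>\<delta>. exp (- y * \<delta>)) \<longlongrightarrow> exp (- y * 0)) (at_right 0)" by (intro tendsto_intros)
      from order_tendstoD(1)[OF this, of "1 / 2"] show ?thesis by simp
    qed
    moreover have "\<forall>\<^sub>F \<delta>::real in at_right 0. 0 < \<delta> \<and> \<delta> < 1" by (auto simp: eventually_at_right_field intro: exI[of _ 1])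
    ultimately have "\<forall>\<^sub>F \<delta> in at_right 0. \<bar>fejer_transform H T \<delta> y - fejer_transform H T 0 y\<bar> < 1 / 128 \<and> 1 / 2 < exp (- y * \<delta>) \<and> 0 < \<delta> \<and> \<delta> < 1"
      by eventually_elim auto
    then obtain \<delta> where d: "\<bar>fejer_transform H T \<delta> y - fejer_transform H T 0 y\<bar> < 1 / 128" "1 / 2 < exp (- y * \<delta>)" "0 < \<delta>" "\<delta> < 1"
      using eventually_happens'[OF trivial_limit_at_right_real] by blast
    \<comment> \<open>Balance: 1/16 from the harmonic sum, minus 1/64 for the transform and 1/64 for
      the tail, leaves 1/32.\<close>
    have "fejer_transform H T \<delta> y \<ge> - (1 / 64)" using d(1) elim(1) by linarith
    moreover have "1 / 16 \<le> (\<Sum>n. ?k T \<delta> y n)" by (rule low) (use d elim in auto)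
    moreover have "(\<Sum>n. a n * ?k T \<delta> y n) \<le> 2 * T * (\<Sum>n\<in>?W y. a n / real n) + 1 / 64" by (rule up) (use d in auto)
    ultimately have "1 / 32 \<le> 2 * T * (\<Sum>n\<in>?W y. a n / real n)" using AO[OF d(3) T0, of y] by linarith
    then show ?case using T by (simp add: field_simps)
  qed
  then show ?thesis using T by (intro exI[of _ "1 / (64 * T)"]) auto
qed


section \<open>Legendre symbols as characters\<close>

definition legendre_char :: "nat \<Rightarrow> nat \<Rightarrow> real" where
  "legendre_char r n = of_int (Legendre (int n) (int r))"

lemma Legendre_values: "Legendre a p \<in> {-1, 0, 1}" by (simp add: Legendre_def)

lemma Legendre_cong: "[a = b] (mod p) \<Longrightarrow> Legendre a p = Legendre b p"
  by (simp add: Legendre_def QuadRes_def cong_def)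

text \<open>Euler's criterion gives the congruence modulo p; both sides lie in {-1, 0, 1}, so they
  differ by at most 2 < p.\<close>

lemma Legendre_mult:
  assumes p: "prime p" "2 < p"
  shows "Legendre (a * b) p = Legendre a p * Legendre b p"
proof -
  have "[Legendre (a * b) p = (a * b) ^ ((nat p - 1) div 2)] (mod p)" for a b :: int
    using euler_criterion[of "nat p" "a * b"] p by simp
  moreover have "[Legendre a p * Legendre b p = a ^ ((nat p - 1) div 2) * b ^ ((nat p - 1) div 2)] (mod p)"
    using euler_criterion[of "nat p" a] euler_criterion[of "nat p" b] p by (intro cong_mult) simp_all
  ultimately have "[Legendre (a * b) p = Legendre a p * Legendre b p] (mod p)"
    unfolding cong_def power_mult_distrib by simp
  then have "p dvd Legendre (a * b) p - Legendre a p * Legendre b p" by (simp add: cong_iff_dvd_diff)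
  moreover have "\<bar>Legendre (a * b) p - Legendre a p * Legendre b p\<bar> \<le> 2"
    using Legendre_values[of "a * b" p] Legendre_values[of a p] Legendre_values[of b p] by auto
  ultimately show ?thesis using p(2) zdvd_imp_le[of p "\<bar>Legendre (a * b) p - Legendre a p * Legendre b p\<bar>"] by auto
qed

lemma legendre_char_sign_character:
  assumes "prime r" "2 < r"
  shows "sign_character (legendre_char r)"
proof -
  have "prime (int r)" "2 < int r" using assms by auto
  from Legendre_mult[OF this] have "legendre_char r (m * n) = legendre_char r m * legendre_char r n" for m n by (simp add: legendre_char_def)
  moreover have "legendre_char r 1 = 1"
  proof -
    have "\<not> [1 = 0] (mod int r)" using assms by (simp add: cong_iff_dvd_diff)
    moreover have "QuadRes (int r) 1" unfolding QuadRes_def by (rule exI[of _ 1]) simp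
    ultimately show ?thesis by (simp add: legendre_char_def Legendre_def)
  qed
  moreover have "legendre_char r n \<in> {-1, 0, 1}" for n using Legendre_values[of "int n" "int r"] by (auto simp: legendre_char_def)
  ultimately show ?thesis unfolding sign_character_def by blast
qed

lemma legendre_char_cong: "[m = n] (mod r) \<Longrightarrow> legendre_char r m = legendre_char r n"
  unfolding legendre_char_def using Legendre_cong[of "int m" "int n" "int r"] by (simp add: cong_int_iff)

lemma legendre_char_0 [simp]: "legendre_char r 0 = 0"
  by (simp add: legendre_char_def Legendre_def)

text \<open>Squaring on the nonzero residues identifies 1 and r - 1, so it is not injective, hence
  on a finite set not surjective; a missed residue is a nonresidue.\<close>

lemma ex_legendre_char_minus_1:
  assumes r: "prime r" "2 < r"
  obtains g where "legendre_char r g = -1"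
proof -
  let ?A = "{1..<r}" and ?f = "\<lambda>x. x\<^sup>2 mod r"
  have sub: "?f ` ?A \<subseteq> ?A"
  proof
    fix y assume "y \<in> ?f ` ?A"
    then obtain x where x: "x \<in> ?A" "y = x\<^sup>2 mod r" by blast
    have "\<not> r dvd x" using x(1) by (auto dest: dvd_imp_le)
    then have "\<not> r dvd x\<^sup>2" using r(1) prime_dvd_power by blast
    then have "y \<noteq> 0" using x(2) by (auto simp: dvd_eq_mod_eq_0)
    then show "y \<in> ?A" using x(2) r by simp
  qed
  have eq: "?f (r - 1) = ?f 1"
  proof -
    have "(r - 1)\<^sup>2 = 1 + r * (r - 2)"
      using r by (cases r; cases "r - 1") (auto simp: power2_eq_square algebra_simps)
    then show ?thesis by (simp only: mod_mult_self2 power_one)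
  qed
  have "\<not> inj_on ?f ?A"
  proof
    assume "inj_on ?f ?A"
    then have "r - 1 = 1" by (rule inj_onD[of ?f ?A "r - 1" 1]) (use r in \<open>auto simp: eq[simplified]\<close>)
    then show False using r by arith
  qed
  then have "?f ` ?A \<noteq> ?A" using eq_card_imp_inj_on[of ?A ?f] by auto
  then obtain g where g: "g \<in> ?A" "g \<notin> ?f ` ?A" using sub by blast
  have "\<not> [int g = 0] (mod int r)" using g(1) by (auto simp: cong_0_iff dest: dvd_imp_le)
  moreover have "\<not> QuadRes (int r) (int g)"
  proof
    assume "QuadRes (int r) (int g)"
    then obtain z where z: "[z\<^sup>2 = int g] (mod int r)" unfolding QuadRes_def by blast
    define x where "x = nat (z mod int r)"
    have x: "int x = z mod int r" "x < r" using r by (auto simp: x_def nat_less_iff)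
    have "[(int x)\<^sup>2 = int g] (mod int r)" using z unfolding x(1) by (simp add: cong_def power_mod)
    then have "[x\<^sup>2 = g] (mod r)" by (simp flip: cong_int_iff)
    then have e: "x\<^sup>2 mod r = g" using g(1) by (simp add: cong_def)
    then have "x \<noteq> 0" using g(1) by (intro notI) simp
    then show False using e g(2) x(2) by (auto simp: image_iff)
  qed
  ultimately have "legendre_char r g = -1" by (simp add: legendre_char_def Legendre_def)
  then show ?thesis by (rule that)
qed

text \<open>Whole periods cancel, leaving fewer than m terms of size at most 1.\<close>

lemma periodic_sum_bound:
  fixes \<psi> :: "nat \<Rightarrow> real"
  assumes m: "m > 0" and per: "\<And>n. \<psi> (n + m) = \<psi> n" and z: "(\<Sum>n<m. \<psi> n) = 0" and le: "\<And>n. \<bar>\<psi> n\<bar> \<le> 1"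
  shows "\<bar>\<Sum>j\<le>N. \<psi> j\<bar> \<le> real m"
proof -
  have "\<bar>\<Sum>j<N. \<psi> j\<bar> \<le> real m" for N
  proof (induction N rule: less_induct)
    case (less N)
    show ?case
    proof (cases "N < m")
      case True
      have "\<bar>\<Sum>j<N. \<psi> j\<bar> \<le> (\<Sum>j<N. 1)" by (rule order_trans[OF sum_abs sum_mono]) (rule le)
      then show ?thesis using True by simp
    next
      case False
      then obtain M where M: "N = m + M" using le_Suc_ex not_less by blast
      have "(\<Sum>j<m + M. \<psi> j) = (\<Sum>j<m. \<psi> j) + (\<Sum>j<M. \<psi> (m + j))"
        by (induction M) auto
      then have "(\<Sum>j<N. \<psi> j) = (\<Sum>j<M. \<psi> j)" unfolding M using z per by (simp add: add.commute)
      then show ?thesis using less.IH[of M] m M by simp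
    qed
  qed
  from this[of "Suc N"] show ?thesis by (simp add: lessThan_Suc_atMost)
qed

text \<open>Multiplication by c permutes the residues and flips the sign of every term.\<close>

lemma sum_period_zero:
  fixes \<psi> :: "nat \<Rightarrow> real"
  assumes m: "m > 0" and c: "coprime c m" "\<psi> c = -1"
    and mult: "\<And>a b. \<psi> (a * b) = \<psi> a * \<psi> b" and per: "\<And>a b. [a = b] (mod m) \<Longrightarrow> \<psi> a = \<psi> b"
  shows "(\<Sum>n<m. \<psi> n) = 0"
proof -
  have inj: "inj_on (\<lambda>n. c * n mod m) {..<m}"
  proof (rule inj_onI)
    fix x y assume "x \<in> {..<m}" "y \<in> {..<m}" "c * x mod m = c * y mod m"
    then show "x = y" using cong_mult_lcancel_nat[OF c(1), of x y] by (simp add: cong_def)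
  qed
  have "(\<lambda>n. c * n mod m) ` {..<m} = {..<m}"
    by (rule endo_inj_surj[OF _ _ inj]) (use m in auto)
  then have "(\<Sum>n<m. \<psi> n) = (\<Sum>n<m. \<psi> (c * n mod m))" using sum.reindex[OF inj, of \<psi>] by simp
  also have "\<dots> = (\<Sum>n<m. - \<psi> n)"
  proof (rule sum.cong[OF refl])
    fix n
    have "\<psi> (c * n mod m) = \<psi> (c * n)" by (rule per) (simp add: cong_def)
    then show "\<psi> (c * n mod m) = - \<psi> n" by (simp add: mult c(2))
  qed
  also have "\<dots> = - (\<Sum>n<m. \<psi> n)" by (rule sum_negf)
  finally show ?thesis by linarith
qed

definition legendre_prod :: "nat set \<Rightarrow> nat \<Rightarrow> real" where
  "legendre_prod S n = (\<Prod>r\<in>S. legendre_char r n)"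

lemma legendre_prod_sign_character:
  assumes S: "finite S" "\<And>r. r \<in> S \<Longrightarrow> prime r \<and> 2 < r"
  shows "sign_character (legendre_prod S)"
proof -
  have cs: "sign_character (legendre_char r)" if "r \<in> S" for r using legendre_char_sign_character S(2)[OF that] by blast
  have "legendre_prod S n \<in> {-1, 0, 1}" for n
    using S(1) cs unfolding legendre_prod_def
  proof (induction S rule: finite_induct)
    case (insert r S)
    have "legendre_char r n \<in> {-1, 0, 1}" using insert.prems[of r] by (simp add: sign_character_def)
    moreover have "(\<Prod>r\<in>S. legendre_char r n) \<in> {-1, 0, 1}" using insert by blast
    ultimately show ?case using insert.hyps by auto
  qed simp
  moreover have "legendre_prod S 1 = 1" unfolding legendre_prod_def by (rule prod.neutral) (use cs in \<open>auto simp: sign_character_def\<close>)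
  moreover have "legendre_prod S (m * n) = legendre_prod S m * legendre_prod S n" for m n
    unfolding legendre_prod_def prod.distrib[symmetric] by (rule prod.cong) (use cs in \<open>auto simp: sign_character_def\<close>)
  ultimately show ?thesis unfolding sign_character_def by blast
qed

text \<open>The product is a nontrivial character: by the Chinese remainder theorem some c is a
  nonresidue modulo one r and congruent to 1 modulo the others, hence has value -1.\<close>

lemma legendre_prod_bounded:
  assumes S: "finite S" "\<And>r. r \<in> S \<Longrightarrow> prime r \<and> 2 < r" and ne: "S \<noteq> {}"
  shows "\<bar>\<Sum>j\<le>N. legendre_prod S j\<bar> \<le> real (\<Prod>S)"
proof -
  have cs: "sign_character (legendre_prod S)" by (rule legendre_prod_sign_character[OF S])
  have m: "\<Prod>S > 0" using S(2) by (intro prod_pos) force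
  have per: "legendre_prod S a = legendre_prod S b" if "[a = b] (mod \<Prod>S)" for a b
    unfolding legendre_prod_def
  proof (rule prod.cong[OF refl])
    fix r assume "r \<in> S"
    then have "r dvd \<Prod>S" using S(1) by (rule dvd_prodI[of _ _ "\<lambda>x. x", rotated])
    with that have "[a = b] (mod r)" by (rule cong_dvd_modulus_nat)
    then show "legendre_char r a = legendre_char r b" by (rule legendre_char_cong)
  qed
  obtain r where r: "r \<in> S" using ne by blast
  obtain g where g: "legendre_char r g = -1" using ex_legendre_char_minus_1 S(2)[OF r] by blast
  have cop: "coprime r (\<Prod>(S - {r}))"
    by (rule prod_coprime_right) (use S(2) r in \<open>auto intro!: primes_coprime\<close>)
  obtain c where c: "[c = g] (mod r)" "[c = 1] (mod \<Prod>(S - {r}))" using binary_chinese_remainder_nat[OF cop] by blast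
  have PS: "\<Prod>S = r * \<Prod>(S - {r})" using prod.remove[OF S(1) r, of "\<lambda>x. x"] by simp
  have cr: "legendre_char r c = -1" using legendre_char_cong[OF c(1)] g by simp
  have c1: "legendre_char s c = 1" if "s \<in> S - {r}" for s
  proof -
    have "s dvd \<Prod>(S - {r})" using S(1) that by (intro dvd_prodI[of _ _ "\<lambda>x. x"]) auto
    then have "[c = 1] (mod s)" using c(2) by (rule cong_dvd_modulus_nat[rotated])
    then have "legendre_char s c = legendre_char s 1" by (rule legendre_char_cong)
    then show ?thesis using legendre_char_sign_character S(2)[of s] that by (auto simp: sign_character_def)
  qed
  have pc: "legendre_prod S c = -1" unfolding legendre_prod_def prod.remove[OF S(1) r] using cr c1 by simp
  have "coprime c (\<Prod>S)"
  proof -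
    have "\<not> r dvd c"
    proof
      assume "r dvd c"
      then have "[c = 0] (mod r)" by (simp add: cong_0_iff)
      from legendre_char_cong[OF this] cr show False by simp
    qed
    then have "coprime c r" using S(2)[OF r] prime_imp_coprime coprime_commute by blast
    moreover have "coprime c (\<Prod>(S - {r}))" using cong_imp_coprime[OF cong_sym[OF c(2)]] by simp
    ultimately show ?thesis unfolding PS by simp
  qed
  then have zero: "(\<Sum>n<\<Prod>S. legendre_prod S n) = 0"
    by (rule sum_period_zero[of "\<Prod>S" c "legendre_prod S", OF m _ pc]) (use cs per in \<open>auto simp: sign_character_def\<close>)
  have shift: "legendre_prod S (n + \<Prod>S) = legendre_prod S n" for n by (rule per) (simp add: cong_def)
  show ?thesis
    by (rule periodic_sum_bound[of "\<Prod>S" "legendre_prod S", OF m shift zero sign_character_abs_le[OF cs]])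
qed

lemma legendre_prod_0: "finite S \<Longrightarrow> S \<noteq> {} \<Longrightarrow> legendre_prod S 0 = 0"
  unfolding legendre_prod_def by auto

lemma abs_conv_beyond_1_mono:
  assumes "abs_conv_beyond_1 b" "\<And>n. \<bar>a n\<bar> \<le> C * \<bar>b n\<bar>"
  shows "abs_conv_beyond_1 a"
  unfolding abs_conv_beyond_1_def
proof (intro allI impI)
  fix \<sigma> :: real assume "1 < \<sigma>"
  then have "summable (\<lambda>n. C * (\<bar>b n\<bar> * real n powr - \<sigma>))" using assms(1) by (intro summable_mult) (auto simp: abs_conv_beyond_1_def)
  then show "summable (\<lambda>n. \<bar>a n\<bar> * real n powr - \<sigma>)"
    by (rule summable_comparison_test'[where N = 0])
      (use assms(2) in \<open>auto simp: mult.assoc[symmetric] intro!: mult_right_mono\<close>)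
qed

definition nonresidue_weight :: "nat set \<Rightarrow> nat \<Rightarrow> real" where
  "nonresidue_weight P n = (\<Prod>r\<in>P. 1 - legendre_char r n)"

lemma nonresidue_weight_bounds:
  assumes P: "finite P" "\<And>r. r \<in> P \<Longrightarrow> prime r \<and> 2 < r"
  shows "0 \<le> nonresidue_weight P n" "nonresidue_weight P n \<le> 2 ^ card P"
proof -
  have "legendre_char r n \<in> {-1, 0, 1}" if "r \<in> P" for r using legendre_char_sign_character P(2)[OF that] by (auto simp: sign_character_def)
  then have b: "0 \<le> 1 - legendre_char r n \<and> 1 - legendre_char r n \<le> 2" if "r \<in> P" for r using that by fastforce
  show "0 \<le> nonresidue_weight P n" unfolding nonresidue_weight_def using b by (intro prod_nonneg) blast
  have "nonresidue_weight P n \<le> (\<Prod>r\<in>P. 2)" unfolding nonresidue_weight_def using b by (intro prod_mono) blast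
  then show "nonresidue_weight P n \<le> 2 ^ card P" by simp
qed

lemma nonresidue_weight_abs_conv_beyond_1:
  assumes P: "finite P" "\<And>r. r \<in> P \<Longrightarrow> prime r \<and> 2 < r"
  shows "abs_conv_beyond_1 (\<lambda>n. mangoldt n * nonresidue_weight P n)"
proof (rule abs_conv_beyond_1_mono[of "\<lambda>n. mangoldt n * 1"])
  show "abs_conv_beyond_1 (\<lambda>n. mangoldt n * 1)" by (rule sign_character_abs_conv_beyond_1(3)) (simp add: sign_character_def)
  show "\<bar>mangoldt n * nonresidue_weight P n\<bar> \<le> 2 ^ card P * \<bar>mangoldt n * 1\<bar>" for n
    using nonresidue_weight_bounds[OF P, of n] mangoldt_nonneg[of n] by (simp add: abs_mult mult.commute mult_right_mono mult_left_mono)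
qed

text \<open>Only the empty subset of P contributes a pole at 1. Its residue is 1, the same as that
  of zeta, so the comparison series is exactly the one with constant coefficients 1.\<close>

lemma nonresidue_weight_continues_past_1:
  assumes P: "finite P" "\<And>r. r \<in> P \<Longrightarrow> prime r \<and> 2 < r"
  shows "continues_past_1 (\<lambda>s. dirichlet_series (\<lambda>n. mangoldt n * nonresidue_weight P n) s - dirichlet_series (\<lambda>n. 1) s)"
proof -
  define \<kappa> where "\<kappa> = (\<lambda>X::nat set. \<Prod>r\<in>X. (- 1 :: real))"
  let ?Q = "Pow P - {{}}"
  have X: "finite X" "\<And>r. r \<in> X \<Longrightarrow> prime r \<and> 2 < r" if "X \<in> Pow P" for X
    using that P finite_subset by auto
  have expand: "nonresidue_weight P n = (\<Sum>X\<in>Pow P. \<kappa> X * legendre_prod X n)" for n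
  proof -
    have "nonresidue_weight P n = (\<Prod>r\<in>P. (- 1) * legendre_char r n + 1)" by (simp add: nonresidue_weight_def)
    also have "\<dots> = (\<Sum>X\<in>Pow P. (\<Prod>r\<in>X. (- 1) * legendre_char r n) * (\<Prod>r\<in>P - X. 1))" by (rule prod_add[OF P(1)])
    finally show ?thesis unfolding \<kappa>_def legendre_prod_def by (simp only: prod.distrib prod.neutral_const mult_1_right)
  qed
  have eq: "dirichlet_series (\<lambda>n. mangoldt n * nonresidue_weight P n) s = (\<Sum>X\<in>Pow P. of_real (\<kappa> X) * mangoldt_series (legendre_prod X) s)" if s: "Re s > 1" for s
  proof -
    let ?t = "\<lambda>X n. of_real (mangoldt n * legendre_prod X n) * of_nat n powr - s :: complex"
    have sm: "summable (?t X)" if "X \<in> Pow P" for X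
      by (rule abs_conv_beyond_1_summable[OF sign_character_abs_conv_beyond_1(3)[OF legendre_prod_sign_character[OF X[OF that]]] s]) auto
    have "dirichlet_series (\<lambda>n. mangoldt n * nonresidue_weight P n) s = (\<Sum>n. \<Sum>X\<in>Pow P. of_real (\<kappa> X) * ?t X n)"
      unfolding dirichlet_series_def expand by (simp add: sum_distrib_left sum_distrib_right mult_ac)
    also have "\<dots> = (\<Sum>X\<in>Pow P. \<Sum>n. of_real (\<kappa> X) * ?t X n)"
      by (rule suminf_sum) (intro summable_mult sm)
    also have "\<dots> = (\<Sum>X\<in>Pow P. of_real (\<kappa> X) * mangoldt_series (legendre_prod X) s)"
      unfolding dirichlet_series_def by (intro sum.cong refl suminf_mult sm)
    finally show ?thesis .
  qed
  obtain Z where Z: "dirichlet_continuation (\<lambda>n. 1) 1 Z" "Z 1 = 1" "\<And>s. Re s \<ge> 1 \<Longrightarrow> Z s \<noteq> 0" by (rule zeta_continuation_nonzero) blast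
  have z: "continues_past_1 (\<lambda>s. mangoldt_series (\<lambda>n. 1) s - of_nat 1 / (s - 1))" by (rule dirichlet_continuation_continues_past_1[OF Z(1,3)])
  have e: "continues_past_1 (\<lambda>s. \<Sum>X\<in>?Q. of_real (\<kappa> X) * mangoldt_series (legendre_prod X) s)"
  proof (rule continues_past_1_sum)
    fix X assume "X \<in> ?Q"
    then have XP: "X \<in> Pow P" "X \<noteq> {}" by auto
    show "continues_past_1 (\<lambda>s. of_real (\<kappa> X) * mangoldt_series (legendre_prod X) s)"
      by (rule continues_past_1_cmult, rule sign_character_continues_past_1[OF legendre_prod_sign_character[OF X[OF XP(1)]] legendre_prod_0[OF X(1)[OF XP(1)] XP(2)]
            legendre_prod_bounded[OF X[OF XP(1)] XP(2)]]) auto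
  qed (use P in auto)
  show ?thesis
  proof (rule continues_past_1_cong[OF continues_past_1_add[OF e continues_past_1_add[OF z continues_past_1_cmult[OF zeta_continues_past_1, of "- 1"]]]])
    fix s :: complex assume s: "Re s > 1"
    have "(\<Sum>X\<in>Pow P. of_real (\<kappa> X) * mangoldt_series (legendre_prod X) s) =
        of_real (\<kappa> {}) * mangoldt_series (legendre_prod {}) s + (\<Sum>X\<in>?Q. of_real (\<kappa> X) * mangoldt_series (legendre_prod X) s)"
      by (rule sum.remove) (use P in auto)
    moreover have "legendre_prod {} = (\<lambda>n. 1)" "\<kappa> {} = 1" by (auto simp: legendre_prod_def \<kappa>_def)
    ultimately show "(\<Sum>X\<in>?Q. of_real (\<kappa> X) * mangoldt_series (legendre_prod X) s) +
        (mangoldt_series (\<lambda>n. 1) s - of_nat 1 / (s - 1) + - 1 * (dirichlet_series (\<lambda>n. 1) s - 1 / (s - 1))) =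
        dirichlet_series (\<lambda>n. mangoldt n * nonresidue_weight P n) s - dirichlet_series (\<lambda>n. 1) s"
      unfolding eq[OF s] by simp
  qed
qed


section \<open>Primes in short intervals\<close>

text \<open>The exponent is at least 2, so the base is at most sqrt X, and the exponent is at most
  log 2 X; the added ones account for the index 0.\<close>

lemma card_proper_prime_powers:
  assumes X: "X \<ge> 1"
  shows "finite {n::nat. primepow n \<and> \<not> prime n \<and> real n \<le> X}"
    and "real (card {n::nat. primepow n \<and> \<not> prime n \<and> real n \<le> X}) \<le> (sqrt X + 1) * (log 2 X + 1)"
proof -
  let ?A = "{n::nat. primepow n \<and> \<not> prime n \<and> real n \<le> X}"
  let ?B = "{..nat \<lfloor>sqrt X\<rfloor>} \<times> {..nat \<lfloor>log 2 X\<rfloor>}"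
  have sub: "?A \<subseteq> (\<lambda>(p, k). p ^ k) ` ?B"
  proof
    fix n assume "n \<in> ?A"
    then have n: "primepow n" "\<not> prime n" "real n \<le> X" by auto
    then obtain p k where pk: "prime p" "k > 0" "n = p ^ k" unfolding primepow_def by blast
    have "k \<noteq> 1" using n(2) pk by auto
    then have k2: "k \<ge> 2" using pk(2) by linarith
    have p2: "p \<ge> 2" using pk(1) by (rule prime_ge_2_nat)
    have pk': "real p ^ k \<le> X" using n(3) pk(3) by simp
    have "real p ^ 2 \<le> real p ^ k" using k2 p2 by (intro power_increasing) auto
    then have "real p \<le> sqrt X" using pk' by (intro real_le_rsqrt) linarith
    then have 1: "p \<le> nat \<lfloor>sqrt X\<rfloor>" by (simp add: le_nat_floor)
    have "2 ^ k \<le> real p ^ k" using p2 by (intro power_mono) auto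
    then have "2 powr real k \<le> X" using pk' by (simp add: powr_realpow)
    then have "real k \<le> log 2 X" using X by (simp add: le_log_iff)
    then have 2: "k \<le> nat \<lfloor>log 2 X\<rfloor>" by (simp add: le_nat_floor)
    show "n \<in> (\<lambda>(p, k). p ^ k) ` ?B" using 1 2 pk(3) by auto
  qed
  then show "finite ?A" by (rule finite_subset) auto
  have "card ?A \<le> card ((\<lambda>(p, k). p ^ k) ` ?B)" using sub by (intro card_mono) auto
  also have "\<dots> \<le> card ?B" by (rule card_image_le) auto
  finally have "real (card ?A) \<le> real (card ?B)" by (simp only: of_nat_le_iff)
  also have "\<dots> = (real (nat \<lfloor>sqrt X\<rfloor>) + 1) * (real (nat \<lfloor>log 2 X\<rfloor>) + 1)"
    by (simp add: algebra_simps)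
  also have "\<dots> \<le> (sqrt X + 1) * (log 2 X + 1)"
    using X by (intro mult_mono add_mono) auto
  finally show "real (card ?A) \<le> (sqrt X + 1) * (log 2 X + 1)" .
qed

lemma ex_prime_avoiding:
  assumes P: "finite P" "\<And>r. r \<in> P \<Longrightarrow> prime r \<and> 2 < r"
  shows "\<forall>\<^sub>F x in at_top. \<exists>p. prime p \<and> x / 2 < real p \<and> real p \<le> x \<and> (\<forall>r\<in>P. \<not> [p = 1] (mod r))"
proof -
  \<comment> \<open>Centred at ln x - 3/10, this window is [ln x - 6/10, ln x]; it stays above ln (x
    / 2) because ln 2 >= 2/3 > 6/10.\<close>
  let ?W = "\<lambda>y. {n::nat. 0 < n \<and> \<bar>y - ln (real n)\<bar> \<le> 3 / 10}"
  let ?a = "\<lambda>n. mangoldt n * nonresidue_weight P n"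
  have a0: "?a n \<ge> 0" for n using nonresidue_weight_bounds(1)[OF P] mangoldt_nonneg by (intro mult_nonneg_nonneg) auto
  obtain c where c: "c > 0" "\<forall>\<^sub>F y in at_top. c \<le> (\<Sum>n\<in>?W y. ?a n / real n)"
    using short_interval_mass[OF a0 nonresidue_weight_abs_conv_beyond_1[OF P] nonresidue_weight_continues_past_1[OF P], of "3 / 10"] by auto
  have fl: "filterlim (\<lambda>x::real. ln x - 3 / 10) at_top at_top" by real_asymp
  have c': "\<forall>\<^sub>F x in at_top. c \<le> (\<Sum>n\<in>?W (ln x - 3 / 10). ?a n / real n)"
    using c(2) fl by (rule eventually_compose_filterlim)
  \<comment> \<open>The expression bounds what proper prime powers can contribute: their number,
    times the largest weight 2 ^ card P, times ln x, times 1 / n < 2 / x.\<close>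
  have "((\<lambda>x::real. 2 ^ card P * (2 * ((sqrt x + 1) * (log 2 x + 1) * ln x / x))) \<longlongrightarrow> 2 ^ card P * (2 * 0)) at_top"
    by (intro tendsto_mult_left) real_asymp
  then have "\<forall>\<^sub>F x::real in at_top. 2 ^ card P * (2 * ((sqrt x + 1) * (log 2 x + 1) * ln x / x)) < c"
    using c(1) by (intro order_tendstoD) auto
  with c' eventually_gt_at_top[of "1 :: real"] show ?thesis
  proof eventually_elim
    case (elim x)
    let ?V = "?W (ln x - 3 / 10)"
    have V: "real n \<le> x" "x / 2 < real n" "0 < n" if "n \<in> ?V" for n
    proof -
      have "\<bar>ln x - 3 / 10 - ln (real n)\<bar> \<le> 3 / 10" using that by blast
      then have "ln (real n) \<le> ln x" "ln x - 6 / 10 \<le> ln (real n)" unfolding abs_le_iff by linarith+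
      then have n: "0 < n" "ln (real n) \<le> ln x" "ln x - 6 / 10 \<le> ln (real n)" using that by auto
      then show "real n \<le> x" "0 < n" using elim by auto
      have "ln (x / 2) = ln x - ln 2" using elim by (simp add: ln_div)
      then have "ln (x / 2) < ln (real n)" using n(3) ln2_ge_two_thirds by linarith
      then show "x / 2 < real n" using elim n(1) by simp
    qed
    have fin: "finite ?V" by (rule finite_log_window)
    show ?case
    proof (rule ccontr)
      assume no: "\<not> ?case"
      let ?A = "{n::nat. primepow n \<and> \<not> prime n \<and> real n \<le> x}"
      have x1: "x \<ge> 1" using elim by simp
      have summand: "?a n / real n \<le> (if n \<in> ?A then 2 ^ card P * (2 * (ln x / x)) else 0)" if n: "n \<in> ?V" for n
      proof (cases "n \<in> ?A")
        case True
        have "?a n \<le> ln (real n) * 2 ^ card P"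
          using mangoldt_le_ln[of n] nonresidue_weight_bounds[OF P, of n] V[OF n] by (intro mult_mono) (auto simp: Suc_le_eq)
        also have "\<dots> \<le> ln x * 2 ^ card P" using V[OF n] by (intro mult_right_mono) auto
        finally have "?a n / real n \<le> ln x * 2 ^ card P / (x / 2)"
          using V[OF n] x1 a0[of n] by (intro frac_le) auto
        then show ?thesis using True by (simp add: mult_ac)
      next
        case False
        have "?a n = 0"
        proof (cases "primepow n")
          case True
          then have "prime n" using False V[OF n] by auto
          then obtain r where r: "r \<in> P" "[n = 1] (mod r)" using no V[OF n] by blast
          have "legendre_char r n = 1"
            using legendre_char_cong[OF r(2)] legendre_char_sign_character P(2)[OF r(1)] by (auto simp: sign_character_def)
          then have "nonresidue_weight P n = 0" unfolding nonresidue_weight_def using r(1) P(1) by (intro prod_zero) auto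
          then show ?thesis by simp
        qed (simp add: mangoldt_def)
        with False show ?thesis by (simp only: if_False div_0 order_refl)
      qed
      have "(\<Sum>n\<in>?V. ?a n / real n) \<le> (\<Sum>n\<in>?V. if n \<in> ?A then 2 ^ card P * (2 * (ln x / x)) else 0)"
        by (rule sum_mono) (rule summand)
      also have "\<dots> = (\<Sum>n\<in>?V \<inter> ?A. 2 ^ card P * (2 * (ln x / x)))"
        by (rule sum.inter_restrict[OF fin, symmetric])
      also have "\<dots> = real (card (?V \<inter> ?A)) * (2 ^ card P * (2 * (ln x / x)))" by simp
      also have "\<dots> \<le> ((sqrt x + 1) * (log 2 x + 1)) * (2 ^ card P * (2 * (ln x / x)))"
      proof (rule mult_right_mono)
        have "card (?V \<inter> ?A) \<le> card ?A" by (rule card_mono[OF card_proper_prime_powers(1)[OF x1]]) auto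
        then show "real (card (?V \<inter> ?A)) \<le> (sqrt x + 1) * (log 2 x + 1)"
          using card_proper_prime_powers(2)[OF x1] by linarith
      qed (use x1 in auto)
      also have "\<dots> = 2 ^ card P * (2 * ((sqrt x + 1) * (log 2 x + 1) * ln x / x))" by simp
      also have "\<dots> < c" by (rule elim)
      finally show False using elim by linarith
    qed
  qed
qed

section \<open>Divisibility of the product\<close>

text \<open>As l is odd, the hypothesis reads k^l = (-q)^l modulo p. An inverse u of l modulo p - 1
  undoes the l-th power by Fermat's theorem, giving k = -q.\<close>

lemma root_mod_unique:
  fixes k p q l :: nat
  assumes p: "prime p" "coprime l (p - 1)" and l: "odd l" and q: "\<not> p dvd q" and d: "p dvd k ^ l + q ^ l"
  shows "p dvd k + q"
proof -
  have pk: "\<not> p dvd k"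
  proof
    assume "p dvd k"
    then have "p dvd k ^ l" using l by (intro dvd_trans[OF _ dvd_power]) (auto intro: odd_pos)
    then have "p dvd q ^ l" using d by (simp add: dvd_add_right_iff)
    then show False using q p(1) prime_dvd_power by blast
  qed
  have l0: "l > 0" using l by (rule odd_pos)
  have c: "[int k ^ l = (- int q) ^ l] (mod int p)"
  proof -
    have "int p dvd int (k ^ l + q ^ l)" using d by (simp only: int_dvd_int_iff)
    then show ?thesis using l by (simp add: cong_iff_dvd_diff)
  qed
  have "\<exists>u v. l * u = (p - 1) * v + 1"
  \<comment> \<open>The strong Bezout lemma excludes modulus 1, so p = 2 gets an explicit
    solution.\<close>
  proof (cases "p - 1 = 1")
    case True
    then have "l * 1 = (p - 1) * (l - 1) + 1" using l0 by simp
    then show ?thesis by blast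
  next
    case False
    then show ?thesis using coprime_bezout_strong[OF p(2)] by blast
  qed
  then obtain u v where uv: "l * u = (p - 1) * v + 1" by blast
  have fermat: "[x ^ (l * u) = x] (mod int p)" if x: "\<not> int p dvd x" for x :: int
  proof -
    have "[x ^ (p - 1) = 1] (mod int p)"
    proof -
      define y where "y = nat (x mod int p)"
      have y: "int y = x mod int p" using p(1) prime_gt_0_nat by (simp add: y_def)
      have "\<not> p dvd y"
      proof
        assume "p dvd y"
        then have "int p dvd x mod int p" unfolding y[symmetric] by simp
        then show False using x by (simp add: dvd_mod_iff)
      qed
      then have "[y ^ (p - 1) = 1] (mod p)" by (rule fermat_theorem[OF p(1)])
      then have "[int y ^ (p - 1) = 1] (mod int p)" using cong_int_iff[of "y ^ (p - 1)" 1 p] by simp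
      then show ?thesis unfolding y by (simp add: cong_def power_mod)
    qed
    then have "[(x ^ (p - 1)) ^ v * x = 1 ^ v * x] (mod int p)" by (intro cong_mult cong_pow) auto
    then show ?thesis unfolding uv power_add power_mult by simp
  qed
  have "[(int k ^ l) ^ u = ((- int q) ^ l) ^ u] (mod int p)" using c by (rule cong_pow)
  then have "[int k ^ (l * u) = (- int q) ^ (l * u)] (mod int p)" by (simp add: power_mult)
  moreover have "[int k ^ (l * u) = int k] (mod int p)" using pk by (intro fermat) simp
  moreover have "[(- int q) ^ (l * u) = - int q] (mod int p)" using q by (intro fermat) simp
  ultimately have "[int k = - int q] (mod int p)" unfolding cong_def by simp
  then have "int p dvd int (k + q)" by (simp add: cong_iff_dvd_diff)
  then show ?thesis by (simp only: int_dvd_int_iff)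
qed

lemma square_not_dvd_term:
  fixes k p q l :: nat
  assumes p: "prime p" and l: "odd l" and pl: "\<not> p dvd l" "\<not> p dvd q" and k: "k + q = p"
  shows "\<not> p\<^sup>2 dvd k ^ l + q ^ l"
proof
  assume "p\<^sup>2 dvd k ^ l + q ^ l"
  then have 1: "int p ^ 2 dvd int k ^ l + int q ^ l" by (metis of_nat_add of_nat_dvd_iff of_nat_power)
  have k': "int k = int p - int q" using k by linarith
  \<comment> \<open>Binomial expansion in p, truncated after the linear term. At m = 0 the truncated
    exponent \<open>m - 1\<close> is multiplied by 0.\<close>
  have "int p ^ 2 dvd (int p - int q) ^ m - ((- int q) ^ m + int m * int p * (- int q) ^ (m - 1))" for m
  proof (induction m)
    case (Suc m)
    have "(int p - int q) ^ Suc m - ((- int q) ^ Suc m + int (Suc m) * int p * (- int q) ^ m) =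
      (int p - int q) * ((int p - int q) ^ m - ((- int q) ^ m + int m * int p * (- int q) ^ (m - 1)))
      + int p ^ 2 * (int m * (- int q) ^ (m - 1))"
      by (cases m) (auto simp: algebra_simps power2_eq_square)
    then show ?case using Suc by simp
  qed simp
  from this[of l] have "int p ^ 2 dvd (int k ^ l + int q ^ l) - int l * int p * (- int q) ^ (l - 1)"
    using l unfolding k' by (simp add: algebra_simps)
  then have "int p ^ 2 dvd int l * int p * (- int q) ^ (l - 1)" using 1 by (simp add: dvd_diff_right_iff)
  moreover have "(- int q) ^ (l - 1) = int q ^ (l - 1)" using l by simp
  ultimately have "int p * int p dvd int p * (int l * int q ^ (l - 1))" by (simp add: power2_eq_square mult_ac)
  then have "int p dvd int (l * q ^ (l - 1))" using p prime_gt_0_nat by simp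
  then have "p dvd l * q ^ (l - 1)" by (simp only: int_dvd_int_iff)
  then show False using p pl prime_dvd_mult_iff prime_dvd_power by blast
qed

theorem theorem2:
  fixes q l :: nat
  assumes "q > 0" and "l > 0" and "odd l"
  shows "\<exists>N :: int. \<forall>n :: nat. n > 0 \<longrightarrow> int n \<ge> N \<longrightarrow>
           \<not> powerful (\<Prod>k = 1..n. (k ^ l + q ^ l))"
proof -
  define P where "P = prime_factors l"
  have P: "finite P" "\<And>r. r \<in> P \<Longrightarrow> prime r \<and> 2 < r"
  proof -
    fix r assume "r \<in> P"
    then have r: "prime r" "r dvd l" by (auto simp: P_def)
    then have "r \<noteq> 2" using \<open>odd l\<close> by auto
    then show "prime r \<and> 2 < r" using r prime_ge_2_nat[of r] by auto
  qed (simp add: P_def)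
  obtain X where X: "\<And>x. x \<ge> X \<Longrightarrow> \<exists>p. prime p \<and> x / 2 < real p \<and> real p \<le> x \<and> (\<forall>r\<in>P. \<not> [p = 1] (mod r))"
    using ex_prime_avoiding[OF P] unfolding eventually_at_top_linorder by blast
  \<comment> \<open>Beyond N, n + q exceeds X as well as 2 l and 2 q; a prime above (n + q) / 2 is
    then larger than l and q and divides neither.\<close>
  define N where "N = nat \<lceil>X\<rceil> + 2 * l + 2 * q"
  have "\<not> powerful (\<Prod>k = 1..n. (k ^ l + q ^ l))" if n: "n > 0" "int n \<ge> int N" for n
  proof -
    have "real (n + q) \<ge> X" using n(2) unfolding N_def by linarith
    from X[OF this] obtain p where p: "prime p" "real (n + q) / 2 < real p" "real p \<le> real (n + q)"
      "\<And>r. r \<in> P \<Longrightarrow> \<not> [p = 1] (mod r)" by blast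
    have pn: "n + q < 2 * p" "p \<le> n + q"
    proof -
      have "real (n + q) < real (2 * p)" using p(2) by simp
      then show "n + q < 2 * p" by (simp only: of_nat_less_iff)
      show "p \<le> n + q" using p(3) by (simp only: of_nat_le_iff)
    qed
    have "l < p" "q < p" using pn(1) n(2) unfolding N_def by linarith+
    then have nd: "\<not> p dvd l" "\<not> p dvd q" using assms by (auto dest: dvd_imp_le)
    have cop: "coprime l (p - 1)"
    proof (rule ccontr)
      assume "\<not> coprime l (p - 1)"
      then obtain r where r': "prime r" "r dvd gcd l (p - 1)"
        using prime_factor_nat[of "gcd l (p - 1)"] unfolding coprime_iff_gcd_eq_1 by blast
      then have r: "prime r" "r dvd l" "r dvd p - 1" by auto
      have "r \<in> P" using r assms by (simp add: P_def prime_factors_dvd)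
      moreover have "[p = 1] (mod r)" using r(3) prime_gt_0_nat[OF p(1)] by (simp add: cong_altdef_nat)
      ultimately show False using p(4) by blast
    qed
    define k0 where "k0 = p - q"
    have k0: "k0 + q = p" "k0 \<in> {1..n}" using \<open>q < p\<close> pn by (auto simp: k0_def)
    let ?t = "\<lambda>k. k ^ l + q ^ l"
    have others: "\<not> p dvd ?t k" if k: "k \<in> {1..n} - {k0}" for k
    proof
      assume "p dvd ?t k"
      then have "p dvd k + q" by (rule root_mod_unique[OF p(1) cop \<open>odd l\<close> nd(2)])
      then obtain j where j: "k + q = p * j" by blast
      have "j \<noteq> 0" using j k by (intro notI) simp
      moreover have "j < 2"
      proof (rule ccontr)
        assume "\<not> j < 2"
        then have "p * 2 \<le> p * j" by (intro mult_left_mono) auto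
        moreover have "k \<le> n" using k by simp
        ultimately show False using j pn(1) by linarith
      qed
      ultimately have "j = 1" by linarith
      then show False using j k k0 by simp
    qed
    have split: "(\<Prod>k = 1..n. ?t k) = ?t k0 * (\<Prod>k\<in>{1..n} - {k0}. ?t k)"
      by (rule prod.remove) (use k0 in auto)
    have "\<not> p dvd (\<Prod>k\<in>{1..n} - {k0}. ?t k)"
      using others p(1) by (simp add: prime_dvd_prod_iff)
    then have "coprime (p\<^sup>2) (\<Prod>k\<in>{1..n} - {k0}. ?t k)" using p(1) prime_imp_coprime by auto
    then have "\<not> p\<^sup>2 dvd (\<Prod>k = 1..n. ?t k)"
      using square_not_dvd_term[OF p(1) \<open>odd l\<close> nd k0(1)] unfolding split by (simp add: coprime_dvd_mult_left_iff)
    moreover have "p dvd (\<Prod>k = 1..n. ?t k)"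
    proof -
      have "int k0 + int q dvd int k0 ^ l + int q ^ l"
      proof -
        have "int k0 - (- int q) dvd int k0 ^ l - (- int q) ^ l" unfolding power_diff_sumr2 by (rule dvd_triv_left)
        then show ?thesis using \<open>odd l\<close> by simp
      qed
      then have "p dvd ?t k0" using k0(1) by (metis of_nat_add of_nat_dvd_iff of_nat_power)
      then show ?thesis unfolding split by simp
    qed
    ultimately show ?thesis using p(1) unfolding powerful_def by blast
  qed
  then show ?thesis by blast
qed

end
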